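(* Let $\mathcal{K}_{168}\subset \mathrm{PGL}_3(\mathbf{C})$ be Klein's group of order $168$ acting on $\mathbf{CP}^2$, and let $h$ be the explicit degree-$15$ map of $\mathbf{CP}^2$ given in the context. Under $\mathcal{K}_{168}$, $h$ is the unique holomorphic equivariant map that is doubly critical exactly at the $21$-lines. That is, $h$ is a holomorphic $\mathcal{K}_{168}$-equivariant map of $\mathbf{CP}^2$ that is doubly critical exactly at the $21$-lines, and it is the only such map.
   Context: **The group.** Put $\theta=\frac{1+\sqrt{7}\,i}{2}$. In coordinates $x=(x_1,x_2,x_3)$ let $\mathcal{O}_7\subset \mathrm{SO}_3$ be the rotation group of the cube with vertices $(\pm1,\pm1,\pm1)$, i.e. the group of the $24$ signed $3\times 3$ permutation matrices of determinant $1$, and let $$Q=\frac12\begin{pmatrix}1&1&-\theta\\ 1&1&\theta\\ 1-\theta&\theta-1&0\end{pmatrix}.$$ $\mathcal{K}_{168}$ is the subgroup of $\mathrm{PGL}_3(\mathbf{C})$ generated by the images of $\mathcal{O}_7$ and $Q$. It has order $168$, is isomorphic to $\mathrm{PGL}_3(\mathbf{Z}/2)$, and contains exactly $21$ involutions. **$21$-lines.** The fixed-point set in $\mathbf{CP}^2$ of each involution of $\mathcal{K}_{168}$ consists of a projective line and one isolated point not on that line. The $21$ lines obtained in this way are called the $21$-lines. **Equivariant maps.** A map $g$ of $\mathbf{CP}^2$ is $\mathcal{K}_{168}$-equivariant if $g\circ T=T\circ g$ for all $T\in\mathcal{K}_{168}$. A holomorphic map $g:\mathbf{CP}^2\to\mathbf{CP}^2$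 is given by a triple $\hat g$ of homogeneous polynomials of the same degree $d$ with no common zero in $\mathbf{C}^3\setminus\{0\}$; $\hat g$ is determined by $g$ up to a nonzero constant. **Doubly critical.** Let $\ell_1,\dots,\ell_{21}$ be linear forms defining the $21$-lines. A holomorphic map $g$ with lift $\hat g$ is doubly critical exactly at the $21$-lines if its critical set is the union of the $21$-lines, each with multiplicity two: $\det J(\hat g)=c\prod_{i=1}^{21}\ell_i^2$ with $c\ne0$ constant, $J$ being the Jacobian matrix. (Such a map has degree $15$, since $\det J(\hat g)$ has degree $3(d-1)$.) **Coordinates $y$.** Use the homogeneous coordinates $[y_1,y_2,y_3]$ on $\mathbf{CP}^2$ in which the four points $[x_1,x_2,x_3]=[1,-1,1]$, $[1,-1-\theta,1]$, $[1+\theta,-1,1]$, $[1,-1,1+\theta]$ become respectively $[0,0,1]$, $[1,0,1]$, $[-\frac12,\frac{\sqrt3}{2},1]$, $[-\frac12,-\frac{\sqrt3}{2},1]$. Explicitly, $$x_1=-\theta y_1+\sqrt3\,\theta y_2+(3+\theta)y_3,\quad x_2=-2\theta y_1-(3+\theta)y_3,\quad x_3=-\theta y_1-\sqrt3\,\theta y_2+(3+\theta)y_3 .$$ **The map $h$.** It is found among the degree-$15$ equivariants by requiring the Jacobian determinant to vanish on the $21$-lines. In $y$ coordinates, $h=[\,27A,\ -27y_2^3B,\ C\,]$, where $A=816 y_1^{15}+4200 y_3 y_1^{14}-18960 y_2^2 y_1^{13}+1680 y_3^2 y_1^{13}+97020 y_3^3 y_1^{12}-68040 y_2^2 y_3 y_1^{12}-4640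 y_2^4 y_1^{11}-332955 y_3^4 y_1^{11}-150780 y_2^2 y_3^2 y_1^{11}-950796 y_3^5 y_1^{10}+776160 y_2^2 y_3^3 y_1^{10}+80080 y_2^4 y_3 y_1^{10}-96800 y_2^6 y_1^9-2716560 y_3^6 y_1^9-7858620 y_2^2 y_3^4 y_1^9+412720 y_2^4 y_3^2 y_1^9+2376990 y_3^7 y_1^8+679140 y_2^2 y_3^5 y_1^8-2651880 y_2^4 y_3^3 y_1^8+314160 y_2^6 y_3 y_1^8-34320 y_2^8 y_1^7-1188495 y_3^8 y_1^7-339570 y_2^2 y_3^6 y_1^7-9588810 y_2^4 y_3^4 y_1^7-1321320 y_2^6 y_3^2 y_1^7+11092620 y_3^9 y_1^6-1584660 y_2^4 y_3^5 y_1^6-1811040 y_2^6 y_3^3 y_1^6-120120 y_2^8 y_3 y_1^6+77616 y_2^{10} y_1^5+7764834 y_3^{10} y_1^5-83194650 y_2^2 y_3^8 y_1^5-5546310 y_2^4 y_3^6 y_1^5-1584660 y_2^6 y_3^4 y_1^5+776160 y_2^8 y_3^2 y_1^5-38824170 y_3^{11} y_1^4-11092620 y_2^2 y_3^9 y_1^4-7923300 y_2^4 y_3^7 y_1^4+7923300 y_2^6 y_3^5 y_1^4+743820 y_2^8 y_3^3 y_1^4-138600 y_2^{10} y_3 y_1^4+52689945 y_2^4 y_3^8 y_1^3-11884950 y_2^6 y_3^6 y_1^3+1754445 y_2^8 y_3^4 y_1^3-97020 y_2^{10} y_3^2 y_1^3+77648340 y_2^2 y_3^{11} y_1^2-25882780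 y_2^4 y_3^9 y_1^2-6338640 y_2^6 y_3^7 y_1^2+2716560 y_2^8 y_3^5 y_1^2-776160 y_2^{10} y_3^3 y_1^2+12941390 y_2^4 y_3^{10} y_1-11092620 y_2^6 y_3^8 y_1-3961650 y_2^8 y_3^6 y_1-1358280 y_2^{10} y_3^4 y_1+12941390 y_2^4 y_3^{11}-3697540 y_2^6 y_3^9-792330 y_2^8 y_3^7+271656 y_2^{10} y_3^5$, $B=24640 y_1^{12}+61600 y_3 y_1^{11}-8624 y_2^2 y_1^{10}+204820 y_3^2 y_1^{10}-1196580 y_3^3 y_1^9-154000 y_2^2 y_3 y_1^9+66000 y_2^4 y_1^8+7413945 y_3^4 y_1^8-582120 y_2^2 y_3^2 y_1^8-2942940 y_3^5 y_1^7+2587200 y_2^2 y_3^3 y_1^7-147840 y_2^4 y_3 y_1^7+26400 y_2^6 y_1^6+3961650 y_3^6 y_1^6+13809180 y_2^2 y_3^4 y_1^6+1265880 y_2^4 y_3^2 y_1^6+6338640 y_3^7 y_1^5-2852388 y_2^2 y_3^5 y_1^5+3039960 y_2^4 y_3^3 y_1^5+110880 y_2^6 y_3 y_1^5-76320 y_2^8 y_1^4+85967805 y_3^8 y_1^4+18223590 y_2^2 y_3^6 y_1^4+1730190 y_2^4 y_3^4 y_1^4-665280 y_2^6 y_3^2 y_1^4+29580320 y_3^9 y_1^3+12677280 y_2^2 y_3^7 y_1^3-10639860 y_2^4 y_3^5 y_1^3-258720 y_2^6 y_3^3 y_1^3+171360 y_2^8 y_3 y_1^3-2160 y_2^{10}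 y_1^2-25882780 y_3^{10} y_1^2-49916790 y_2^2 y_3^8 y_1^2+15507030 y_2^4 y_3^6 y_1^2-1067220 y_2^6 y_3^4 y_1^2+49140 y_2^8 y_3^2 y_1^2-103531120 y_3^{11} y_1+29580320 y_2^2 y_3^9 y_1+6338640 y_2^4 y_3^7 y_1-2037420 y_2^6 y_3^5 y_1+485100 y_2^8 y_3^3 y_1-15120 y_2^{10} y_3 y_1+1296 y_2^{12}-5176556 y_2^2 y_3^{10}+9904125 y_2^4 y_3^8+1245090 y_2^6 y_3^6+963585 y_2^8 y_3^4+7560 y_2^{10} y_3^2$, $C=-704 y_1^{15}+36960 y_3 y_1^{14}+10560 y_2^2 y_1^{13}+221760 y_3^2 y_1^{13}+560560 y_3^3 y_1^{12}-406560 y_2^2 y_3 y_1^{12}-63360 y_2^4 y_1^{11}+2651880 y_3^4 y_1^{11}-1552320 y_2^2 y_3^2 y_1^{11}-7844067 y_3^5 y_1^{10}-4107180 y_2^2 y_3^3 y_1^{10}+1552320 y_2^4 y_3 y_1^{10}+190080 y_2^6 y_1^9-23185085 y_3^6 y_1^9+18078060 y_2^2 y_3^4 y_1^9+2217600 y_2^4 y_3^2 y_1^9-68083785 y_3^7 y_1^8-199667160 y_2^2 y_3^5 y_1^8+12806640 y_2^4 y_3^3 y_1^8-1995840 y_2^6 y_3 y_1^8-285120 y_2^8 y_1^7+121226490 y_3^8 y_1^7-6791400 y_2^2 y_3^6 y_1^7-57047760 y_2^4 y_3^4 y_1^7+3991680 y_2^6 y_3^2 y_1^7-187914265 y_3^9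 y_1^6+24109470 y_2^2 y_3^7 y_1^6-292369770 y_2^4 y_3^5 y_1^6-26195400 y_2^6 y_3^3 y_1^6-997920 y_2^8 y_3 y_1^6+171072 y_2^{10} y_1^5+202440315 y_3^{10} y_1^5-121226490 y_2^2 y_3^8 y_1^5+164012310 y_2^4 y_3^6 y_1^5-61122600 y_2^6 y_3^4 y_1^5-5987520 y_2^8 y_3^2 y_1^5+150506685 y_3^{11} y_1^4-2402344560 y_2^2 y_3^9 y_1^4-309687840 y_2^4 y_3^7 y_1^4-42785820 y_2^6 y_3^5 y_1^4+27941760 y_2^8 y_3^3 y_1^4+2993760 y_2^{10} y_3 y_1^4-767071480 y_3^{12} y_1^3-404880630 y_2^2 y_3^{10} y_1^3-606132450 y_2^4 y_3^8 y_1^3+171143280 y_2^6 y_3^6 y_1^3-1746360 y_2^8 y_3^4 y_1^3-5987520 y_2^{10} y_3^2 y_1^3-141178800 y_3^{13} y_1^2+301013370 y_2^2 y_3^{11} y_1^2+661991715 y_2^4 y_3^9 y_1^2-437026590 y_2^6 y_3^7 y_1^2+32089365 y_2^8 y_3^5 y_1^2+2619540 y_2^{10} y_3^3 y_1^2+2301214440 y_2^2 y_3^{12} y_1-607320945 y_2^4 y_3^{10} y_1-363679470 y_2^6 y_3^8 y_1+71819055 y_2^8 y_3^6 y_1-13097700 y_2^{10} y_3^4 y_1+105413504 y_3^{15}-141178800 y_2^2 y_3^{13}+150506685 y_2^4 y_3^{11}-392203350 y_2^6 y_3^9-35145495 y_2^8 y_3^7-25671492 y_2^{10} y_3^5$.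 *)

theory Defs
  imports "HOL-Analysis.Analysis" "HOL-Algebra.Generated_Groups"
begin

text \<open>Points of the complex projective plane are the nonzero vectors of \<open>\<complex>\<^sup>3\<close> up to nonzero scalars.\<close>

quotient_type cp2 = "complex^3" /
  partial: "\<lambda>u v. u \<noteq> 0 \<and> (\<exists>c. c \<noteq> 0 \<and> v = c *s u)"
proof (rule part_equivpI)
  show "\<exists>u::complex^3. u \<noteq> 0 \<and> (\<exists>c. c \<noteq> 0 \<and> u = c *s u)"
    by (rule exI[of _ "axis 1 1"], rule conjI, simp add: axis_eq_0_iff, rule exI[of _ 1], simp)
  show "symp (\<lambda>u v::complex^3. u \<noteq> 0 \<and> (\<exists>c. c \<noteq> 0 \<and> v = c *s u))"
  proof (rule sympI)
    fix u v :: "complex^3"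
    assume "u \<noteq> 0 \<and> (\<exists>c. c \<noteq> 0 \<and> v = c *s u)"
    then obtain c where c: "u \<noteq> 0" "c \<noteq> 0" "v = c *s u" by blast
    then have "v \<noteq> 0" "u = inverse c *s v" by (simp_all add: vector_smult_assoc)
    then show "v \<noteq> 0 \<and> (\<exists>c. c \<noteq> 0 \<and> u = c *s v)"
      using c(2) nonzero_imp_inverse_nonzero by blast
  qed
  show "transp (\<lambda>u v::complex^3. u \<noteq> 0 \<and> (\<exists>c. c \<noteq> 0 \<and> v = c *s u))"
    by (rule transpI) (metis vector_smult_assoc no_zero_divisors)
qed

text \<open>\<open>cp2_pt v\<close> is the point \<open>[v\<^sub>1, v\<^sub>2, v\<^sub>3]\<close>; it is meaningful only for \<open>v \<noteq> 0\<close>.\<close>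

definition cp2_pt :: "complex^3 \<Rightarrow> cp2" where
  "cp2_pt = abs_cp2"

lemma cp2_pt_eq_iff:
  assumes "u \<noteq> 0" "v \<noteq> 0"
  shows "cp2_pt u = cp2_pt v \<longleftrightarrow> (\<exists>c. c \<noteq> 0 \<and> v = c *s u)"
proof -
  have r: "w \<noteq> 0 \<and> (\<exists>c. c \<noteq> 0 \<and> w = c *s w)" if "w \<noteq> 0" for w :: "complex^3"
    using that by (metis vector_smult_lid zero_neq_one)
  show ?thesis
    unfolding cp2_pt_def using Quotient_rel[OF Quotient_cp2, of u v] r[OF assms(1)] r[OF assms(2)] assms
    by blast
qed

lemma cp2_pt_cases: obtains v where "v \<noteq> 0" "p = cp2_pt v"
  using Quotient_abs_rep[OF Quotient_cp2, of p] Quotient_rep_reflp[OF Quotient_cp2, of p]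
  unfolding cp2_pt_def by metis

definition GL3 :: "(complex^3^3) monoid" where
  "GL3 = \<lparr>carrier = {A. invertible A}, mult = (**), one = mat 1\<rparr>"

definition scalar_mats :: "(complex^3^3) set" where
  "scalar_mats = {mat c | c. c \<noteq> 0}"

definition PGL3 :: "(complex^3^3) set monoid" where
  "PGL3 = GL3 Mod scalar_mats"

definition to_PGL3 :: "complex^3^3 \<Rightarrow> (complex^3^3) set" where
  "to_PGL3 A = scalar_mats #>\<^bsub>GL3\<^esub> A"

text \<open>The action of a class of matrices does not depend on the representatives; see
  \<open>pgl_act_to_PGL3\<close> below.\<close>

definition pgl_act :: "(complex^3^3) set \<Rightarrow> cp2 \<Rightarrow> cp2" where
  "pgl_act T p = (THE q. \<exists>A\<in>T. \<exists>v. v \<noteq> 0 \<and> p = cp2_pt v \<and> q = cp2_pt (A *v v))"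

lemma mat_scalar_mult: "mat c ** A = (\<chi> i j. c * (A $ i $ j))" for A :: "complex^3^3"
  by (simp add: matrix_matrix_mult_def mat_def vec_eq_iff if_distrib[of "\<lambda>x. x * _"] sum.delta' cong: if_cong)

lemma mat_scalar_commute: "mat c ** A = A ** mat c" for A :: "complex^3^3"
  by (simp add: matrix_matrix_mult_def mat_def vec_eq_iff if_distrib[of "\<lambda>x. x * _"]
      if_distrib[of "\<lambda>x. _ * x"] sum.delta sum.delta' mult.commute cong: if_cong)

lemma mat_scalar_mult_vec: "(mat c ** A) *v v = c *s (A *v v)" for A :: "complex^3^3"
  by (simp add: mat_scalar_mult matrix_vector_mult_def vec_eq_iff sum_distrib_left mult.assoc)

lemma mat_mult_mat: "mat a ** mat b = (mat (a * b) :: complex^3^3)"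
  by (simp add: mat_scalar_mult) (simp add: mat_def vec_eq_iff)

lemma invertible_mat: "c \<noteq> 0 \<Longrightarrow> invertible (mat c :: complex^3^3)"
  unfolding invertible_def by (rule exI[of _ "mat (inverse c)"]) (simp add: mat_mult_mat)

lemma group_GL3: "group GL3"
proof (rule groupI)
  fix A assume "A \<in> carrier GL3"
  then obtain B where "A ** B = mat 1" "B ** A = mat 1"
    by (auto simp: GL3_def invertible_def)
  then show "\<exists>B\<in>carrier GL3. B \<otimes>\<^bsub>GL3\<^esub> A = \<one>\<^bsub>GL3\<^esub>"
    by (auto simp: GL3_def invertible_def)
qed (auto simp: GL3_def invertible_mult matrix_mul_assoc invertible_mat)

lemma normal_scalar_mats: "scalar_mats \<lhd> GL3"
proof -
  interpret group GL3 by (rule group_GL3)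
  have "subgroup scalar_mats GL3"
  proof (rule subgroupI)
    show "scalar_mats \<subseteq> carrier GL3"
      by (auto simp: scalar_mats_def GL3_def invertible_mat)
    show "scalar_mats \<noteq> {}"
      unfolding scalar_mats_def using zero_neq_one by blast
  next
    fix a assume "a \<in> scalar_mats"
    then obtain c where c: "c \<noteq> 0" "a = mat c" by (auto simp: scalar_mats_def)
    have "inv\<^bsub>GL3\<^esub> a = mat (inverse c)"
      by (rule inv_equality) (use c in \<open>auto simp: GL3_def mat_mult_mat invertible_mat\<close>)
    then show "inv\<^bsub>GL3\<^esub> a \<in> scalar_mats"
      using c(1) by (auto simp: scalar_mats_def)
  next
    fix a b assume "a \<in> scalar_mats" "b \<in> scalar_mats"
    then obtain c d where "c \<noteq> 0" "a = mat c" "d \<noteq> 0" "b = mat d" by (auto simp: scalar_mats_def)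
    then show "a \<otimes>\<^bsub>GL3\<^esub> b \<in> scalar_mats"
      unfolding scalar_mats_def GL3_def by (auto simp: mat_mult_mat intro!: exI[of _ "c * d"])
  qed
  moreover have "scalar_mats #>\<^bsub>GL3\<^esub> A = A <#\<^bsub>GL3\<^esub> scalar_mats" for A
    unfolding r_coset_def l_coset_def scalar_mats_def GL3_def
    by (auto simp: mat_scalar_commute)
  ultimately show ?thesis
    by (simp add: normal_def normal_axioms_def group_GL3)
qed

lemma pgl_act_to_PGL3:
  assumes "invertible A" "v \<noteq> 0"
  shows "pgl_act (to_PGL3 A) (cp2_pt v) = cp2_pt (A *v v)"
proof -
  have nz: "A *v w \<noteq> 0" if "w \<noteq> 0" for w
    using assms(1) that by (metis invertible_def matrix_vector_mul_assoc matrix_vector_mul_lid matrix_vector_mult_0_right)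
  have coset: "B \<in> to_PGL3 A \<longleftrightarrow> (\<exists>c. c \<noteq> 0 \<and> B = mat c ** A)" for B
    by (auto simp: to_PGL3_def r_coset_def scalar_mats_def GL3_def)
  show ?thesis
    unfolding pgl_act_def
  proof (rule the_equality)
    have "A \<in> to_PGL3 A" unfolding coset by (rule exI[of _ 1]) simp
    then show "\<exists>B\<in>to_PGL3 A. \<exists>w. w \<noteq> 0 \<and> cp2_pt v = cp2_pt w \<and> cp2_pt (A *v v) = cp2_pt (B *v w)"
      using assms(2) by blast
  next
    fix q assume "\<exists>B\<in>to_PGL3 A. \<exists>w. w \<noteq> 0 \<and> cp2_pt v = cp2_pt w \<and> q = cp2_pt (B *v w)"
    then obtain B w where B: "B \<in> to_PGL3 A" and w: "w \<noteq> 0" "cp2_pt v = cp2_pt w"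
      and q': "q = cp2_pt (B *v w)" by (elim bexE exE conjE)
    obtain c where c: "c \<noteq> 0" "B = mat c ** A" using B[unfolded coset] by (elim exE conjE)
    have q: "q = cp2_pt ((mat c ** A) *v w)" using q' c(2) by simp
    obtain d where d: "d \<noteq> 0" "w = d *s v" using w(2)[unfolded cp2_pt_eq_iff[OF assms(2) w(1)]] by (elim exE conjE)
    have "(mat c ** A) *v w = (c * d) *s (A *v v)"
      by (simp add: mat_scalar_mult_vec d(2) vector_scalar_commute vector_smult_assoc)
    moreover have "cp2_pt (A *v v) = cp2_pt ((c * d) *s (A *v v))"
      using c d nz[OF assms(2)] by (subst cp2_pt_eq_iff) auto
    ultimately show "q = cp2_pt (A *v v)" using q by simp
  qed
qed

definition klein_theta :: complex where
  "klein_theta = (1 + complex_of_real (sqrt 7) * \<i>) / 2"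

text \<open>The signed permutation matrices of determinant 1.\<close>

definition cube_group :: "(complex^3^3) set" where
  "cube_group = {A. det A = 1 \<and>
     (\<exists>s e. s permutes (UNIV :: 3 set) \<and> (\<forall>i. e i \<in> {1, -1}) \<and>
        A = (\<chi> i j. if j = s i then e i else 0))}"

definition klein_Q :: "complex^3^3" where
  "klein_Q = (1/2) *\<^sub>R vector
     [vector [1, 1, - klein_theta],
      vector [1, 1, klein_theta],
      vector [1 - klein_theta, klein_theta - 1, 0]]"

lemma klein_theta_sq: "klein_theta * klein_theta = klein_theta - 2"
  by (simp add: klein_theta_def complex_eq_iff field_simps)

lemma det_klein_Q: "det klein_Q = 1"
proof -
  have s: "klein_theta * (klein_theta * x) = klein_theta * x - 2 * x" for x
    using klein_theta_sq by (metis left_diff_distrib mult.assoc)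
  show ?thesis
    unfolding klein_Q_def det_3 vector_scaleR_component vector_3
    by (simp add: scaleR_conv_of_real field_simps klein_theta_sq s)
qed

definition K168 :: "(complex^3^3) set set" where
  "K168 = generate PGL3 (to_PGL3 ` (cube_group \<union> {klein_Q}))"

definition K168_involutions :: "(complex^3^3) set set" where
  "K168_involutions = {T \<in> K168. T \<noteq> \<one>\<^bsub>PGL3\<^esub> \<and> T \<otimes>\<^bsub>PGL3\<^esub> T = \<one>\<^bsub>PGL3\<^esub>}"

definition lin_form :: "complex^3 \<Rightarrow> complex^3 \<Rightarrow> complex" where
  "lin_form l v = (\<Sum>i\<in>UNIV. l $ i * v $ i)"

definition zero_line :: "complex^3 \<Rightarrow> cp2 set" where
  "zero_line l = {cp2_pt v | v. v \<noteq> 0 \<and> lin_form l v = 0}"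

definition cp2_line :: "cp2 set \<Rightarrow> bool" where
  "cp2_line L \<longleftrightarrow> (\<exists>l. l \<noteq> 0 \<and> L = zero_line l)"

definition lines21 :: "cp2 set set" where
  "lines21 = {L. cp2_line L \<and>
     (\<exists>T\<in>K168_involutions. \<exists>p. p \<notin> L \<and> {q. pgl_act T q = q} = L \<union> {p})}"

definition K168_equivariant :: "(cp2 \<Rightarrow> cp2) \<Rightarrow> bool" where
  "K168_equivariant g \<longleftrightarrow> (\<forall>T\<in>K168. g \<circ> pgl_act T = pgl_act T \<circ> g)"

text \<open>A homogeneous polynomial in three variables is represented by its function on \<open>\<complex>\<^sup>3\<close>;
  over the infinite field of complex numbers this loses no information.\<close>

definition homog_poly :: "nat \<Rightarrow> (complex^3 \<Rightarrow> complex) \<Rightarrow> bool" where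
  "homog_poly d p \<longleftrightarrow> (\<exists>a :: nat \<Rightarrow> nat \<Rightarrow> complex. \<forall>v.
     p v = (\<Sum>i\<le>d. \<Sum>j\<le>d - i. a i j * (v$1)^i * (v$2)^j * (v$3)^(d - i - j)))"

text \<open>A holomorphic self-map of the plane is given by a triple of homogeneous polynomials of the same
  degree without common zero in \<open>\<complex>\<^sup>3 - {0}\<close>.\<close>

definition is_lift :: "nat \<Rightarrow> (complex^3 \<Rightarrow> complex^3) \<Rightarrow> (cp2 \<Rightarrow> cp2) \<Rightarrow> bool" where
  "is_lift d F g \<longleftrightarrow>
     (\<forall>i. homog_poly d (\<lambda>v. F v $ i)) \<and>
     (\<forall>v. v \<noteq> 0 \<longrightarrow> F v \<noteq> 0) \<and>
     (\<forall>v. v \<noteq> 0 \<longrightarrow> g (cp2_pt v) = cp2_pt (F v))"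

definition holomorphic_cp2 :: "(cp2 \<Rightarrow> cp2) \<Rightarrow> bool" where
  "holomorphic_cp2 g \<longleftrightarrow> (\<exists>d F. is_lift d F g)"

text \<open>The entries are the complex partial derivatives \<open>\<partial>F\<^sub>i/\<partial>v\<^sub>j\<close>.\<close>

definition jacobian_mat :: "(complex^3 \<Rightarrow> complex^3) \<Rightarrow> complex^3 \<Rightarrow> complex^3^3" where
  "jacobian_mat F v = (\<chi> i j. deriv (\<lambda>t. F (v + t *s axis j 1) $ i) 0)"

text \<open>The forms \<open>l 1, \<dots>, l 21\<close> define the lines of \<open>lines21\<close>, each exactly once. A lift is determined by
  \<open>g\<close> up to a nonzero constant, so the condition does not depend on the lift chosen.\<close>

definition doubly_critical_at_lines21 :: "(cp2 \<Rightarrow> cp2) \<Rightarrow> bool" where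
  "doubly_critical_at_lines21 g \<longleftrightarrow> (\<exists>d F. is_lift d F g \<and>
     (\<exists>(l :: nat \<Rightarrow> complex^3) c.
        (\<forall>i\<in>{1..21}. l i \<noteq> 0) \<and> bij_betw (\<lambda>i. zero_line (l i)) {1..21} lines21 \<and> c \<noteq> 0 \<and>
        (\<forall>v. det (jacobian_mat F v) = c * (\<Prod>i=1..21. (lin_form (l i) v)^2))))"

text \<open>\<open>y_to_x *v y\<close> are the \<open>x\<close>-coordinates of the point with \<open>y\<close>-coordinates \<open>y\<close>.\<close>

definition y_to_x :: "complex^3^3" where
  "y_to_x = vector
     [vector [- klein_theta, complex_of_real (sqrt 3) * klein_theta, 3 + klein_theta],
      vector [- 2 * klein_theta, 0, - (3 + klein_theta)],
      vector [- klein_theta, - complex_of_real (sqrt 3) * klein_theta, 3 + klein_theta]]"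

lemma y_to_x_points:
  "y_to_x *v vector [0, 0, 1] = (3 + klein_theta) *s vector [1, -1, 1]"
  "y_to_x *v vector [1, 0, 1] = 3 *s vector [1, -1 - klein_theta, 1]"
  "y_to_x *v vector [-1/2, complex_of_real (sqrt 3) / 2, 1] = 3 *s vector [1 + klein_theta, -1, 1]"
  "y_to_x *v vector [-1/2, - complex_of_real (sqrt 3) / 2, 1] = 3 *s vector [1, -1, 1 + klein_theta]"
proof -
  have s: "complex_of_real (sqrt 3) * complex_of_real (sqrt 3) = 3"
    by (simp flip: of_real_mult)
  have s': "complex_of_real (sqrt 3) * (complex_of_real (sqrt 3) * x) = 3 * x" for x
    by (simp flip: mult.assoc add: s)
  show "y_to_x *v vector [0, 0, 1] = (3 + klein_theta) *s vector [1, -1, 1]"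
    "y_to_x *v vector [1, 0, 1] = 3 *s vector [1, -1 - klein_theta, 1]"
    "y_to_x *v vector [-1/2, complex_of_real (sqrt 3) / 2, 1] = 3 *s vector [1 + klein_theta, -1, 1]"
    "y_to_x *v vector [-1/2, - complex_of_real (sqrt 3) / 2, 1] = 3 *s vector [1, -1, 1 + klein_theta]"
    by (simp_all add: y_to_x_def matrix_vector_mult_def sum_3 vec_eq_iff forall_3 vector_3
        algebra_simps s s')
qed

lemma invertible_y_to_x: "invertible y_to_x"
proof -
  have "det y_to_x = 6 * complex_of_real (sqrt 3) * klein_theta ^ 2 * (3 + klein_theta)"
    by (simp add: y_to_x_def det_3 vector_3 algebra_simps power2_eq_square)
  moreover have "klein_theta \<noteq> 0" "3 + klein_theta \<noteq> 0"
    by (simp_all add: klein_theta_def complex_eq_iff)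
  ultimately show ?thesis by (simp add: invertible_det_nz)
qed

definition klein_A :: "complex \<Rightarrow> complex \<Rightarrow> complex \<Rightarrow> complex" where
  "klein_A y1 y2 y3 =
    816 * y1^15 + 4200 * y3 * y1^14 - 18960 * y2^2 * y1^13 + 1680 * y3^2 * y1^13
     + 97020 * y3^3 * y1^12 - 68040 * y2^2 * y3 * y1^12 - 4640 * y2^4 * y1^11
     - 332955 * y3^4 * y1^11 - 150780 * y2^2 * y3^2 * y1^11 - 950796 * y3^5 * y1^10
     + 776160 * y2^2 * y3^3 * y1^10 + 80080 * y2^4 * y3 * y1^10 - 96800 * y2^6 * y1^9
     - 2716560 * y3^6 * y1^9 - 7858620 * y2^2 * y3^4 * y1^9 + 412720 * y2^4 * y3^2 * y1^9
     + 2376990 * y3^7 * y1^8 + 679140 * y2^2 * y3^5 * y1^8 - 2651880 * y2^4 * y3^3 * y1^8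
     + 314160 * y2^6 * y3 * y1^8 - 34320 * y2^8 * y1^7 - 1188495 * y3^8 * y1^7
     - 339570 * y2^2 * y3^6 * y1^7 - 9588810 * y2^4 * y3^4 * y1^7 - 1321320 * y2^6 * y3^2 * y1^7
     + 11092620 * y3^9 * y1^6 - 1584660 * y2^4 * y3^5 * y1^6 - 1811040 * y2^6 * y3^3 * y1^6
     - 120120 * y2^8 * y3 * y1^6 + 77616 * y2^10 * y1^5 + 7764834 * y3^10 * y1^5
     - 83194650 * y2^2 * y3^8 * y1^5 - 5546310 * y2^4 * y3^6 * y1^5 - 1584660 * y2^6 * y3^4 * y1^5
     + 776160 * y2^8 * y3^2 * y1^5 - 38824170 * y3^11 * y1^4 - 11092620 * y2^2 * y3^9 * y1^4
     - 7923300 * y2^4 * y3^7 * y1^4 + 7923300 * y2^6 * y3^5 * y1^4 + 743820 * y2^8 * y3^3 * y1^4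
     - 138600 * y2^10 * y3 * y1^4 + 52689945 * y2^4 * y3^8 * y1^3 - 11884950 * y2^6 * y3^6 * y1^3
     + 1754445 * y2^8 * y3^4 * y1^3 - 97020 * y2^10 * y3^2 * y1^3 + 77648340 * y2^2 * y3^11 * y1^2
     - 25882780 * y2^4 * y3^9 * y1^2 - 6338640 * y2^6 * y3^7 * y1^2 + 2716560 * y2^8 * y3^5 * y1^2
     - 776160 * y2^10 * y3^3 * y1^2 + 12941390 * y2^4 * y3^10 * y1 - 11092620 * y2^6 * y3^8 * y1
     - 3961650 * y2^8 * y3^6 * y1 - 1358280 * y2^10 * y3^4 * y1 + 12941390 * y2^4 * y3^11
     - 3697540 * y2^6 * y3^9 - 792330 * y2^8 * y3^7 + 271656 * y2^10 * y3^5"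

definition klein_B :: "complex \<Rightarrow> complex \<Rightarrow> complex \<Rightarrow> complex" where
  "klein_B y1 y2 y3 =
    24640 * y1^12 + 61600 * y3 * y1^11 - 8624 * y2^2 * y1^10 + 204820 * y3^2 * y1^10
     - 1196580 * y3^3 * y1^9 - 154000 * y2^2 * y3 * y1^9 + 66000 * y2^4 * y1^8
     + 7413945 * y3^4 * y1^8 - 582120 * y2^2 * y3^2 * y1^8 - 2942940 * y3^5 * y1^7
     + 2587200 * y2^2 * y3^3 * y1^7 - 147840 * y2^4 * y3 * y1^7 + 26400 * y2^6 * y1^6
     + 3961650 * y3^6 * y1^6 + 13809180 * y2^2 * y3^4 * y1^6 + 1265880 * y2^4 * y3^2 * y1^6
     + 6338640 * y3^7 * y1^5 - 2852388 * y2^2 * y3^5 * y1^5 + 3039960 * y2^4 * y3^3 * y1^5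
     + 110880 * y2^6 * y3 * y1^5 - 76320 * y2^8 * y1^4 + 85967805 * y3^8 * y1^4
     + 18223590 * y2^2 * y3^6 * y1^4 + 1730190 * y2^4 * y3^4 * y1^4 - 665280 * y2^6 * y3^2 * y1^4
     + 29580320 * y3^9 * y1^3 + 12677280 * y2^2 * y3^7 * y1^3 - 10639860 * y2^4 * y3^5 * y1^3
     - 258720 * y2^6 * y3^3 * y1^3 + 171360 * y2^8 * y3 * y1^3 - 2160 * y2^10 * y1^2
     - 25882780 * y3^10 * y1^2 - 49916790 * y2^2 * y3^8 * y1^2 + 15507030 * y2^4 * y3^6 * y1^2
     - 1067220 * y2^6 * y3^4 * y1^2 + 49140 * y2^8 * y3^2 * y1^2 - 103531120 * y3^11 * y1
     + 29580320 * y2^2 * y3^9 * y1 + 6338640 * y2^4 * y3^7 * y1 - 2037420 * y2^6 * y3^5 * y1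
     + 485100 * y2^8 * y3^3 * y1 - 15120 * y2^10 * y3 * y1 + 1296 * y2^12 - 5176556 * y2^2 * y3^10
     + 9904125 * y2^4 * y3^8 + 1245090 * y2^6 * y3^6 + 963585 * y2^8 * y3^4 + 7560 * y2^10 * y3^2"

definition klein_C :: "complex \<Rightarrow> complex \<Rightarrow> complex \<Rightarrow> complex" where
  "klein_C y1 y2 y3 =
    - 704 * y1^15 + 36960 * y3 * y1^14 + 10560 * y2^2 * y1^13 + 221760 * y3^2 * y1^13
     + 560560 * y3^3 * y1^12 - 406560 * y2^2 * y3 * y1^12 - 63360 * y2^4 * y1^11
     + 2651880 * y3^4 * y1^11 - 1552320 * y2^2 * y3^2 * y1^11 - 7844067 * y3^5 * y1^10
     - 4107180 * y2^2 * y3^3 * y1^10 + 1552320 * y2^4 * y3 * y1^10 + 190080 * y2^6 * y1^9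
     - 23185085 * y3^6 * y1^9 + 18078060 * y2^2 * y3^4 * y1^9 + 2217600 * y2^4 * y3^2 * y1^9
     - 68083785 * y3^7 * y1^8 - 199667160 * y2^2 * y3^5 * y1^8 + 12806640 * y2^4 * y3^3 * y1^8
     - 1995840 * y2^6 * y3 * y1^8 - 285120 * y2^8 * y1^7 + 121226490 * y3^8 * y1^7
     - 6791400 * y2^2 * y3^6 * y1^7 - 57047760 * y2^4 * y3^4 * y1^7 + 3991680 * y2^6 * y3^2 * y1^7
     - 187914265 * y3^9 * y1^6 + 24109470 * y2^2 * y3^7 * y1^6 - 292369770 * y2^4 * y3^5 * y1^6
     - 26195400 * y2^6 * y3^3 * y1^6 - 997920 * y2^8 * y3 * y1^6 + 171072 * y2^10 * y1^5
     + 202440315 * y3^10 * y1^5 - 121226490 * y2^2 * y3^8 * y1^5 + 164012310 * y2^4 * y3^6 * y1^5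
     - 61122600 * y2^6 * y3^4 * y1^5 - 5987520 * y2^8 * y3^2 * y1^5 + 150506685 * y3^11 * y1^4
     - 2402344560 * y2^2 * y3^9 * y1^4 - 309687840 * y2^4 * y3^7 * y1^4
     - 42785820 * y2^6 * y3^5 * y1^4 + 27941760 * y2^8 * y3^3 * y1^4 + 2993760 * y2^10 * y3 * y1^4
     - 767071480 * y3^12 * y1^3 - 404880630 * y2^2 * y3^10 * y1^3 - 606132450 * y2^4 * y3^8 * y1^3
     + 171143280 * y2^6 * y3^6 * y1^3 - 1746360 * y2^8 * y3^4 * y1^3 - 5987520 * y2^10 * y3^2 * y1^3
     - 141178800 * y3^13 * y1^2 + 301013370 * y2^2 * y3^11 * y1^2 + 661991715 * y2^4 * y3^9 * y1^2
     - 437026590 * y2^6 * y3^7 * y1^2 + 32089365 * y2^8 * y3^5 * y1^2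
     + 2619540 * y2^10 * y3^3 * y1^2 + 2301214440 * y2^2 * y3^12 * y1
     - 607320945 * y2^4 * y3^10 * y1 - 363679470 * y2^6 * y3^8 * y1 + 71819055 * y2^8 * y3^6 * y1
     - 13097700 * y2^10 * y3^4 * y1 + 105413504 * y3^15 - 141178800 * y2^2 * y3^13
     + 150506685 * y2^4 * y3^11 - 392203350 * y2^6 * y3^9 - 35145495 * y2^8 * y3^7
     - 25671492 * y2^10 * y3^5"

definition klein_h_y :: "complex^3 \<Rightarrow> complex^3" where
  "klein_h_y y = vector
     [27 * klein_A (y$1) (y$2) (y$3),
      - 27 * (y$2)^3 * klein_B (y$1) (y$2) (y$3),
      klein_C (y$1) (y$2) (y$3)]"

definition klein_h_lift :: "complex^3 \<Rightarrow> complex^3" where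
  "klein_h_lift x = y_to_x *v klein_h_y (matrix_inv y_to_x *v x)"

text \<open>The value does not depend on the representative chosen by \<open>rep_cp2\<close>, because
  \<open>klein_h_lift\<close> is homogeneous.\<close>

definition klein_h :: "cp2 \<Rightarrow> cp2" where
  "klein_h p = cp2_pt (klein_h_lift (rep_cp2 p))"

end

theory Submission
  imports Defs "HOL-Complex_Analysis.Cauchy_Integral_Formula"
begin

text \<open>
  In the coordinates \<open>x\<close> the lift of \<open>h\<close> is invariant under signed permutations by its shape, and equivariance under
  \<open>Q\<close> is one polynomial identity. Its Jacobian determinant is, by another identity, a constant times the square
  of the product \<open>\<Phi>\<close> of \<open>21\<close> explicit linear forms. By Euler's formula a common zero of the lift lies on one of these
  lines, hence after a group element on \<open>x\<^sub>3 = 0\<close>, where two coprime binary forms remain. The \<open>21\<close> forms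
  define exactly the \<open>21\<close>-lines: they are conjugate to the mirror \<open>x\<^sub>3 = 0\<close>, and conversely the invariant \<open>\<Phi>\<close> has odd
  degree and so vanishes on every mirror.

  A lift \<open>F\<close> of another such map has degree \<open>15\<close>, and Liouville's theorem together with the invariance of
  \<open>\<Phi>\<^sup>2\<close> shows that it commutes with the matrices of the group and not only projectively. Since the Jacobian determinant
  vanishes on \<open>x\<^sub>3 = 0\<close>, the form \<open>F\<^sub>3\<close> is divisible by \<open>x\<^sub>3\<^sup>3\<close>. This leaves \<open>16\<close> coefficients, and equivariance under \<open>Q\<close>
  determines them up to a common factor.
\<close>

text \<open>Two obstacles shape the proof. The group is given only by generators in PGL_3, and
  neither its elements nor its involutions are ever listed: every class has a representative of
  determinant 1 that commutes with the lift and preserves \<Phi> exactly, a property that passes to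
  products and inverses. This is why the mirrors are bounded by the odd degree of \<Phi> and not by
  enumeration. The other obstacle is the size of the identities. The root of 3 disappears because A,
  B, C are even in y_2 and the extra factor y_2^3 meets a second root of 3 in the change of
  coordinates. The number \<theta> becomes an indeterminate t with t^2 = t - 2, so the large
  identities have integer coefficients. In the squares of the coordinates the Jacobian determinant
  drops from degree 42 to degree 18, and it splits into a part free of t and a multiple of t. A
  competing map is equivariant only projectively and its degree is not prescribed. The degree is
  read off from the Jacobian determinant. Exact commutation matters because it makes the conditions
  on the coefficients of a lift linear.\<close>

section \<open>The map in the coordinates \<open>x\<close>\<close>

text \<open>The number \<open>k\<close> witnesses that \<open>x - y\<close> is a multiple of the minimal polynomial of \<open>\<theta>\<close>, which
  turns identities modulo \<open>t\<^sup>2 = t - 2\<close> into plain polynomial identities.\<close>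

lemma theta_eqI:
  fixes t x y k :: complex
  assumes "t * t = t - 2" and "x - y - (t * t - t + 2) * k = 0"
  shows "x = y"
  using assms by simp

text \<open>Taken at the squares of the coordinates, this is the shape that signed permutations
  force on a component once the cube of its own coordinate is split off. Only the 16 values
  \<open>c j k\<close> with \<open>k \<le> j\<close> and \<open>j + k \<le> 6\<close> are read. They
  stay arbitrary so that the same family serves for \<open>h\<close> and for its
  competitors.\<close>

definition sym_sextic :: "(nat \<Rightarrow> nat \<Rightarrow> complex) \<Rightarrow> complex \<Rightarrow> complex \<Rightarrow> complex \<Rightarrow> complex" where
  "sym_sextic c x y z =
    c 0 0 * x^6
    + c 1 0 * x^5 * (y + z)
    + c 2 0 * x^4 * (y^2 + z^2)
    + c 1 1 * x^4 * y * z
    + c 3 0 * x^3 * (y^3 + z^3)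
    + c 2 1 * x^3 * (y^2 * z + y * z^2)
    + c 4 0 * x^2 * (y^4 + z^4)
    + c 3 1 * x^2 * (y^3 * z + y * z^3)
    + c 2 2 * x^2 * y^2 * z^2
    + c 5 0 * x * (y^5 + z^5)
    + c 4 1 * x * (y^4 * z + y * z^4)
    + c 3 2 * x * (y^3 * z^2 + y^2 * z^3)
    + c 6 0 * (y^6 + z^6)
    + c 5 1 * (y^5 * z + y * z^5)
    + c 4 2 * (y^4 * z^2 + y^2 * z^4)
    + c 3 3 * y^3 * z^3"

definition sextic_map :: "(nat \<Rightarrow> nat \<Rightarrow> complex) \<Rightarrow> complex^3 \<Rightarrow> complex^3" where
  "sextic_map c v = vector
     [(v$1)^3 * sym_sextic c ((v$1)^2) ((v$2)^2) ((v$3)^2),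
      (v$2)^3 * sym_sextic c ((v$2)^2) ((v$1)^2) ((v$3)^2),
      (v$3)^3 * sym_sextic c ((v$3)^2) ((v$1)^2) ((v$2)^2)]"

text \<open>In the coordinates \<open>x\<close> the lift has the components \<open>x\<^sub>i\<^sup>3 P(x\<^sub>i\<^sup>2, x\<^sub>j\<^sup>2, x\<^sub>k\<^sup>2) / 2\<^sup>1\<^sup>4\<close>, where \<open>P\<close> is symmetric in its
  last two arguments. Its coefficients \<open>klein_c0 + \<theta> klein_c1\<close> were obtained by expanding the substitution
  \<open>y = y(x)\<close>; entry \<open>j, k\<close> with \<open>k \<le> j\<close> belongs to the monomials with exponents \<open>j\<close> and \<open>k\<close> of the last two arguments.\<close>

definition klein_c0 :: "nat \<Rightarrow> nat \<Rightarrow> complex" where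
  "klein_c0 j k = [[-16], [-40, -3010], [545, 770, -990], [110, 1650, -2310, 2310], [165, 330, 2145], [660, -3300], [0]] ! j ! k"

definition klein_c1 :: "nat \<Rightarrow> nat \<Rightarrow> complex" where
  "klein_c1 j k = [[0], [40, 1910], [-275, 1210, 2970], [-330, -4950, 6930, -6930], [-495, 1650, 1485], [-396, 1980], [0]] ! j ! k"

definition klein_c :: "nat \<Rightarrow> nat \<Rightarrow> complex" where
  "klein_c j k = (klein_c0 j k + klein_theta * klein_c1 j k) / 16384"

lemma sym_sextic_lincomb:
  "sym_sextic (\<lambda>j k. (f j k + s * g j k) / d) x y z = (sym_sextic f x y z + s * sym_sextic g x y z) / d"
  by (simp add: sym_sextic_def add_divide_distrib algebra_simps)

lemma sym_sextic_commute: "sym_sextic c x z y = sym_sextic c x y z"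
  by (simp add: sym_sextic_def algebra_simps)

lemma sym_sextic_homog: "sym_sextic c (s * x) (s * y) (s * z) = s^6 * sym_sextic c x y z"
  unfolding sym_sextic_def by (simp add: power_mult_distrib algebra_simps power_numeral_reduce)

text \<open>These powers occur when a form of degree 15 is evaluated at a third coordinate
  \<open>(3 * t + 2) * r\<close>. With the reduced values \<open>klein_A\<close>,
  \<open>klein_B\<close> and \<open>klein_C\<close> become linear in \<open>t\<close>, which keeps
  the cofactors in the transformations below to one term.\<close>

lemma klein_theta_powers:
  fixes t :: complex
  assumes t: "t * t = t - 2"
  shows "t^14 = (2) + (-91) * t" and "t^14 * (3 * t + 2) = (550) + (-449) * t"
    and "(3 * t + 2)^2 = (-14) + (21) * t"
    and "(3 * t + 2)^3 = (-154) + (63) * t"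
    and "(3 * t + 2)^4 = (-686) + (-147) * t"
    and "(3 * t + 2)^5 = (-490) + (-2793) * t"
    and "(3 * t + 2)^6 = (15778) + (-15435) * t"
    and "(3 * t + 2)^7 = (124166) + (-29841) * t"
    and "(3 * t + 2)^8 = (427378) + (223293) * t"
    and "(3 * t + 2)^9 = (-485002) + (2398599) * t"
    and "(3 * t + 2)^10 = (-15361598) + (10537989) * t"
    and "(3 * t + 2)^11 = (-93951130) + (6605151) * t"
    and "(3 * t + 2)^12 = (-227533166) + (-248827635) * t"
    and "(3 * t + 2)^13 = (1037899478) + (-1926737673) * t"
    and "(3 * t + 2)^14 = (13636224994) + (-6519989931) * t"
    and "(3 * t + 2)^15 = (66392389574) + (8308725327) * t"
proof -
  \<comment> \<open>Multiplication by \<open>t\<close> and, in \<open>st\<close>, by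
    \<open>3 * t + 2\<close> in the basis 1, \<open>t\<close>; each power follows from the previous
    one.\<close>
  have ts: "t^Suc k = - 2 * b + (a + b) * t" if "t^k = a + b * t" for k and a b :: complex
  proof -
    have "t^Suc k = a * t + b * (t * t)" using that by (simp add: algebra_simps)
    then show ?thesis unfolding t by (simp add: algebra_simps)
  qed
  have st: "(3 * t + 2)^Suc k = (2 * a - 6 * b) + (3 * a + 5 * b) * t" if "(3 * t + 2)^k = a + b * t" for k and a b :: complex
  proof -
    have "(3 * t + 2)^Suc k = 3 * a * t + 3 * b * (t * t) + 2 * a + 2 * b * t"
      using that by (simp add: algebra_simps)
    then show ?thesis unfolding t by (simp add: algebra_simps)
  qed
  have t2: "t^2 = (-2) + 1 * t" by (simp add: power2_eq_square t)
  have t3: "t^3 = (-2) + (-1) * t" using ts[OF t2] by simp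
  have t4: "t^4 = (2) + (-3) * t" using ts[OF t3] by simp
  have t5: "t^5 = (6) + (-1) * t" using ts[OF t4] by simp
  have t6: "t^6 = (2) + (5) * t" using ts[OF t5] by simp
  have t7: "t^7 = (-10) + (7) * t" using ts[OF t6] by simp
  have t8: "t^8 = (-14) + (-3) * t" using ts[OF t7] by simp
  have t9: "t^9 = (6) + (-17) * t" using ts[OF t8] by simp
  have t10: "t^10 = (34) + (-11) * t" using ts[OF t9] by simp
  have t11: "t^11 = (22) + (23) * t" using ts[OF t10] by simp
  have t12: "t^12 = (-46) + (45) * t" using ts[OF t11] by simp
  have t13: "t^13 = (-90) + (-1) * t" using ts[OF t12] by simp
  have t14: "t^14 = (2) + (-91) * t" using ts[OF t13] by simp
  show "t^14 = (2) + (-91) * t" by (rule t14)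
  have "t^14 * (3 * t + 2) = 3 * (2) * t + 3 * (-91) * (t * t) + 2 * (2) + 2 * (-91) * t"
    unfolding t14 by (simp add: algebra_simps)
  then show "t^14 * (3 * t + 2) = (550) + (-449) * t" unfolding t by (simp add: algebra_simps)
  have e1: "(3 * t + 2)^1 = 2 + 3 * t" by simp
  show e2: "(3 * t + 2)^2 = (-14) + (21) * t" using st[OF e1] by (simp add: numeral_2_eq_2)
  show e3: "(3 * t + 2)^3 = (-154) + (63) * t" using st[OF e2] by simp
  show e4: "(3 * t + 2)^4 = (-686) + (-147) * t" using st[OF e3] by simp
  show e5: "(3 * t + 2)^5 = (-490) + (-2793) * t" using st[OF e4] by simp
  show e6: "(3 * t + 2)^6 = (15778) + (-15435) * t" using st[OF e5] by simp
  show e7: "(3 * t + 2)^7 = (124166) + (-29841) * t" using st[OF e6] by simp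
  show e8: "(3 * t + 2)^8 = (427378) + (223293) * t" using st[OF e7] by simp
  show e9: "(3 * t + 2)^9 = (-485002) + (2398599) * t" using st[OF e8] by simp
  show e10: "(3 * t + 2)^10 = (-15361598) + (10537989) * t" using st[OF e9] by simp
  show e11: "(3 * t + 2)^11 = (-93951130) + (6605151) * t" using st[OF e10] by simp
  show e12: "(3 * t + 2)^12 = (-227533166) + (-248827635) * t" using st[OF e11] by simp
  show e13: "(3 * t + 2)^13 = (1037899478) + (-1926737673) * t" using st[OF e12] by simp
  show e14: "(3 * t + 2)^14 = (13636224994) + (-6519989931) * t" using st[OF e13] by simp
  show e15: "(3 * t + 2)^15 = (66392389574) + (8308725327) * t" using st[OF e14] by simp
qed

lemma sym_sextic_klein_c0:
  "sym_sextic klein_c0 x y z = (-16) * x^6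
    + (-40) * x^5 * (y + z)
    + (545) * x^4 * (y^2 + z^2)
    + (-3010) * x^4 * y * z
    + (110) * x^3 * (y^3 + z^3)
    + (770) * x^3 * (y^2 * z + y * z^2)
    + (165) * x^2 * (y^4 + z^4)
    + (1650) * x^2 * (y^3 * z + y * z^3)
    + (-990) * x^2 * y^2 * z^2
    + (660) * x * (y^5 + z^5)
    + (330) * x * (y^4 * z + y * z^4)
    + (-2310) * x * (y^3 * z^2 + y^2 * z^3)
    + (-3300) * (y^5 * z + y * z^5)
    + (2145) * (y^4 * z^2 + y^2 * z^4)
    + (2310) * y^3 * z^3"
  by (simp add: sym_sextic_def klein_c0_def)

lemma sym_sextic_klein_c1:
  "sym_sextic klein_c1 x y z = (40) * x^5 * (y + z)
    + (-275) * x^4 * (y^2 + z^2)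
    + (1910) * x^4 * y * z
    + (-330) * x^3 * (y^3 + z^3)
    + (1210) * x^3 * (y^2 * z + y * z^2)
    + (-495) * x^2 * (y^4 + z^4)
    + (-4950) * x^2 * (y^3 * z + y * z^3)
    + (2970) * x^2 * y^2 * z^2
    + (-396) * x * (y^5 + z^5)
    + (1650) * x * (y^4 * z + y * z^4)
    + (6930) * x * (y^3 * z^2 + y^2 * z^3)
    + (1980) * (y^5 * z + y * z^5)
    + (1485) * (y^4 * z^2 + y^2 * z^4)
    + (-6930) * y^3 * z^3"
  by (simp add: sym_sextic_def klein_c1_def)

text \<open>Here \<open>v = \<surd>3 \<cdot> 14 u\<close>, and \<open>42 t (m + u, n, m - u)\<close> are the \<open>x\<close>-coordinates of the point whose \<open>y\<close>-coordinates
  are the arguments of \<open>klein_A\<close>. The factor \<open>3 t + 2\<close> is \<open>14 t / (t + 3)\<close>.\<close>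

lemma klein_A_transform:
  fixes t m n u v :: complex
  assumes t: "t * t = t - 2" and v: "v^2 = 588 * u^2"
  shows "42^15 * t^14 * ((1 * ((m + u)^3 * sym_sextic klein_c0 ((m + u)^2) (n^2) ((m - u)^2)) + 2 * (n^3 * sym_sextic klein_c0 (n^2) ((m + u)^2) ((m - u)^2)) + 1 * ((m - u)^3 * sym_sextic klein_c0 ((m - u)^2) ((m + u)^2) (n^2)))
      + t * (1 * ((m + u)^3 * sym_sextic klein_c1 ((m + u)^2) (n^2) ((m - u)^2)) + 2 * (n^3 * sym_sextic klein_c1 (n^2) ((m + u)^2) ((m - u)^2)) + 1 * ((m - u)^3 * sym_sextic klein_c1 ((m - u)^2) ((m + u)^2) (n^2)))) = (- 2654208) * klein_A (- 14 * (m + n)) v ((3 * t + 2) * (2 * m - n))"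
proof -
  have v': "v^4 = 345744 * u^4" "v^6 = 203297472 * u^6" "v^8 = 119538913536 * u^8" "v^10 = 70288881159168 * u^10" "v^12 = 41329862121590784 * u^12"
    using arg_cong[OF v, of "\<lambda>z. z^2"] arg_cong[OF v, of "\<lambda>z. z^3"] arg_cong[OF v, of "\<lambda>z. z^4"]
      arg_cong[OF v, of "\<lambda>z. z^5"] arg_cong[OF v, of "\<lambda>z. z^6"]
    by (simp_all add: power_mult_distrib flip: power_mult)
  note pw = klein_theta_powers[OF t]
  show ?thesis
    unfolding pw(1)
    \<comment> \<open>Once the powers are reduced, \<open>t^2\<close> arises only from
      \<open>- 91 * t\<close> times the summand with the factor \<open>t\<close>; its coefficient is
      the cofactor.\<close>
    apply (rule theta_eqI[OF t, where k = "42^15 * -91 * (1 * ((m + u)^3 * sym_sextic klein_c1 ((m + u)^2) (n^2) ((m - u)^2)) + 2 * (n^3 * sym_sextic klein_c1 (n^2) ((m + u)^2) ((m - u)^2)) + 1 * ((m - u)^3 * sym_sextic klein_c1 ((m - u)^2) ((m + u)^2) (n^2)))"])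
    unfolding klein_A_def
    apply (simp only: power_mult_distrib pw(3-) v v')
    unfolding sym_sextic_klein_c0 sym_sextic_klein_c1
    by Groebner_Basis.algebra
qed

text \<open>By the rows of \<open>y_to_x\<close>, the combinations (1, 2, 1), (1, 0, -1) and (1, -1,
  1) of the x-coordinates are multiples of y_1, y_2 and y_3. The second one isolates the component
  -27 y_2^3 B, and \<open>u^3\<close> is its factor y_2^3.\<close>

lemma klein_B_transform:
  fixes t m n u v :: complex
  assumes t: "t * t = t - 2" and v: "v^2 = 588 * u^2"
  shows "42^15 * t^14 * ((1 * ((m + u)^3 * sym_sextic klein_c0 ((m + u)^2) (n^2) ((m - u)^2)) - 1 * ((m - u)^3 * sym_sextic klein_c0 ((m - u)^2) ((m + u)^2) (n^2)))
      + t * (1 * ((m + u)^3 * sym_sextic klein_c1 ((m + u)^2) (n^2) ((m - u)^2)) - 1 * ((m - u)^3 * sym_sextic klein_c1 ((m - u)^2) ((m + u)^2) (n^2)))) = - 21849440256 * u^3 * klein_B (- 14 * (m + n)) v ((3 * t + 2) * (2 * m - n))"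
proof -
  have v': "v^4 = 345744 * u^4" "v^6 = 203297472 * u^6" "v^8 = 119538913536 * u^8" "v^10 = 70288881159168 * u^10" "v^12 = 41329862121590784 * u^12"
    using arg_cong[OF v, of "\<lambda>z. z^2"] arg_cong[OF v, of "\<lambda>z. z^3"] arg_cong[OF v, of "\<lambda>z. z^4"]
      arg_cong[OF v, of "\<lambda>z. z^5"] arg_cong[OF v, of "\<lambda>z. z^6"]
    by (simp_all add: power_mult_distrib flip: power_mult)
  note pw = klein_theta_powers[OF t]
  show ?thesis
    unfolding pw(1)
    apply (rule theta_eqI[OF t, where k = "42^15 * -91 * (1 * ((m + u)^3 * sym_sextic klein_c1 ((m + u)^2) (n^2) ((m - u)^2)) - 1 * ((m - u)^3 * sym_sextic klein_c1 ((m - u)^2) ((m + u)^2) (n^2)))"])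
    unfolding klein_B_def
    apply (simp only: power_mult_distrib pw(3-) v v')
    unfolding sym_sextic_klein_c0 sym_sextic_klein_c1
    by Groebner_Basis.algebra
qed

text \<open>The combination (1, -1, 1) of the x-coordinates is 3 (3 + t) y_3. Since 3 + t = 14 t /
  (3 t + 2), the extra factor \<open>3 * t + 2\<close> makes the right-hand side an integer multiple
  of C.\<close>

lemma klein_C_transform:
  fixes t m n u v :: complex
  assumes t: "t * t = t - 2" and v: "v^2 = 588 * u^2"
  shows "42^15 * (t^14 * (3 * t + 2)) * ((1 * ((m + u)^3 * sym_sextic klein_c0 ((m + u)^2) (n^2) ((m - u)^2)) - 1 * (n^3 * sym_sextic klein_c0 (n^2) ((m + u)^2) ((m - u)^2)) + 1 * ((m - u)^3 * sym_sextic klein_c0 ((m - u)^2) ((m + u)^2) (n^2)))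
      + t * (1 * ((m + u)^3 * sym_sextic klein_c1 ((m + u)^2) (n^2) ((m - u)^2)) - 1 * (n^3 * sym_sextic klein_c1 (n^2) ((m + u)^2) ((m - u)^2)) + 1 * ((m - u)^3 * sym_sextic klein_c1 ((m - u)^2) ((m + u)^2) (n^2)))) = 688128 * klein_C (- 14 * (m + n)) v ((3 * t + 2) * (2 * m - n))"
proof -
  have v': "v^4 = 345744 * u^4" "v^6 = 203297472 * u^6" "v^8 = 119538913536 * u^8" "v^10 = 70288881159168 * u^10" "v^12 = 41329862121590784 * u^12"
    using arg_cong[OF v, of "\<lambda>z. z^2"] arg_cong[OF v, of "\<lambda>z. z^3"] arg_cong[OF v, of "\<lambda>z. z^4"]
      arg_cong[OF v, of "\<lambda>z. z^5"] arg_cong[OF v, of "\<lambda>z. z^6"]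
    by (simp_all add: power_mult_distrib flip: power_mult)
  note pw = klein_theta_powers[OF t]
  show ?thesis
    unfolding pw(2)
    apply (rule theta_eqI[OF t, where k = "42^15 * -449 * (1 * ((m + u)^3 * sym_sextic klein_c1 ((m + u)^2) (n^2) ((m - u)^2)) - 1 * (n^3 * sym_sextic klein_c1 (n^2) ((m + u)^2) ((m - u)^2)) + 1 * ((m - u)^3 * sym_sextic klein_c1 ((m - u)^2) ((m + u)^2) (n^2)))"])
    unfolding klein_C_def
    apply (simp only: power_mult_distrib pw(3-) v v')
    unfolding sym_sextic_klein_c0 sym_sextic_klein_c1
    by Groebner_Basis.algebra
qed


lemma sextic_map_homog: "sextic_map c (s *s v) = s^15 *s sextic_map c v"
  by (simp add: sextic_map_def vec_eq_iff forall_3 power_mult_distrib sym_sextic_homog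
      flip: power_mult power_add)

lemma sextic_map_klein_c:
  "sextic_map klein_c v = (1 / 16384) *s (sextic_map klein_c0 v + klein_theta *s sextic_map klein_c1 v)"
proof -
  have eq: "sym_sextic klein_c x y z = (sym_sextic klein_c0 x y z + klein_theta * sym_sextic klein_c1 x y z) / 16384" for x y z
    
    unfolding klein_c_def[abs_def] by (rule sym_sextic_lincomb)
  show ?thesis
    unfolding sextic_map_def eq by (simp add: vec_eq_iff forall_3 field_simps)
qed

text \<open>The point is written as 42 t (m + w, n', m - w), which frees the arguments of A, B, C
  from roots. Homogeneity takes out the scalar, the three transformations give the y-coordinates of
  the image, and \<open>y_to_x\<close> recombines them.\<close>

lemma klein_h_lift_eq: "klein_h_lift x = sextic_map klein_c x"
proof -
  define t where "t = klein_theta"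
  define q where "q = complex_of_real (sqrt 3)"
  have tt: "t * t = t - 2" by (simp add: t_def klein_theta_sq)
  have qq: "q * q = 3" by (simp add: q_def flip: of_real_mult)
  then have q0: "q \<noteq> 0" by auto
  define y where "y = matrix_inv y_to_x *v x"
  have xy: "x = y_to_x *v y"
  proof -
    have "y_to_x ** matrix_inv y_to_x = mat 1"
      using invertible_y_to_x unfolding matrix_inv_def invertible_def by (rule someI2_ex) blast
    then show ?thesis by (simp add: y_def matrix_vector_mul_assoc)
  qed
  define p where "p = y$1"
  define v where "v = y$2"
  define u where "u = v / q"
  \<comment> \<open>\<open>(5 - 3 * t) / 28\<close> is the inverse of \<open>3 * t + 2\<close>, as
    \<open>t28\<close> shows.\<close>
  define r where "r = y$3 * (5 - 3 * t) / 28"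
  have vq: "v = q * u" using q0 by (simp add: u_def)
  have v2: "v^2 = 3 * u^2" using qq by (simp add: vq power2_eq_square algebra_simps)
  have t28: "(3 * t + 2) * (5 - 3 * t) = 28"
    by (rule theta_eqI[OF tt, where k = "-9"]) Groebner_Basis.algebra
  have "(3 * t + 2) * r = (3 * t + 2) * (5 - 3 * t) * y$3 / 28" by (simp add: r_def)
  then have r: "y$3 = (3 * t + 2) * r" unfolding t28 by simp
  define m where "m = (14 * r - p) / 42"
  define n' where "n' = - (p + 7 * r) / 21"
  define w where "w = u / 14"
  have pm: "- 14 * (m + n') = p" and rm: "2 * m - n' = r" by (simp_all add: m_def n'_def field_simps)
  have v2': "v^2 = 588 * w^2" by (simp add: v2 w_def power_divide)
  define x1 where "x1 = m + w"
  define x2 where "x2 = n'"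
  define x3 where "x3 = m - w"
  have r14: "(3 + t) * ((3 * t + 2) * r) = t * (14 * r)"
    by (rule theta_eqI[OF tt, where k = "3 * r"]) Groebner_Basis.algebra
  have qv: "q * v = 3 * u" using qq by (simp add: vq flip: mult.assoc)
  have y3: "(3 + t) * y$3 = t * (14 * r)" unfolding r by (rule r14)
  have qtv: "q * t * v = t * (3 * u)" unfolding qv[symmetric] by (simp only: mult_ac)
  have Y: "(y_to_x *v y)$1 = - t * p + q * t * v + (3 + t) * y$3"
    "(y_to_x *v y)$2 = - 2 * t * p - (3 + t) * y$3"
    "(y_to_x *v y)$3 = - t * p - q * t * v + (3 + t) * y$3"
    by (simp_all add: y_to_x_def matrix_vector_mult_def sum_3 vector_3 t_def q_def p_def v_def algebra_simps)
  have x: "x = (42 * t) *s vector [x1, x2, x3]"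
    unfolding xy vec_eq_iff forall_3 Y y3 qtv
    by (simp add: x1_def x2_def x3_def m_def n'_def w_def field_simps)
  define n where "n = (42^15 * t^14) *s (sextic_map klein_c0 (vector [x1, x2, x3]) + t *s sextic_map klein_c1 (vector [x1, x2, x3]))"
  define A where "A = klein_A p v (y$3)"
  define B where "B = klein_B p v (y$3)"
  define C where "C = klein_C p v (y$3)"
  have nA: "n$1 + 2 * n$2 + n$3 = - 2654208 * A"
    using klein_A_transform[OF tt v2', where m = m and n = n', folded x1_def x3_def, unfolded pm rm, folded x2_def]
    by (simp add: n_def sextic_map_def A_def r algebra_simps)
  have nB: "n$1 - n$3 = - 7962624 * u^3 * B"
    using klein_B_transform[OF tt v2', where m = m and n = n', folded x1_def x3_def, unfolded pm rm, folded x2_def]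
    by (simp add: n_def sextic_map_def B_def r w_def power_divide algebra_simps)
  have nC0: "(3 * t + 2) * (n$1 - n$2 + n$3) = 688128 * C"
    using klein_C_transform[OF tt v2', where m = m and n = n', folded x1_def x3_def, unfolded pm rm, folded x2_def]
    by (simp add: n_def sextic_map_def C_def r algebra_simps)
  define Z where "Z = n$1 - n$2 + n$3"
  have "28 * Z = (3 * t + 2) * (5 - 3 * t) * Z" by (simp only: t28)
  also have "\<dots> = (5 - 3 * t) * ((3 * t + 2) * Z)" by (simp only: mult_ac)
  also have "\<dots> = (5 - 3 * t) * (688128 * C)" by (simp only: Z_def nC0)
  also have "\<dots> = 28 * (24576 * (5 - 3 * t) * C)" by (subst eq_iff_diff_eq_0) Groebner_Basis.algebra
  finally have nC: "n$1 - n$2 + n$3 = 24576 * (5 - 3 * t) * C"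
    unfolding Z_def[symmetric] by (subst (asm) mult_cancel_left) simp
  have qv3: "q * v^3 = 9 * u^3"
  proof -
    have "q * v^3 = (q * q) * (q * q) * u^3" by (simp add: vq power3_eq_cube)
    then show ?thesis by (simp add: qq)
  qed
  have hy: "klein_h_y y = vector [27 * A, - 27 * v^3 * B, C]"
    by (simp add: klein_h_y_def A_def B_def C_def p_def v_def)
  have "klein_h_lift x = y_to_x *v klein_h_y y" by (simp add: klein_h_lift_def y_def)
  also have "\<dots> = vector [- t * (27 * A) - 27 * (q * v^3) * t * B + (3 + t) * C,
      - 2 * t * (27 * A) - (3 + t) * C,
      - t * (27 * A) + 27 * (q * v^3) * t * B + (3 + t) * C]"
    by (simp add: hy y_to_x_def vec_eq_iff forall_3 matrix_vector_mult_def sum_3 vector_3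
        flip: t_def q_def) (simp add: algebra_simps)
  also have "\<dots> = (t / 16384) *s n"
  proof -
    have a: "A = - (n$1 + 2 * n$2 + n$3) / 2654208" using nA by simp
    have ub: "u^3 * B = - (n$1 - n$3) / 7962624" using nB by simp
    have tc: "t * (5 - 3 * t) = 2 * (3 + t)"
      by (rule theta_eqI[OF tt, where k = "- 3"]) Groebner_Basis.algebra
    have "t * (n$1 - n$2 + n$3) = 24576 * (t * (5 - 3 * t)) * C" unfolding nC by (simp add: algebra_simps)
    then have c': "(3 + t) * C = t * (n$1 - n$2 + n$3) / 49152" unfolding tc by (simp add: field_simps)
    have b': "27 * (9 * u^3) * t * B = 243 * t * (u^3 * B)" by simp
    show ?thesis
      unfolding qv3 b' ub c' a by (simp add: vec_eq_iff forall_3 vector_3 field_simps)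
  qed
  also have "\<dots> = sextic_map klein_c x"
    unfolding x sextic_map_homog sextic_map_klein_c n_def t_def[symmetric]
    by (simp add: vec_eq_iff power_mult_distrib power_numeral_reduce)
  finally show ?thesis .
qed

text \<open>In coordinates \<open>(X + Y, X - Y, (1 - \<theta>) W)\<close> the matrix \<open>klein_Q\<close> maps \<open>(X, Y, W)\<close> to \<open>(X, -W, Y)\<close>. The right-hand
  side is invariant under exchanging \<open>Y\<close> and \<open>W\<close>, which is what equivariance under \<open>klein_Q\<close> amounts to.\<close>

lemma sym_sextic_klein_Q:
  fixes t X Y W :: complex
  defines "N \<equiv> \<lambda>x y z. sym_sextic klein_c0 x y z + t * sym_sextic klein_c1 x y z"
  assumes t: "t * t = t - 2"
  shows "(X + Y)^3 * N ((X + Y)^2) ((X - Y)^2) (- (1 + t) * W^2)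
      + (X - Y)^3 * N ((X - Y)^2) ((X + Y)^2) (- (1 + t) * W^2)
    = - 2 * (1 + t) * X^3 * N (- (1 + t) * X^2) ((Y - W)^2) ((Y + W)^2)"
proof -
  show ?thesis
    \<comment> \<open>The cofactor is the quotient of the difference of both sides by t^2 - t +
      2.\<close>
    apply (rule theta_eqI[OF t, where k = "
      ((1408) + (-864) * t + (-1472) * t^2 + (-864) * t^3 + (-256) * t^4 + (-32) * t^5) * X^15
      + ((7360) + (4000) * t + (-960) * t^2 + (-2080) * t^3 + (-960) * t^4 + (-160) * t^5) * X^13 * Y^2
      + ((3680) + (4000) * t + (-960) * t^2 + (-2080) * t^3 + (-960) * t^4 + (-160) * t^5) * X^13 * W^2
      + ((-76000) + (-21120) * t + (15040) * t^2 + (12480) * t^3 + (2720) * t^4) * X^11 * Y^4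
      + ((183360) + (180800) * t + (-48640) * t^2 + (-60320) * t^3 + (-14240) * t^4) * X^11 * Y^2 * W^2
      + ((-1760) + (3520) * t + (15040) * t^2 + (12480) * t^3 + (2720) * t^4) * X^11 * W^4
      + ((-42240) + (-49280) * t + (-21120) * t^2 + (-3520) * t^3) * X^9 * Y^6
      + ((109120) + (204160) * t + (119680) * t^2 + (24640) * t^3) * X^9 * Y^4 * W^2
      + ((70400) + (165440) * t + (119680) * t^2 + (24640) * t^3) * X^9 * Y^2 * W^4
      + ((-3520) + (-10560) * t + (-10560) * t^2 + (-3520) * t^3) * X^9 * W^6
      + ((-58080) + (-58080) * t + (-15840) * t^2) * X^7 * Y^8
      + ((-422400) + (-580800) * t + (-158400) * t^2) * X^7 * Y^6 * W^2
      + ((95040) + (190080) * t + (95040) * t^2) * X^7 * Y^4 * W^4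
      + ((5280) + (15840) * t + (15840) * t^2 + (5280) * t^3) * X^7 * W^8
      + ((-92928) + (-32736) * t) * X^5 * Y^10
      + ((68640) + (68640) * t) * X^5 * Y^8 * W^2
      + ((-221760) + (-443520) * t + (-221760) * t^2) * X^5 * Y^4 * W^6
      + ((-84480) + (-195360) * t + (-137280) * t^2 + (-26400) * t^3) * X^5 * Y^2 * W^8
      + ((5280) + (3168) * t + (-12672) * t^2 + (-13728) * t^3 + (-3168) * t^4) * X^5 * W^10
      + ((-21120) + (-21120) * t) * X^3 * Y^8 * W^4
      + ((591360) + (813120) * t + (221760) * t^2) * X^3 * Y^6 * W^6
      + ((-126720) + (-274560) * t + (-190080) * t^2 + (-42240) * t^3) * X^3 * Y^4 * W^8
      + ((-190080) + (-179520) * t + (63360) * t^2 + (68640) * t^3 + (15840) * t^4) * X^3 * Y^2 * W^10"])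
    unfolding N_def sym_sextic_klein_c0 sym_sextic_klein_c1 by Groebner_Basis.algebra
qed

text \<open>The sum and the difference of the two sextics are forms in \<open>s = (a + b)\<^sup>2\<close> and \<open>p = a b\<close>, up to the factor
  \<open>(a - b)(a + b)\<close>; the last case is a Bezout identity for these forms.\<close>

lemma sym_sextic_klein_coprime:
  fixes t x y :: complex
  defines "N \<equiv> \<lambda>x y. sym_sextic klein_c0 x y 0 + t * sym_sextic klein_c1 x y 0"
  assumes t: "t * t = t - 2" and x: "x^3 * N (x^2) (y^2) = 0" and y: "y^3 * N (y^2) (x^2) = 0"
  shows "x = 0 \<and> y = 0"
proof (cases "x = 0 \<or> y = 0")
  case True
  then show ?thesis
    using x y by (auto simp: N_def sym_sextic_klein_c0 sym_sextic_klein_c1)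
next
  case False
  define a where "a = x^2"
  define b where "b = y^2"
  have ab: "a \<noteq> 0" "b \<noteq> 0" using False by (auto simp: a_def b_def)
  define p where "p = a * b"
  define s where "s = (a + b)^2"
  define S where "S = - 16 * s^3 + (716 - 356 * t) * s^2 * p + (- 1914 + 654 * t) * s * p^2 + (72 + 168 * t) * p^3"
  define A where "A = - 16 * s^2 + (- 636 + 436 * t) * s * p + (1732 - 652 * t) * p^2"
  have N: "N a b = 0" "N b a = 0" using x y False by (auto simp: a_def b_def)
  have e: "sym_sextic klein_c0 x y 0 = - 16 * x^6 - 40 * x^5 * y + 545 * x^4 * y^2 + 110 * x^3 * y^3 + 165 * x^2 * y^4 + 660 * x * y^5"
    "sym_sextic klein_c1 x y 0 = 40 * x^5 * y - 275 * x^4 * y^2 - 330 * x^3 * y^3 - 495 * x^2 * y^4 - 396 * x * y^5" for x y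
    by (simp_all add: sym_sextic_klein_c0 sym_sextic_klein_c1)
  have "N a b + N b a = S"
    unfolding N_def e S_def s_def p_def by (subst eq_iff_diff_eq_0) Groebner_Basis.algebra
  then have S0: "S = 0" using N by simp
  have "N a b - N b a = (a - b) * (a + b) * A"
    unfolding N_def e A_def s_def p_def by (subst eq_iff_diff_eq_0) Groebner_Basis.algebra
  then consider "a = b" | "a = - b" | "A = 0" using N by (auto simp: eq_neg_iff_add_eq_0)
  then have False
  proof cases
    case 1
    have "S = (2848 - 2912 * t) * b^6"
      unfolding S_def s_def p_def 1 by (subst eq_iff_diff_eq_0) Groebner_Basis.algebra
    then have "(2848 - 2912 * t) * b^6 = 0" using S0 by simp
    then have c: "2848 - 2912 * t = 0" using ab by simp
    \<comment> \<open>The second factor is the conjugate under t -> 1 - t, so the product is the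
      norm, here 2^24. The next case uses the norm of \<open>72 + 168 * t\<close> in the same
      way.\<close>
    have "(2848 - 2912 * t) * (-64 + 2912 * t) = 16777216"
      by (rule theta_eqI[OF t, where k = "- 8479744"]) Groebner_Basis.algebra
    then show False unfolding c by simp
  next
    case 2
    have "s = 0" "p = - (b^2)" by (simp_all add: s_def p_def 2 power2_eq_square)
    then have "S = - (72 + 168 * t) * b^6" by (simp add: S_def algebra_simps flip: power_mult)
    moreover have "b^6 \<noteq> 0" using ab by simp
    ultimately have c: "72 + 168 * t = 0" by (metis S0 mult_eq_0_iff neg_equal_0_iff_equal mult_minus_left)
    have "(72 + 168 * t) * (240 - 168 * t) = 73728"
      by (rule theta_eqI[OF t, where k = "- 28224"]) Groebner_Basis.algebra
    then show False unfolding c by simp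
  next
    case 3
    have "((- 31003064 - 122214860 * t) * p + (2963534 - 2892253 * t) * s) * S
        + ((17259744 + 42401328 * t) * p^2 + (- 4911360 - 125708928 * t) * s * p + (- 2963534 + 2892253 * t) * s^2) * A
      - 124017180672 * p^4
      = (t * t - t + 2) * ((- 122214860 * p - 2892253 * s) * (- 356 * s^2 * p + 654 * s * p^2 + 168 * p^3)
        + (42401328 * p^2 - 125708928 * s * p + 2892253 * s^2) * (436 * s * p - 652 * p^2))"
      unfolding S_def A_def by (subst eq_iff_diff_eq_0) Groebner_Basis.algebra
    moreover have "t * t - t + 2 = 0" by (simp add: t)
    ultimately have "p^4 = 0" unfolding S0 3 by simp
    then show False using ab by (simp add: p_def)
  qed
  then show ?thesis ..
qed


section \<open>The Jacobian determinant\<close>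

definition sym_sextic_dx :: "(nat \<Rightarrow> nat \<Rightarrow> complex) \<Rightarrow> complex \<Rightarrow> complex \<Rightarrow> complex \<Rightarrow> complex" where
  "sym_sextic_dx c x y z =
    c 0 0 * (6 * x^5)
    + c 1 0 * (5 * x^4 * y + 5 * x^4 * z)
    + c 1 1 * (4 * x^3 * y * z)
    + c 2 0 * (4 * x^3 * y^2 + 4 * x^3 * z^2)
    + c 2 1 * (3 * x^2 * y^2 * z + 3 * x^2 * y * z^2)
    + c 2 2 * (2 * x * y^2 * z^2)
    + c 3 0 * (3 * x^2 * y^3 + 3 * x^2 * z^3)
    + c 3 1 * (2 * x * y^3 * z + 2 * x * y * z^3)
    + c 3 2 * (y^3 * z^2 + y^2 * z^3)
    + c 4 0 * (2 * x * y^4 + 2 * x * z^4)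
    + c 4 1 * (y^4 * z + y * z^4)
    + c 5 0 * (y^5 + z^5)"

text \<open>By symmetry of the sextic, exchanging the last two arguments turns this into the
  derivative in the third one.\<close>

definition sym_sextic_dy :: "(nat \<Rightarrow> nat \<Rightarrow> complex) \<Rightarrow> complex \<Rightarrow> complex \<Rightarrow> complex \<Rightarrow> complex" where
  "sym_sextic_dy c x y z =
    c 1 0 * (x^5)
    + c 1 1 * (x^4 * z)
    + c 2 0 * (2 * x^4 * y)
    + c 2 1 * (2 * x^3 * y * z + x^3 * z^2)
    + c 2 2 * (2 * x^2 * y * z^2)
    + c 3 0 * (3 * x^3 * y^2)
    + c 3 1 * (3 * x^2 * y^2 * z + x^2 * z^3)
    + c 3 2 * (3 * x * y^2 * z^2 + 2 * x * y * z^3)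
    + c 3 3 * (3 * y^2 * z^3)
    + c 4 0 * (4 * x^2 * y^3)
    + c 4 1 * (4 * x * y^3 * z + x * z^4)
    + c 4 2 * (4 * y^3 * z^2 + 2 * y * z^4)
    + c 5 0 * (5 * x * y^4)
    + c 5 1 * (5 * y^4 * z + z^5)
    + c 6 0 * (6 * y^5)"

definition det3 :: "complex \<Rightarrow> complex \<Rightarrow> complex \<Rightarrow> complex \<Rightarrow> complex \<Rightarrow> complex
    \<Rightarrow> complex \<Rightarrow> complex \<Rightarrow> complex \<Rightarrow> complex" where
  "det3 a b c d e f g h i = a * (e * i - f * h) - b * (d * i - f * g) + c * (d * h - e * g)"

text \<open>Up to the factor \<open>x\<^sub>1\<^sup>2 x\<^sub>2\<^sup>2 x\<^sub>3\<^sup>2\<close> this is the Jacobian determinant of \<open>sextic_map c\<close>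
  in terms of the squares of the coordinates.\<close>

definition reduced_jacobian :: "(nat \<Rightarrow> nat \<Rightarrow> complex) \<Rightarrow> complex \<Rightarrow> complex \<Rightarrow> complex \<Rightarrow> complex" where
  "reduced_jacobian c x y z = det3
     (3 * sym_sextic c x y z + 2 * x * sym_sextic_dx c x y z) (2 * y * sym_sextic_dy c x y z) (2 * z * sym_sextic_dy c x z y)
     (2 * x * sym_sextic_dy c y x z) (3 * sym_sextic c y x z + 2 * y * sym_sextic_dx c y x z) (2 * z * sym_sextic_dy c y z x)
     (2 * x * sym_sextic_dy c z x y) (2 * y * sym_sextic_dy c z y x) (3 * sym_sextic c z x y + 2 * z * sym_sextic_dx c z x y)"

lemma theta_mult:
  fixes t a b c d :: complex
  assumes "t * t = t - 2"
  shows "(a + t * b) * (c + t * d) = (a * c - 2 * (b * d)) + t * (a * d + b * c + b * d)"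
  by (rule theta_eqI[OF assms, where k = "b * d"]) Groebner_Basis.algebra

lemma theta_square:
  fixes t a b v :: complex
  assumes "t * t = t - 2"
  shows "v * (a + t * b)^2 = v * (a^2 - 2 * b^2) + t * (v * (2 * a * b + b^2))"
  by (rule theta_eqI[OF assms, where k = "v * b^2"]) Groebner_Basis.algebra

text \<open>Multilinearity in the rows together with t^2 = t - 2 and t^3 = - t - 2:
  \<open>d1\<close> replaces one row at a time. With \<open>theta_mult\<close> and
  \<open>theta_square\<close> it puts both sides of the Jacobian identity into the form a + t
  b.\<close>

lemma theta_det3:
  fixes t :: complex
  assumes t: "t * t = t - 2"
  defines "d1 \<equiv> \<lambda>a b c d e f g h i a' b' c' d' e' f' g' h' i'.
    det3 a' b' c' d e f g h i + det3 a b c d' e' f' g h i + det3 a b c d e f g' h' i'"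
  shows "det3 (a + t * a') (b + t * b') (c + t * c') (d + t * d') (e + t * e') (f + t * f') (g + t * g') (h + t * h') (i + t * i')
    = (det3 a b c d e f g h i - 2 * d1 a' b' c' d' e' f' g' h' i' a b c d e f g h i - 2 * det3 a' b' c' d' e' f' g' h' i')
    + t * (d1 a b c d e f g h i a' b' c' d' e' f' g' h' i' + d1 a' b' c' d' e' f' g' h' i' a b c d e f g h i - det3 a' b' c' d' e' f' g' h' i')"
  apply (rule theta_eqI[OF t, where k = "d1 a' b' c' d' e' f' g' h' i' a b c d e f g h i + (t + 1) * det3 a' b' c' d' e' f' g' h' i'"])
  unfolding det3_def d1_def by Groebner_Basis.algebra

text \<open>At the squares of the coordinates this is the product of the four forms t x + y + z, t x
  + y - z, t x - y + z, t x - y - z.\<close>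

definition line_quad :: "complex \<Rightarrow> complex \<Rightarrow> complex \<Rightarrow> complex \<Rightarrow> complex" where
  "line_quad t x y z = (t * t * x + y - z)^2 - 4 * (t * t) * x * y"

lemma line_quad_theta:
  fixes t x y z :: complex
  assumes t: "t * t = t - 2"
  shows "line_quad t x y z = (2 * x^2 + (y - z)^2 + 4 * x * y + 4 * x * z) + t * (- 3 * x^2 - 2 * x * y - 2 * x * z)"
  unfolding line_quad_def t
  by (rule theta_eqI[OF t, where k = "x^2"]) Groebner_Basis.algebra

lemma reduced_jacobian_klein:
  fixes t x y z :: complex
  assumes t: "t * t = t - 2"
  shows "reduced_jacobian (\<lambda>j k. klein_c0 j k + t * klein_c1 j k) x y z
    = (8575875 + t * 385914375) * (((x - y) * (y - z) * (z - x))^2 *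
        (line_quad t x y z * line_quad t y x z * line_quad t z x y)^2)"
proof -
  have lin: "sym_sextic (\<lambda>j k. klein_c0 j k + t * klein_c1 j k) x y z = sym_sextic klein_c0 x y z + t * sym_sextic klein_c1 x y z"
    "sym_sextic_dx (\<lambda>j k. klein_c0 j k + t * klein_c1 j k) x y z = sym_sextic_dx klein_c0 x y z + t * sym_sextic_dx klein_c1 x y z"
    "sym_sextic_dy (\<lambda>j k. klein_c0 j k + t * klein_c1 j k) x y z = sym_sextic_dy klein_c0 x y z + t * sym_sextic_dy klein_c1 x y z"
    for x y z
    by (simp_all add: sym_sextic_def sym_sextic_dx_def sym_sextic_dy_def algebra_simps)
  have diag: "3 * (p + t * p') + (q + t * q') = (3 * p + q) + t * (3 * p' + q')"
    and off: "2 * x * (q + t * q') = 2 * x * q + t * (2 * x * q')" for p p' q q' x :: complex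
    by (simp_all add: algebra_simps)
  have explicit: "sym_sextic_dx klein_c0 x y z = (-16) * (6 * x^5)
      + (-40) * (5 * x^4 * y + 5 * x^4 * z)
      + (-3010) * (4 * x^3 * y * z)
      + (545) * (4 * x^3 * y^2 + 4 * x^3 * z^2)
      + (770) * (3 * x^2 * y^2 * z + 3 * x^2 * y * z^2)
      + (-990) * (2 * x * y^2 * z^2)
      + (110) * (3 * x^2 * y^3 + 3 * x^2 * z^3)
      + (1650) * (2 * x * y^3 * z + 2 * x * y * z^3)
      + (-2310) * (y^3 * z^2 + y^2 * z^3)
      + (165) * (2 * x * y^4 + 2 * x * z^4)
      + (330) * (y^4 * z + y * z^4)
      + (660) * (y^5 + z^5)"
    "sym_sextic_dx klein_c1 x y z = (40) * (5 * x^4 * y + 5 * x^4 * z)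
      + (1910) * (4 * x^3 * y * z)
      + (-275) * (4 * x^3 * y^2 + 4 * x^3 * z^2)
      + (1210) * (3 * x^2 * y^2 * z + 3 * x^2 * y * z^2)
      + (2970) * (2 * x * y^2 * z^2)
      + (-330) * (3 * x^2 * y^3 + 3 * x^2 * z^3)
      + (-4950) * (2 * x * y^3 * z + 2 * x * y * z^3)
      + (6930) * (y^3 * z^2 + y^2 * z^3)
      + (-495) * (2 * x * y^4 + 2 * x * z^4)
      + (1650) * (y^4 * z + y * z^4)
      + (-396) * (y^5 + z^5)"
    "sym_sextic_dy klein_c0 x y z = (-40) * (x^5)
      + (-3010) * (x^4 * z)
      + (545) * (2 * x^4 * y)
      + (770) * (2 * x^3 * y * z + x^3 * z^2)
      + (-990) * (2 * x^2 * y * z^2)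
      + (110) * (3 * x^3 * y^2)
      + (1650) * (3 * x^2 * y^2 * z + x^2 * z^3)
      + (-2310) * (3 * x * y^2 * z^2 + 2 * x * y * z^3)
      + (2310) * (3 * y^2 * z^3)
      + (165) * (4 * x^2 * y^3)
      + (330) * (4 * x * y^3 * z + x * z^4)
      + (2145) * (4 * y^3 * z^2 + 2 * y * z^4)
      + (660) * (5 * x * y^4)
      + (-3300) * (5 * y^4 * z + z^5)"
    "sym_sextic_dy klein_c1 x y z = (40) * (x^5)
      + (1910) * (x^4 * z)
      + (-275) * (2 * x^4 * y)
      + (1210) * (2 * x^3 * y * z + x^3 * z^2)
      + (2970) * (2 * x^2 * y * z^2)
      + (-330) * (3 * x^3 * y^2)
      + (-4950) * (3 * x^2 * y^2 * z + x^2 * z^3)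
      + (6930) * (3 * x * y^2 * z^2 + 2 * x * y * z^3)
      + (-6930) * (3 * y^2 * z^3)
      + (-495) * (4 * x^2 * y^3)
      + (1650) * (4 * x * y^3 * z + x * z^4)
      + (1485) * (4 * y^3 * z^2 + 2 * y * z^4)
      + (-396) * (5 * x * y^4)
      + (1980) * (5 * y^4 * z + z^5)" for x y z
    by (simp_all add: sym_sextic_dx_def sym_sextic_dy_def klein_c0_def klein_c1_def)
  show ?thesis
    unfolding reduced_jacobian_def lin diag off theta_det3[OF t]
    unfolding line_quad_theta[OF t] theta_mult[OF t] theta_square[OF t]
    \<comment> \<open>Both sides now read a + t b with a and b free of \<open>t\<close>, so two
      identities in \<open>x\<close>, \<open>y\<close>, \<open>z\<close> alone remain.\<close>
    apply (rule arg_cong2[where f = "\<lambda>a b. a + t * b"])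
    unfolding det3_def explicit sym_sextic_klein_c0 sym_sextic_klein_c1
     apply (subst eq_iff_diff_eq_0, Groebner_Basis.algebra)
    apply (subst eq_iff_diff_eq_0, Groebner_Basis.algebra)
    done
qed


text \<open>The form \<Phi>. The matrix \<open>klein_Q\<close> carries each linear factor to a
  scalar multiple of another; the factors are paired so that these scalars cancel to a sign.\<close>

definition line_prod :: "complex \<Rightarrow> complex \<Rightarrow> complex \<Rightarrow> complex \<Rightarrow> complex" where
  "line_prod t x y z =
    (x * (x + y + t * z))
    * (y * (t * z - x - y))
    * (z * (x - y))
    * (x + y)
    * ((y + z) * (t * x - y + z))
    * ((y - z) * (t * y - x + z))
    * ((x + z) * (t * y - x - z))
    * ((z - x) * (t * x - y - z))
    * (t * x + y + z)
    * (t * x + y - z)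
    * (x + t * y + z)
    * (x + t * y - z)
    * (x - y + t * z)
    * (y - x + t * z)"

text \<open>The coordinates, a Vandermonde product in their squares, and three products of four
  lines. This form matches the Jacobian determinant and shows the effect of sign changes and
  permutations.\<close>

lemma line_prod_squares:
  "line_prod t x y z = x * y * z * ((x^2 - y^2) * (y^2 - z^2) * (z^2 - x^2))
    * (line_quad t (x^2) (y^2) (z^2) * line_quad t (y^2) (x^2) (z^2) * line_quad t (z^2) (x^2) (y^2))"
proof -
  have "line_quad t (x^2) (y^2) (z^2) = (t * x + y + z) * (t * x + y - z) * (t * x - y + z) * (t * x - y - z)"
    unfolding line_quad_def by (subst eq_iff_diff_eq_0) Groebner_Basis.algebra
  moreover have "line_quad t (y^2) (x^2) (z^2) = (x + t * y + z) * (x + t * y - z) * (t * y - x + z) * (t * y - x - z)"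
    unfolding line_quad_def by (subst eq_iff_diff_eq_0) Groebner_Basis.algebra
  moreover have "line_quad t (z^2) (x^2) (y^2) = (x + y + t * z) * (x - y + t * z) * (y - x + t * z) * (t * z - x - y)"
    unfolding line_quad_def by (subst eq_iff_diff_eq_0) Groebner_Basis.algebra
  moreover have "x^2 - y^2 = (x + y) * (x - y)" "y^2 - z^2 = (y + z) * (y - z)" "z^2 - x^2 = (x + z) * (z - x)"
    by (simp_all add: power2_eq_square algebra_simps)
  ultimately show ?thesis
    unfolding line_prod_def by (simp only: mult_ac)
qed

text \<open>The arguments are the coordinates of \<open>klein_Q\<close> applied to (X + Y, X - Y, (1
  - t) W), and of that point itself. Exactly four of the groups of factors change sign
  (\<open>e0\<close>, \<open>e1\<close>, \<open>e2\<close>, \<open>e12\<close>), so the product is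
  invariant.\<close>

lemma line_prod_Q:
  assumes t: "t * t = t - 2"
  shows "line_prod t (X - W) (X + W) ((1 - t) * Y) = line_prod t (X + Y) (X - Y) ((1 - t) * W)"
proof -
  have e0: "(X - W) * ((X - W) + (X + W) + t * ((1 - t) * Y)) = - ((t * ((1 - t) * W) - (X + Y) - (X - Y)) * (X + Y))"
    by (rule theta_eqI[OF t, where k = "(-1) * X * Y + (-1) * X * W"]) Groebner_Basis.algebra
  have e1: "(X + W) * (t * ((1 - t) * Y) - (X - W) - (X + W)) = - (((X + Y) + (X - Y) + t * ((1 - t) * W)) * (X - Y))"
    by (rule theta_eqI[OF t, where k = "(-1) * X * Y + (-1) * X * W"]) Groebner_Basis.algebra
  have e2: "((1 - t) * Y) * ((X - W) - (X + W)) = - (((X + Y) - (X - Y)) * ((1 - t) * W))"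
    by (rule theta_eqI[OF t, where k = "0"]) Groebner_Basis.algebra
  have e3: "((X - W) + (X + W)) = ((X + Y) + (X - Y))"
    by (rule theta_eqI[OF t, where k = "0"]) Groebner_Basis.algebra
  have e4: "((X + W) + ((1 - t) * Y)) * (t * (X - W) - (X + W) + ((1 - t) * Y)) = (t * (X + Y) - (X - Y) - ((1 - t) * W)) * ((X - Y) - ((1 - t) * W))"
    by (rule theta_eqI[OF t, where k = "(-1) * X * Y + (1) * Y^2 + (-1) * X * W + (-1) * W^2"]) Groebner_Basis.algebra
  have e5: "((X + W) - ((1 - t) * Y)) * (t * (X + W) - (X - W) + ((1 - t) * Y)) = (t * (X - Y) - (X + Y) - ((1 - t) * W)) * ((X - Y) + ((1 - t) * W))"
    by (rule theta_eqI[OF t, where k = "(1) * X * Y + (-1) * Y^2 + (1) * X * W + (1) * W^2"]) Groebner_Basis.algebra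
  have e6: "((X - W) + ((1 - t) * Y)) * (t * (X + W) - (X - W) - ((1 - t) * Y)) = (t * (X + Y) - (X - Y) + ((1 - t) * W)) * ((X + Y) + ((1 - t) * W))"
    by (rule theta_eqI[OF t, where k = "(-1) * X * Y + (-1) * Y^2 + (1) * X * W + (-1) * W^2"]) Groebner_Basis.algebra
  have e7: "(((1 - t) * Y) - (X - W)) * (t * (X - W) - (X + W) - ((1 - t) * Y)) = (t * (X - Y) - (X + Y) + ((1 - t) * W)) * (((1 - t) * W) - (X + Y))"
    by (rule theta_eqI[OF t, where k = "(-1) * X * Y + (-1) * Y^2 + (1) * X * W + (-1) * W^2"]) Groebner_Basis.algebra
  have e8: "(t * (X - W) + (X + W) + ((1 - t) * Y)) = ((X + Y) + t * (X - Y) + ((1 - t) * W))"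
    by (rule theta_eqI[OF t, where k = "0"]) Groebner_Basis.algebra
  have e9: "(t * (X - W) + (X + W) - ((1 - t) * Y)) = (t * (X + Y) + (X - Y) + ((1 - t) * W))"
    by (rule theta_eqI[OF t, where k = "0"]) Groebner_Basis.algebra
  have e10: "((X - W) + t * (X + W) + ((1 - t) * Y)) = ((X + Y) + t * (X - Y) - ((1 - t) * W))"
    by (rule theta_eqI[OF t, where k = "0"]) Groebner_Basis.algebra
  have e11: "((X - W) + t * (X + W) - ((1 - t) * Y)) = (t * (X + Y) + (X - Y) - ((1 - t) * W))"
    by (rule theta_eqI[OF t, where k = "0"]) Groebner_Basis.algebra
  have e12: "((X - W) - (X + W) + t * ((1 - t) * Y)) = - (((X - Y) - (X + Y) + t * ((1 - t) * W)))"
    by (rule theta_eqI[OF t, where k = "(-1) * Y + (-1) * W"]) Groebner_Basis.algebra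
  have e13: "((X + W) - (X - W) + t * ((1 - t) * Y)) = ((X + Y) - (X - Y) + t * ((1 - t) * W))"
    by (rule theta_eqI[OF t, where k = "(-1) * Y + (1) * W"]) Groebner_Basis.algebra
  show ?thesis
    unfolding line_prod_def e0 e1 e2 e4 e5 e6 e7 e8 e9 e10 e11 e12 e13
    \<comment> \<open>Applied last because its left-hand side is a subterm of other factors, for
      instance of the one in \<open>e0\<close>.\<close>
    unfolding e3
    by (simp only: mult_minus_left mult_minus_right minus_minus mult_ac)
qed

lemma jacobian_det_identity:
  fixes t x y z :: complex
  assumes t: "t * t = t - 2"
  shows "x^2 * y^2 * z^2 * reduced_jacobian (\<lambda>j k. klein_c0 j k + t * klein_c1 j k) (x^2) (y^2) (z^2)
    = (8575875 + t * 385914375) * (line_prod t x y z)^2"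
  unfolding reduced_jacobian_klein[OF t] line_prod_squares power_mult_distrib by (simp only: mult_ac)


section \<open>Homogeneous polynomial functions\<close>

lemma homog_poly_monomial:
  assumes "i + j + k = d"
  shows "homog_poly d (\<lambda>v. c * (v$1)^i * (v$2)^j * (v$3)^k)"
  unfolding homog_poly_def
proof (intro exI allI)
  fix v :: "complex^3"
  let ?a = "\<lambda>i' j'. if i' = i \<and> j' = j then c else 0"
  have "(\<Sum>i'\<le>d. \<Sum>j'\<le>d - i'. ?a i' j' * (v$1)^i' * (v$2)^j' * (v$3)^(d - i' - j'))
      = (\<Sum>i'\<in>{i}. \<Sum>j'\<le>d - i'. ?a i' j' * (v$1)^i' * (v$2)^j' * (v$3)^(d - i' - j'))"
    using assms by (intro sum.mono_neutral_right) auto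
  also have "\<dots> = (\<Sum>j'\<le>d - i. ?a i j' * (v$1)^i * (v$2)^j' * (v$3)^(d - i - j'))" by simp
  also have "\<dots> = (\<Sum>j'\<in>{j}. ?a i j' * (v$1)^i * (v$2)^j' * (v$3)^(d - i - j'))"
    using assms by (intro sum.mono_neutral_right) auto
  also have "\<dots> = c * (v$1)^i * (v$2)^j * (v$3)^k"
    using assms by auto
  finally show "c * (v$1)^i * (v$2)^j * (v$3)^k
    = (\<Sum>i'\<le>d. \<Sum>j'\<le>d - i'. ?a i' j' * (v$1)^i' * (v$2)^j' * (v$3)^(d - i' - j'))" by simp
qed

lemma homog_poly_add:
  assumes "homog_poly d p" "homog_poly d q"
  shows "homog_poly d (\<lambda>v. p v + q v)"
proof -
  obtain a b where ab: "\<And>v. p v = (\<Sum>i\<le>d. \<Sum>j\<le>d - i. a i j * (v$1)^i * (v$2)^j * (v$3)^(d - i - j))"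
    "\<And>v. q v = (\<Sum>i\<le>d. \<Sum>j\<le>d - i. b i j * (v$1)^i * (v$2)^j * (v$3)^(d - i - j))"
    using assms unfolding homog_poly_def by blast
  show ?thesis unfolding homog_poly_def
    by (rule exI[of _ "\<lambda>i j. a i j + b i j"]) (simp add: ab sum.distrib distrib_right)
qed

lemma homog_poly_0: "homog_poly d (\<lambda>v. 0)"
  unfolding homog_poly_def by (rule exI[of _ "\<lambda>i j. 0"]) simp

lemma homog_poly_sum:
  assumes "\<And>i. i \<in> A \<Longrightarrow> homog_poly d (p i)"
  shows "homog_poly d (\<lambda>v. \<Sum>i\<in>A. p i v)"
  using assms by (induction A rule: infinite_finite_induct) (auto intro: homog_poly_0 homog_poly_add)

lemma homog_poly_mult:
  assumes "homog_poly d p" "homog_poly e q"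
  shows "homog_poly (d + e) (\<lambda>v. p v * q v)"
proof -
  obtain a b where ab: "\<And>v. p v = (\<Sum>i\<le>d. \<Sum>j\<le>d - i. a i j * (v$1)^i * (v$2)^j * (v$3)^(d - i - j))"
    "\<And>v. q v = (\<Sum>i\<le>e. \<Sum>j\<le>e - i. b i j * (v$1)^i * (v$2)^j * (v$3)^(e - i - j))"
    using assms unfolding homog_poly_def by blast
  have eq: "p v * q v = (\<Sum>i\<le>d. \<Sum>j\<le>d - i. \<Sum>i'\<le>e. \<Sum>j'\<le>e - i'.
      (a i j * b i' j') * (v$1)^(i + i') * (v$2)^(j + j') * (v$3)^((d - i - j) + (e - i' - j')))" for v
    unfolding ab(1) sum_distrib_right unfolding ab(2) sum_distrib_left
    by (intro sum.cong refl) (simp only: power_add mult_ac)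
  show ?thesis unfolding eq
    by (intro homog_poly_sum homog_poly_monomial) auto
qed

lemma homog_poly_coord: "homog_poly 1 (\<lambda>v. v $ k)"
  using homog_poly_monomial[of 1 0 0 1 1] homog_poly_monomial[of 0 1 0 1 1] homog_poly_monomial[of 0 0 1 1 1]
    exhaust_3[of k] by auto

lemma homog_poly_power: "homog_poly d p \<Longrightarrow> homog_poly (d * n) (\<lambda>v. p v ^ n)"
proof (induction n)
  case 0
  then show ?case using homog_poly_monomial[of 0 0 0 0 1] by simp
next
  case (Suc n)
  then show ?case using homog_poly_mult[of d p "d * n" "\<lambda>v. p v ^ n"] by simp
qed

lemma homog_poly_cmult: "homog_poly d p \<Longrightarrow> homog_poly d (\<lambda>v. c * p v)"
  using homog_poly_mult[OF homog_poly_monomial[of 0 0 0 0 c], of d p] by simp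

lemma homog_poly_homog:
  assumes "homog_poly d p"
  shows "p (s *s v) = s^d * p v"
proof -
  obtain a where a: "\<And>v. p v = (\<Sum>i\<le>d. \<Sum>j\<le>d - i. a i j * (v$1)^i * (v$2)^j * (v$3)^(d - i - j))"
    using assms unfolding homog_poly_def by blast
  have "a i j * (s * v$1)^i * (s * v$2)^j * (s * v$3)^(d - i - j)
      = s^d * (a i j * (v$1)^i * (v$2)^j * (v$3)^(d - i - j))" if "i \<le> d" "j \<le> d - i" for i j
  proof -
    have "s^d = s^i * s^j * s^(d - i - j)" using that by (simp flip: power_add)
    then show ?thesis by (simp add: power_mult_distrib)
  qed
  then show ?thesis unfolding a sum_distrib_left by (intro sum.cong refl) simp
qed

lemma homog_poly_sym_sextic:
  assumes "homog_poly 2 p" "homog_poly 2 q" "homog_poly 2 r"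
  shows "homog_poly 12 (\<lambda>v. sym_sextic c (p v) (q v) (r v))"
proof -
  have m: "homog_poly 12 (\<lambda>v. b * (p v ^ i * (q v ^ j * r v ^ k)))" if "i + j + k = 6" for b i j k
  proof -
    have "2 * i + (2 * j + 2 * k) = 12" using that by simp
    then show ?thesis
      using homog_poly_cmult[OF homog_poly_mult[OF homog_poly_power[OF assms(1), of i]
          homog_poly_mult[OF homog_poly_power[OF assms(2), of j] homog_poly_power[OF assms(3), of k]]], of b]
      by metis
  qed
  have eq: "sym_sextic c x y z = c 0 0 * (x^6 * (y^0 * z^0))
      + c 1 0 * (x^5 * (y^1 * z^0))
      + c 1 0 * (x^5 * (y^0 * z^1))
      + c 1 1 * (x^4 * (y^1 * z^1))
      + c 2 0 * (x^4 * (y^2 * z^0))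
      + c 2 0 * (x^4 * (y^0 * z^2))
      + c 2 1 * (x^3 * (y^2 * z^1))
      + c 2 1 * (x^3 * (y^1 * z^2))
      + c 2 2 * (x^2 * (y^2 * z^2))
      + c 3 0 * (x^3 * (y^3 * z^0))
      + c 3 0 * (x^3 * (y^0 * z^3))
      + c 3 1 * (x^2 * (y^3 * z^1))
      + c 3 1 * (x^2 * (y^1 * z^3))
      + c 3 2 * (x^1 * (y^3 * z^2))
      + c 3 2 * (x^1 * (y^2 * z^3))
      + c 3 3 * (x^0 * (y^3 * z^3))
      + c 4 0 * (x^2 * (y^4 * z^0))
      + c 4 0 * (x^2 * (y^0 * z^4))
      + c 4 1 * (x^1 * (y^4 * z^1))
      + c 4 1 * (x^1 * (y^1 * z^4))
      + c 4 2 * (x^0 * (y^4 * z^2))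
      + c 4 2 * (x^0 * (y^2 * z^4))
      + c 5 0 * (x^1 * (y^5 * z^0))
      + c 5 0 * (x^1 * (y^0 * z^5))
      + c 5 1 * (x^0 * (y^5 * z^1))
      + c 5 1 * (x^0 * (y^1 * z^5))
      + c 6 0 * (x^0 * (y^6 * z^0))
      + c 6 0 * (x^0 * (y^0 * z^6))" for x y z
    by (simp add: sym_sextic_def distrib_left)
  show ?thesis
    unfolding eq by (intro homog_poly_add m) simp_all
qed

lemma homog_poly_sextic_map: "homog_poly 15 (\<lambda>v. sextic_map c v $ i)"
proof -
  have sq: "homog_poly 2 (\<lambda>v. (v $ k)^2)" for k
    using homog_poly_power[OF homog_poly_coord, of 2] by simp
  have "homog_poly 15 (\<lambda>v. (v $ k)^3 * sym_sextic c ((v $ k)^2) ((v $ l)^2) ((v $ m)^2))" for k l m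
    using homog_poly_mult[OF homog_poly_power[OF homog_poly_coord, of 3] homog_poly_sym_sextic[OF sq sq sq]] by simp
  then show ?thesis
    using exhaust_3[of i] by (auto simp: sextic_map_def)
qed

section \<open>Gradients and Jacobian matrices of homogeneous maps\<close>

text \<open>Differentiability is encoded as the chain rule along complex curves. In this form it
  passes through sums, products and powers by the derivative rules of one complex variable.\<close>

definition has_gradient :: "(complex^3 \<Rightarrow> complex) \<Rightarrow> (complex^3 \<Rightarrow> complex^3) \<Rightarrow> bool" where
  "has_gradient p G \<longleftrightarrow> (\<forall>w w' t. (\<forall>i. ((\<lambda>t. w t $ i) has_field_derivative w' $ i) (at t)) \<longrightarrow>
     ((\<lambda>t. p (w t)) has_field_derivative lin_form (G (w t)) w') (at t))"

lemma has_gradientD: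
  fixes w :: "complex \<Rightarrow> complex^3"
  assumes "has_gradient p G" and "\<And>i. ((\<lambda>t. w t $ i) has_field_derivative w' $ i) (at t)"
  shows "((\<lambda>t. p (w t)) has_field_derivative lin_form (G (w t)) w') (at t)"
  using assms unfolding has_gradient_def by blast

lemma has_gradient_const: "has_gradient (\<lambda>v. c) (\<lambda>v. 0)"
  by (simp add: has_gradient_def lin_form_def)

lemma has_gradient_coord: "has_gradient (\<lambda>v. v $ k) (\<lambda>v. axis k 1)"
  by (simp add: has_gradient_def lin_form_def axis_def if_distrib[where f = "\<lambda>x. x * _"] cong: if_cong)

lemma has_gradient_add:
  assumes "has_gradient p G" "has_gradient q H"
  shows "has_gradient (\<lambda>v. p v + q v) (\<lambda>v. G v + H v)"
  using assms unfolding has_gradient_def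
  by (auto simp: lin_form_def distrib_right sum.distrib intro!: DERIV_add)

lemma has_gradient_mult:
  assumes "has_gradient p G" "has_gradient q H"
  shows "has_gradient (\<lambda>v. p v * q v) (\<lambda>v. p v *s H v + q v *s G v)"
  unfolding has_gradient_def
proof (intro allI impI)
  fix w :: "complex \<Rightarrow> complex^3" and w' t
  assume w: "\<forall>i. ((\<lambda>t. w t $ i) has_field_derivative w' $ i) (at t)"
  have "((\<lambda>t. p (w t)) has_field_derivative lin_form (G (w t)) w') (at t)"
    "((\<lambda>t. q (w t)) has_field_derivative lin_form (H (w t)) w') (at t)"
    using assms w by (simp_all add: has_gradient_def)
  from DERIV_mult[OF this]
  show "((\<lambda>t. p (w t) * q (w t)) has_field_derivative lin_form (p (w t) *s H (w t) + q (w t) *s G (w t)) w') (at t)"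
    by (rule DERIV_cong) (simp add: lin_form_def algebra_simps sum.distrib sum_distrib_left)
qed

lemma has_gradient_power:
  assumes "has_gradient p G"
  shows "\<exists>H. has_gradient (\<lambda>v. p v ^ n) H"
proof (induction n)
  case 0
  show ?case using has_gradient_const[of 1] by auto
next
  case (Suc n)
  then obtain H where "has_gradient (\<lambda>v. p v ^ n) H" by blast
  from has_gradient_mult[OF assms this] show ?case by auto
qed

lemma has_gradient_sum:
  assumes "\<And>i. i \<in> A \<Longrightarrow> \<exists>G. has_gradient (p i) G"
  shows "\<exists>G. has_gradient (\<lambda>v. \<Sum>i\<in>A. p i v) G"
  using assms
proof (induction A rule: infinite_finite_induct)
  case (insert i A)
  then obtain G H where "has_gradient (p i) G" "has_gradient (\<lambda>v. \<Sum>i\<in>A. p i v) H" by blast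
  from has_gradient_add[OF this] show ?case using insert(1,2) by auto
qed (auto intro: has_gradient_const)

lemma homog_poly_has_gradient:
  assumes "homog_poly d p"
  shows "\<exists>G. has_gradient p G"
proof -
  obtain a where a: "p = (\<lambda>v. \<Sum>i\<le>d. \<Sum>j\<le>d - i. a i j * (v$1)^i * (v$2)^j * (v$3)^(d - i - j))"
    using assms unfolding homog_poly_def by blast
  have "\<exists>G. has_gradient (\<lambda>v. c * (v$1)^i * (v$2)^j * (v$3)^k) G" for c i j k
  proof -
    obtain H1 H2 H3 where "has_gradient (\<lambda>v. (v$1)^i) H1" "has_gradient (\<lambda>v. (v$2)^j) H2" "has_gradient (\<lambda>v. (v$3)^k) H3"
      using has_gradient_power[OF has_gradient_coord] by metis
    from has_gradient_mult[OF has_gradient_mult[OF has_gradient_mult[OF has_gradient_const this(1)] this(2)] this(3)]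
    show ?thesis by blast
  qed
  then show ?thesis unfolding a by (intro has_gradient_sum)
qed

lemma jacobian_chain_rule:
  fixes F :: "complex^3 \<Rightarrow> complex^3"
    and w :: "complex \<Rightarrow> complex^3"
  assumes F: "\<And>i. homog_poly d (\<lambda>v. F v $ i)"
    and w: "\<And>i. ((\<lambda>t. w t $ i) has_field_derivative w' $ i) (at t)"
  shows "((\<lambda>t. F (w t) $ i) has_field_derivative (jacobian_mat F (w t) *v w') $ i) (at t)"
proof -
  obtain G where G: "has_gradient (\<lambda>v. F v $ i) G" using homog_poly_has_gradient[OF F] by blast
  \<comment> \<open>Coordinate lines identify the gradient with a row of
    \<open>jacobian_mat\<close>.\<close>
  have "((\<lambda>t. F (v + t *s axis j 1) $ i) has_field_derivative G v $ j) (at 0)" for v j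
  proof -
    have "((\<lambda>t. F (v + t *s axis j 1) $ i) has_field_derivative lin_form (G (v + 0 *s axis j 1)) (axis j 1)) (at 0)"
      by (rule has_gradientD[OF G, where w = "\<lambda>t. v + t *s axis j 1"]) (auto intro!: derivative_eq_intros)
    then show ?thesis by (simp add: lin_form_def axis_def if_distrib[where f = "\<lambda>x. _ * x"] cong: if_cong)
  qed
  then have "jacobian_mat F v $ i $ j = G v $ j" for v j
    by (simp add: jacobian_mat_def DERIV_imp_deriv)
  then have "(jacobian_mat F (w t) *v w') $ i = lin_form (G (w t)) w'"
    by (simp add: matrix_vector_mult_def lin_form_def)
  then show ?thesis using has_gradientD[OF G w] by simp
qed

lemma jacobian_mat_eqI:
  fixes F :: "complex^3 \<Rightarrow> complex^3"
    and w :: "complex \<Rightarrow> complex^3"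
  assumes "\<And>i. homog_poly d (\<lambda>v. F v $ i)"
    and "\<And>i. ((\<lambda>t. w t $ i) has_field_derivative w' $ i) (at t)"
    and "\<And>i. ((\<lambda>t. F (w t) $ i) has_field_derivative D $ i) (at t)"
  shows "jacobian_mat F (w t) *v w' = D"
  using DERIV_unique[OF jacobian_chain_rule[OF assms(1,2)] assms(3)] by (simp add: vec_eq_iff)

text \<open>Differentiation along (1 + t) v. It makes the Jacobian matrix singular at a common zero,
  and in the uniqueness part it supplies a column of that matrix.\<close>

lemma jacobian_euler:
  fixes F :: "complex^3 \<Rightarrow> complex^3"
  assumes "\<And>i. homog_poly d (\<lambda>v. F v $ i)"
  shows "jacobian_mat F v *v v = of_nat d *s F v"
proof -
  have F: "F ((1 + t) *s v) $ i = (1 + t)^d * F v $ i" for t i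
    by (rule homog_poly_homog[OF assms])
  have "jacobian_mat F ((1 + 0) *s v) *v v = of_nat d *s F v"
  proof (rule jacobian_mat_eqI[OF assms, where w = "\<lambda>t. (1 + t) *s v"])
    show "((\<lambda>t. ((1 + t) *s v) $ i) has_field_derivative v $ i) (at 0)" for i
      by (auto intro!: derivative_eq_intros)
    show "((\<lambda>t. F ((1 + t) *s v) $ i) has_field_derivative (of_nat d *s F v) $ i) (at 0)" for i
      unfolding F by (auto intro!: derivative_eq_intros)
  qed
  then show ?thesis by simp
qed

text \<open>Two matrices are allowed so that the chain rule covers both equivariance up to a scalar
  and homogeneity, where \<open>A\<close> and \<open>B\<close> are different scalar
  matrices.\<close>

lemma jacobian_equivariant:
  fixes F :: "complex^3 \<Rightarrow> complex^3"
  assumes F: "\<And>i. homog_poly d (\<lambda>v. F v $ i)" and AB: "\<And>v. F (A *v v) = B *v F v"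
  shows "jacobian_mat F (A *v v) ** A = B ** jacobian_mat F v"
proof -
  have "(jacobian_mat F (A *v v) ** A) *v w = (B ** jacobian_mat F v) *v w" for w
  proof -
    have line: "((\<lambda>t. (v + t *s w) $ i) has_field_derivative w $ i) (at 0)" for i
      by (auto intro!: derivative_eq_intros)
    have "((\<lambda>t. F (v + t *s w) $ i) has_field_derivative (jacobian_mat F (v + 0 *s w) *v w) $ i) (at 0)" for i
      by (rule jacobian_chain_rule[OF F, where w = "\<lambda>t. v + t *s w"]) (rule line)
    then have "((\<lambda>t. (B *v F (v + t *s w)) $ i) has_field_derivative (B *v (jacobian_mat F v *v w)) $ i) (at 0)" for i
      unfolding matrix_vector_mult_def[of B] by (auto intro!: DERIV_sum DERIV_cmult)
    then have "((\<lambda>t. F (A *v (v + t *s w)) $ i) has_field_derivative (B *v (jacobian_mat F v *v w)) $ i) (at 0)" for i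
      by (simp add: AB)
    moreover have "((\<lambda>t. (A *v (v + t *s w)) $ i) has_field_derivative (A *v w) $ i) (at 0)" for i
      unfolding matrix_vector_mult_def by (auto intro!: DERIV_sum DERIV_cmult line[simplified])
    ultimately have "jacobian_mat F (A *v (v + 0 *s w)) *v (A *v w) = B *v (jacobian_mat F v *v w)"
      using jacobian_mat_eqI[OF F, where w = "\<lambda>t. A *v (v + t *s w)" and t = 0] by blast
    then show ?thesis by (simp add: matrix_vector_mul_assoc)
  qed
  then show ?thesis by (simp add: matrix_eq)
qed

text \<open>The determinants of \<open>A\<close> on the two sides cancel, and only that of the
  scalar matrix \<open>c\<close> is left. This is the source of the equation k^3 = 1 for
  multipliers.\<close>

lemma det_jacobian_equivariant:
  fixes F :: "complex^3 \<Rightarrow> complex^3"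
  assumes "\<And>i. homog_poly d (\<lambda>v. F v $ i)" and "\<And>v. F (A *v v) = c *s (A *v F v)" and "invertible A"
  shows "det (jacobian_mat F (A *v v)) = c^3 * det (jacobian_mat F v)"
proof -
  have "jacobian_mat F (A *v v) ** A = (mat c ** A) ** jacobian_mat F v"
    by (rule jacobian_equivariant[OF assms(1)]) (simp add: assms(2) mat_scalar_mult_vec)
  then have "det (jacobian_mat F (A *v v)) * det A = det (mat c :: complex^3^3) * det A * det (jacobian_mat F v)"
    by (metis det_mul)
  moreover have "det (mat c :: complex^3^3) = c^3"
    by (simp add: det_3 mat_def power3_eq_cube)
  ultimately show ?thesis using assms(3) by (simp add: invertible_det_nz)
qed

text \<open>The factor \<open>s^3\<close> on the left avoids the exponent 3 (d - 1), whose
  subtraction would be truncated at d = 0.\<close>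

lemma det_jacobian_homog:
  fixes F :: "complex^3 \<Rightarrow> complex^3"
  assumes F: "\<And>i. homog_poly d (\<lambda>v. F v $ i)"
  shows "s^3 * det (jacobian_mat F (s *s v)) = s^(3 * d) * det (jacobian_mat F v)"
proof -
  have A: "mat c *v v = c *s v" for c :: complex and v :: "complex^3"
    using mat_scalar_mult_vec[of c "mat 1" v] by simp
  have "jacobian_mat F (mat s *v v) ** mat s = mat (s^d) ** jacobian_mat F v"
  proof (rule jacobian_equivariant[OF F])
    show "F (mat s *v v) = mat (s^d) *v F v" for v
      unfolding A using homog_poly_homog[OF F] by (simp add: vec_eq_iff)
  qed
  then have "det (jacobian_mat F (s *s v)) * det (mat s :: complex^3^3) = det (mat (s^d) :: complex^3^3) * det (jacobian_mat F v)"
    unfolding A by (metis det_mul)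
  moreover have "det (mat c :: complex^3^3) = c^3" for c
    by (simp add: det_3 mat_def power3_eq_cube)
  ultimately show ?thesis by (simp add: mult.commute flip: power_mult)
qed

section \<open>The Jacobian determinant of the maps built from sextics\<close>

lemma has_field_derivative_sym_sextic:
  assumes "(x has_field_derivative x') (at t)" "(y has_field_derivative y') (at t)" "(z has_field_derivative z') (at t)"
  shows "((\<lambda>t. sym_sextic c (x t) (y t) (z t)) has_field_derivative
    sym_sextic_dx c (x t) (y t) (z t) * x' + sym_sextic_dy c (x t) (y t) (z t) * y' + sym_sextic_dy c (x t) (z t) (y t) * z') (at t)"
  unfolding sym_sextic_def
  by (rule DERIV_cong, (rule derivative_intros assms refl)+)
    (simp add: sym_sextic_dx_def sym_sextic_dy_def power_numeral_reduce algebra_simps)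

lemma jacobian_sextic_map:
  fixes v :: "complex^3"
  defines "x \<equiv> v$1" and "y \<equiv> v$2" and "z \<equiv> v$3"
  shows "jacobian_mat (sextic_map c) v = vector
    [vector [x^2 * (3 * sym_sextic c (x^2) (y^2) (z^2) + 2 * x^2 * sym_sextic_dx c (x^2) (y^2) (z^2)),
        2 * x^3 * y * sym_sextic_dy c (x^2) (y^2) (z^2), 2 * x^3 * z * sym_sextic_dy c (x^2) (z^2) (y^2)],
     vector [2 * y^3 * x * sym_sextic_dy c (y^2) (x^2) (z^2),
        y^2 * (3 * sym_sextic c (y^2) (x^2) (z^2) + 2 * y^2 * sym_sextic_dx c (y^2) (x^2) (z^2)),
        2 * y^3 * z * sym_sextic_dy c (y^2) (z^2) (x^2)],
     vector [2 * z^3 * x * sym_sextic_dy c (z^2) (x^2) (y^2), 2 * z^3 * y * sym_sextic_dy c (z^2) (y^2) (x^2),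
        z^2 * (3 * sym_sextic c (z^2) (x^2) (y^2) + 2 * z^2 * sym_sextic_dx c (z^2) (x^2) (y^2))]]"
proof -
  have d: "((\<lambda>t. (p + t * p')^3 * sym_sextic c ((p + t * p')^2) ((q + t * q')^2) ((r + t * r')^2)) has_field_derivative
      3 * p^2 * p' * sym_sextic c (p^2) (q^2) (r^2) + p^3 * (sym_sextic_dx c (p^2) (q^2) (r^2) * (2 * p * p')
        + sym_sextic_dy c (p^2) (q^2) (r^2) * (2 * q * q') + sym_sextic_dy c (p^2) (r^2) (q^2) * (2 * r * r'))) (at 0)"
    for p p' q q' r r' :: complex
  proof -
    have sq: "((\<lambda>t. (p + t * p')^2) has_field_derivative 2 * p * p') (at 0)" for p p' :: complex
      by (auto intro!: derivative_eq_intros)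
    have cube: "((\<lambda>t. (p + t * p')^3) has_field_derivative 3 * p^2 * p') (at 0)"
      by (auto intro!: derivative_eq_intros)
    show ?thesis
      using DERIV_mult[OF cube has_field_derivative_sym_sextic[OF sq[of p p'] sq[of q q'] sq[of r r']], of c]
      by (rule DERIV_cong) simp
  qed
  have diag: "3 * x^2 * S + x^3 * (D * (2 * x)) = x^2 * (3 * S + 2 * x^2 * D)" for x S D :: complex
    by (simp add: power2_eq_square power3_eq_cube algebra_simps)
  show ?thesis
    unfolding jacobian_mat_def vec_eq_iff forall_3 x_def y_def z_def sextic_map_def
    by (simp add: axis_def DERIV_imp_deriv[OF d] diag)
qed

lemma det_vector_det3:
  "det (vector [vector [a, b, c], vector [d, e, f], vector [g, h, i]] :: complex^3^3) = det3 a b c d e f g h i"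
  by (simp add: det_3 det3_def algebra_simps)

text \<open>With D the diagonal matrix of the coordinates, the Jacobian matrix is D^3 M D^(-1),
  where M is the matrix in \<open>reduced_jacobian\<close>. Written as a polynomial identity this
  also covers vanishing coordinates.\<close>

lemma det_jacobian_sextic_map:
  "det (jacobian_mat (sextic_map c) v) = (v$1)^2 * (v$2)^2 * (v$3)^2 * reduced_jacobian c ((v$1)^2) ((v$2)^2) ((v$3)^2)"
proof -
  have "det3 (x^2 * a) (2 * x^3 * y * b) (2 * x^3 * z * b') (2 * y^3 * x * d) (y^2 * e) (2 * y^3 * z * d')
      (2 * z^3 * x * f) (2 * z^3 * y * f') (z^2 * g)
    = x^2 * y^2 * z^2 * det3 a (2 * y^2 * b) (2 * z^2 * b') (2 * x^2 * d) e (2 * z^2 * d') (2 * x^2 * f) (2 * y^2 * f') g"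
    for x y z a b b' d d' e f f' g :: complex
    unfolding det3_def by (subst eq_iff_diff_eq_0) Groebner_Basis.algebra
  then show ?thesis
    unfolding jacobian_sextic_map reduced_jacobian_def det_vector_det3 by simp
qed

lemma det_jacobian_klein:
  obtains c where "c \<noteq> 0" "\<And>v. det (jacobian_mat (sextic_map klein_c) v) = c * (line_prod klein_theta (v$1) (v$2) (v$3))^2"
proof
  define e where "e = (\<lambda>j k. klein_c0 j k + klein_theta * klein_c1 j k)"
  have c: "klein_c = (\<lambda>j k. 1 / 16384 * e j k)"
    by (simp add: klein_c_def e_def fun_eq_iff)
  have eq: "sym_sextic (\<lambda>j k. s * e j k) x y z = s * sym_sextic e x y z"
    "sym_sextic_dx (\<lambda>j k. s * e j k) x y z = s * sym_sextic_dx e x y z"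
    "sym_sextic_dy (\<lambda>j k. s * e j k) x y z = s * sym_sextic_dy e x y z" for s x y z
    by (simp_all add: sym_sextic_def sym_sextic_dx_def sym_sextic_dy_def distrib_left mult.assoc)
  have det3: "det3 (s * a) (s * b) (s * c) (s * d) (s * e) (s * f) (s * g) (s * h) (s * i)
    = s^3 * det3 a b c d e f g h i" for s a b c d e f g h i
    unfolding det3_def by (subst eq_iff_diff_eq_0) Groebner_Basis.algebra
  have diag: "3 * (s * p) + s * q = s * (3 * p + q)" and off: "2 * x * (s * q) = s * (2 * x * q)"
    for s p q x :: complex by (simp_all add: algebra_simps)
  have "reduced_jacobian (\<lambda>j k. s * e j k) x y z = s^3 * reduced_jacobian e x y z" for s x y z
    unfolding reduced_jacobian_def det3[symmetric] eq off diag by (rule refl)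
  then have red: "reduced_jacobian klein_c x y z = (1 / 16384)^3 * reduced_jacobian e x y z" for x y z
    unfolding c by blast
  show "det (jacobian_mat (sextic_map klein_c) v)
      = (8575875 + klein_theta * 385914375) / 16384^3 * (line_prod klein_theta (v$1) (v$2) (v$3))^2" for v
  proof -
    have "det (jacobian_mat (sextic_map klein_c) v) = (1 / 16384)^3 * ((v$1)^2 * (v$2)^2 * (v$3)^2 * reduced_jacobian e ((v$1)^2) ((v$2)^2) ((v$3)^2))"
      unfolding det_jacobian_sextic_map red by (simp only: mult_ac)
    also have "\<dots> = (1 / 16384)^3 * ((8575875 + klein_theta * 385914375) * (line_prod klein_theta (v$1) (v$2) (v$3))^2)"
      unfolding e_def jacobian_det_identity[OF klein_theta_sq] ..
    finally show ?thesis by (simp add: power_divide)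
  qed
  show "(8575875 + klein_theta * 385914375) / 16384^3 \<noteq> 0"
    by (simp add: klein_theta_def complex_eq_iff)
qed

section \<open>Equivariance of the lift and absence of common zeros\<close>

lemma klein_Q_mult_vec:
  "klein_Q *v u = vector [(u$1 + u$2 - klein_theta * u$3) / 2, (u$1 + u$2 + klein_theta * u$3) / 2, (1 - klein_theta) * (u$1 - u$2) / 2]"
  unfolding klein_Q_def vec_eq_iff forall_3 matrix_vector_mult_def sum_3 vec_lambda_beta
    vector_scaleR_component vector_3
  by (simp add: scaleR_conv_of_real algebra_simps add_divide_distrib diff_divide_distrib)

text \<open>In the coordinates X, Y, W one identity \<open>S\<close> gives all three components. Its
  symmetry in Y and W gives the sum of the first two; putting W or Y in the place of X gives their
  difference and the third.\<close>

lemma sextic_map_klein_Q: "sextic_map klein_c (klein_Q *v v) = klein_Q *v sextic_map klein_c v"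
proof -
  define t where "t = klein_theta"
  have tt: "t * t = t - 2" by (simp add: t_def klein_theta_sq)
  define N where "N = (\<lambda>x y z. sym_sextic klein_c0 x y z + t * sym_sextic klein_c1 x y z)"
  have N: "sym_sextic klein_c x y z = N x y z / 16384" for x y z
    using sym_sextic_lincomb[of klein_c0 klein_theta klein_c1 16384 x y z]
    by (simp add: N_def klein_c_def[abs_def] t_def)
  define X where "X = (v$1 + v$2) / 2"
  define Y where "Y = (v$1 - v$2) / 2"
  define W where "W = t * v$3 / 2"
  have tau: "(1 - t) * t = 2" by (rule theta_eqI[OF tt, where k = "- 1"]) Groebner_Basis.algebra
  have v: "v$1 = X + Y" "v$2 = X - Y" "v$3 = (1 - t) * W"
  proof -
    have "(1 - t) * W = (1 - t) * t * v$3 / 2" by (simp add: W_def)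
    then show "v$3 = (1 - t) * W" unfolding tau by simp
  qed (simp_all add: X_def Y_def field_simps)
  have Qm: "klein_Q *v u = vector [(u$1 + u$2 - t * u$3) / 2, (u$1 + u$2 + t * u$3) / 2, (1 - t) * (u$1 - u$2) / 2]" for u
    unfolding t_def by (rule klein_Q_mult_vec)
  have tW: "t * ((1 - t) * W) = 2 * W" using tau by (metis mult.assoc mult.commute)
  have Qv: "klein_Q *v v = vector [X - W, X + W, (1 - t) * Y]"
    unfolding Qm v tW by (simp add: vec_eq_iff forall_3 diff_divide_distrib add_divide_distrib)
  define S where "S = (\<lambda>X Y W. (X + Y)^3 * N ((X + Y)^2) ((X - Y)^2) (- (1 + t) * W^2)
      + (X - Y)^3 * N ((X - Y)^2) ((X + Y)^2) (- (1 + t) * W^2))"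
  have S: "S X Y W = - 2 * (1 + t) * X^3 * N (- (1 + t) * X^2) ((Y - W)^2) ((Y + W)^2)" for X Y W
    using sym_sextic_klein_Q[OF tt] by (simp only: S_def N_def)
  have t2: "((1 - t) * x)^2 = - (1 + t) * x^2" for x
  proof -
    have "(1 - t)^2 = - (1 + t)" unfolding power2_eq_square by (rule theta_eqI[OF tt, where k = "1"]) Groebner_Basis.algebra
    then show ?thesis by (simp add: power_mult_distrib)
  qed
  have t3: "((1 - t) * x)^3 = (1 - t) * (- (1 + t) * x^2) * x" for x
    unfolding t2[symmetric] by (simp add: power3_eq_cube power2_eq_square)
  have Ncomm: "N x y z = N x z y" for x y z by (simp add: N_def sym_sextic_commute)
  define n1 where "n1 = (X + Y)^3 * N ((X + Y)^2) ((X - Y)^2) (- (1 + t) * W^2)"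
  define n2 where "n2 = (X - Y)^3 * N ((X - Y)^2) ((X + Y)^2) (- (1 + t) * W^2)"
  define n3 where "n3 = (1 - t) * (- (1 + t) * W^2) * W * N (- (1 + t) * W^2) ((X + Y)^2) ((X - Y)^2)"
  define m1 where "m1 = (X - W)^3 * N ((X - W)^2) ((X + W)^2) (- (1 + t) * Y^2)"
  define m2 where "m2 = (X + W)^3 * N ((X + W)^2) ((X - W)^2) (- (1 + t) * Y^2)"
  define m3 where "m3 = (1 - t) * (- (1 + t) * Y^2) * Y * N (- (1 + t) * Y^2) ((X - W)^2) ((X + W)^2)"
  have sq: "(a - b)^2 = (b - a)^2" and cube: "(a - b)^3 = - ((b - a)^3)" for a b :: complex
    by (simp_all add: power2_eq_square power3_eq_cube algebra_simps)
  have a: "n1 + n2 = m1 + m2"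
  proof -
    have "n1 + n2 = S X Y W" by (simp add: S_def n1_def n2_def)
    also have "\<dots> = S X W Y" unfolding S by (simp add: sq[of Y W] add.commute)
    also have "\<dots> = m1 + m2" by (simp add: S_def m1_def m2_def)
    finally show ?thesis .
  qed
  have b: "m2 - m1 = t * n3"
  proof -
    have "m2 - m1 = S W X Y" unfolding S_def m1_def m2_def by (simp add: sq[of W X] cube[of W X] add.commute)
    also have "\<dots> = - 2 * (1 + t) * W^3 * N (- (1 + t) * W^2) ((X + Y)^2) ((X - Y)^2)"
      unfolding S by (subst Ncomm) simp
    also have "\<dots> = (1 - t) * t * (- (1 + t) * W^2) * W * N (- (1 + t) * W^2) ((X + Y)^2) ((X - Y)^2)"
      unfolding tau by (simp add: power3_eq_cube power2_eq_square)
    also have "\<dots> = t * n3" unfolding n3_def by (simp only: mult_ac)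
    finally show ?thesis .
  qed
  have c: "2 * m3 = (1 - t) * (n1 - n2)"
  proof -
    have "n1 - n2 = S Y X W" unfolding S_def n1_def n2_def by (simp add: sq[of Y X] cube[of Y X] add.commute)
    also have "\<dots> = - 2 * (1 + t) * Y^3 * N (- (1 + t) * Y^2) ((X - W)^2) ((X + W)^2)" by (rule S)
    finally show ?thesis unfolding m3_def by (simp add: power3_eq_cube power2_eq_square)
  qed
  have F: "sextic_map klein_c v = vector [n1 / 16384, n2 / 16384, n3 / 16384]"
    unfolding sextic_map_def v N t2 t3 n1_def n2_def n3_def by simp
  have FQ: "sextic_map klein_c (klein_Q *v v) = vector [m1 / 16384, m2 / 16384, m3 / 16384]"
    unfolding sextic_map_def Qv vector_3 N t2 t3 m1_def m2_def m3_def by simp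
  have m: "m1 = (n1 + n2 - t * n3) / 2" "m2 = (n1 + n2 + t * n3) / 2" "m3 = (1 - t) * (n1 - n2) / 2"
    unfolding a b[symmetric] c[symmetric] by simp_all
  show ?thesis
    unfolding FQ unfolding F Qm m by (simp add: vec_eq_iff forall_3 field_simps)
qed

lemma sextic_map_nth:
  assumes "i \<noteq> j" "j \<noteq> k" "i \<noteq> k"
  shows "sextic_map c v $ i = (v$i)^3 * sym_sextic c ((v$i)^2) ((v$j)^2) ((v$k)^2)"
  using assms exhaust_3[of i] exhaust_3[of j] exhaust_3[of k] sym_sextic_commute
  by (auto simp: sextic_map_def)

lemma other_two_indices:
  fixes i :: 3
  obtains j k where "i \<noteq> j" "j \<noteq> k" "i \<noteq> k"
proof -
  have "(1::3) \<noteq> 2" "(2::3) \<noteq> 3" "(1::3) \<noteq> 3" by simp_all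
  then show ?thesis using that exhaust_3[of i] by metis
qed

lemma signed_permutation_mult_vec:
  "(\<chi> i j. if j = s i then e i else 0) *v v = (\<chi> i. e i * v $ s i)" for v :: "complex^3"
  by (simp add: matrix_vector_mult_def vec_eq_iff if_distrib[where f = "\<lambda>x. x * _"] cong: if_cong)

lemma sextic_map_signed_permutation:
  fixes v :: "complex^3"
  assumes s: "s permutes (UNIV :: 3 set)" and e: "\<And>i. e i \<in> {1, -1}"
  shows "sextic_map c (\<chi> i. e i * v $ s i) = (\<chi> i. e i * sextic_map c v $ s i)"
proof -
  have sq: "(e i * x)^2 = x^2" "(e i * x)^3 = e i * x^3" for i x using e[of i] by auto
  have "sextic_map c (\<chi> i. e i * v $ s i) $ i = e i * sextic_map c v $ s i" for i
  proof -
    obtain j k where ijk: "i \<noteq> j" "j \<noteq> k" "i \<noteq> k" by (rule other_two_indices)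
    then have "s i \<noteq> s j" "s j \<noteq> s k" "s i \<noteq> s k"
      using permutes_inj[OF s] by (auto dest: injD)
    then show ?thesis
      by (simp add: sextic_map_nth[OF ijk] sextic_map_nth[of "s i" "s j" "s k"] sq)
  qed
  then show ?thesis by (simp add: vec_eq_iff)
qed

lemma sextic_map_cube_group:
  assumes "A \<in> cube_group"
  shows "sextic_map c (A *v v) = A *v sextic_map c v"
proof -
  obtain s e where "s permutes (UNIV :: 3 set)" "\<And>i. e i \<in> {1, -1}"
    and A: "A = (\<chi> i j. if j = s i then e i else 0)"
    using assms unfolding cube_group_def by blast
  from sextic_map_signed_permutation[OF this(1,2)] show ?thesis
    unfolding A signed_permutation_mult_vec by simp
qed

text \<open>Up to signed permutations and signs the 21 forms are of three kinds, x_3, x_1 - x_2 and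
  x_1 + x_2 - \<theta> x_3, which are treated in \<open>A\<close>, \<open>B\<close> and
  \<open>C\<close>.\<close>

lemma sextic_map_klein_0_iff:
  "sextic_map klein_c v = 0 \<longleftrightarrow> v = 0"
proof
  define Z where "Z = (\<lambda>x y z. sextic_map klein_c (vector [x, y, z]) = 0)"
  have swap: "Z x y z \<Longrightarrow> Z y x z" "Z x y z \<Longrightarrow> Z x z y"
    and sign: "Z x y z \<Longrightarrow> Z (- x) y z" for x y z
    by (auto simp: Z_def sextic_map_def vec_eq_iff forall_3 sym_sextic_commute)
  have A: "x = 0 \<and> y = 0" if "Z x y 0" for x y
  proof (rule sym_sextic_klein_coprime[OF klein_theta_sq])
    have N: "sym_sextic klein_c x y z = (sym_sextic klein_c0 x y z + klein_theta * sym_sextic klein_c1 x y z) / 16384" for x y z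
      unfolding klein_c_def[abs_def] by (rule sym_sextic_lincomb)
    show "x^3 * (sym_sextic klein_c0 (x^2) (y^2) 0 + klein_theta * sym_sextic klein_c1 (x^2) (y^2) 0) = 0"
      "y^3 * (sym_sextic klein_c0 (y^2) (x^2) 0 + klein_theta * sym_sextic klein_c1 (y^2) (x^2) 0) = 0"
      using that by (auto simp: Z_def sextic_map_def vec_eq_iff forall_3 N)
  qed
  have Q: "Z ((x + y - klein_theta * z) / 2) ((x + y + klein_theta * z) / 2) ((1 - klein_theta) * (x - y) / 2)" if "Z x y z" for x y z
  proof -
    have "klein_Q *v vector [x, y, z] = vector [(x + y - klein_theta * z) / 2, (x + y + klein_theta * z) / 2, (1 - klein_theta) * (x - y) / 2]"
      by (simp add: klein_Q_mult_vec)
    then show ?thesis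
      using that sextic_map_klein_Q[of "vector [x, y, z]"] by (simp add: Z_def)
  qed
  have t0: "klein_theta \<noteq> 0" by (simp add: klein_theta_def complex_eq_iff)
  \<comment> \<open>\<open>klein_Q\<close> sends the line x_1 = x_2 into x_3 = 0, where
    \<open>A\<close> applies.\<close>
  have B: "x = 0 \<and> z = 0" if "Z x x z" for x z
    using A[of "(x + x - klein_theta * z) / 2" "(x + x + klein_theta * z) / 2"] Q[OF that] t0 by auto
  \<comment> \<open>\<open>klein_Q\<close> sends the line x_1 + x_2 = \<theta> x_3 into x_1 = 0,
    which a permutation of the coordinates reduces to \<open>A\<close>.\<close>
  have C: "x = 0 \<and> y = 0 \<and> z = 0" if "Z x y z" "x + y = klein_theta * z" for x y z
  proof -
    have "Z 0 ((x + y + klein_theta * z) / 2) ((1 - klein_theta) * (x - y) / 2)" using Q[OF that(1)] that(2) by simp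
    from swap(2)[OF swap(1)[OF this]] have "(x + y + klein_theta * z) / 2 = 0 \<and> (1 - klein_theta) * (x - y) / 2 = 0" by (rule A)
    moreover have "klein_theta \<noteq> 1" by (simp add: klein_theta_def complex_eq_iff)
    ultimately show ?thesis using that(2) t0 by auto
  qed
  assume v0: "sextic_map klein_c v = 0"
  obtain c where c: "c \<noteq> 0" "\<And>v. det (jacobian_mat (sextic_map klein_c) v) = c * (line_prod klein_theta (v$1) (v$2) (v$3))^2"
    using det_jacobian_klein by blast
  define x y z where "x = v$1" and "y = v$2" and "z = v$3"
  have v: "v = vector [x, y, z]" by (simp add: x_def y_def z_def vec_eq_iff forall_3)
  have Z: "Z x y z" using v0 by (simp add: Z_def v)
  show "v = 0"
  proof (rule ccontr)
    assume "v \<noteq> 0"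
    then have nz: "\<not> (x = 0 \<and> y = 0 \<and> z = 0)" by (auto simp: v vec_eq_iff forall_3)
    have "jacobian_mat (sextic_map klein_c) v *v v = 0"
      using jacobian_euler[OF homog_poly_sextic_map, of klein_c v] v0 by simp
    then have "det (jacobian_mat (sextic_map klein_c) v) = 0"
      using \<open>v \<noteq> 0\<close> by (metis invertible_det_nz invertible_def matrix_vector_mul_assoc matrix_vector_mul_lid matrix_vector_mult_0_right)
    then have "line_prod klein_theta x y z = 0" using c by (simp add: x_def y_def z_def)
    note sy = swap(1)[OF sign[OF swap(1)]]
    have perm: "Z y x z" "Z x z y" "Z y z x" "Z z y x" "Z z x y"
      using swap Z by blast+
    have s: "Z (e1 * a) (e2 * b) d" if e: "e1 \<in> {1, -1}" "e2 \<in> {1, -1}" and "Z a b d" for e1 e2 a b d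
      using e sign[OF that(3)] sy[OF that(3)] sy[OF sign[OF that(3)]] that(3) by auto
    have x0: "x \<noteq> 0" and y0: "y \<noteq> 0" and z0: "z \<noteq> 0"
      using A[of x y] A[of y z] A[of x z] Z perm nz by auto
    have eq: "a + b \<noteq> 0" "a - b \<noteq> 0" if "Z a b d" "a \<noteq> 0" for a b d
    proof -
      show "a + b \<noteq> 0" using B[of "- a" d] sign[OF that(1)] that(2) by (auto simp: add_eq_0_iff)
      show "a - b \<noteq> 0" using B[of a d] that by auto
    qed
    have line: "klein_theta * d + a + b \<noteq> 0" "klein_theta * d + a - b \<noteq> 0" "klein_theta * d - a + b \<noteq> 0" "klein_theta * d - a - b \<noteq> 0"
      if "Z a b d" "d \<noteq> 0" for a b d
    proof -
      have n: "klein_theta * d - (e1 * a + e2 * b) \<noteq> 0" if "e1 \<in> {1, -1}" "e2 \<in> {1, -1}" for e1 e2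
        using C[OF s[OF that \<open>Z a b d\<close>]] \<open>d \<noteq> 0\<close> by auto
      show "klein_theta * d + a + b \<noteq> 0" "klein_theta * d + a - b \<noteq> 0" "klein_theta * d - a + b \<noteq> 0" "klein_theta * d - a - b \<noteq> 0"
        using n[of "-1" "-1"] n[of "-1" 1] n[of 1 "-1"] n[of 1 1]
        by (simp_all add: algebra_simps del: right_minus_eq)
    qed
    have comm: "x + y + klein_theta * z = klein_theta * z + x + y" "x - y + klein_theta * z = klein_theta * z + x - y"
      "y - x + klein_theta * z = klein_theta * z - x + y" "x + klein_theta * y + z = klein_theta * y + x + z"
      "x + klein_theta * y - z = klein_theta * y + x - z"
      by simp_all
    from \<open>line_prod klein_theta x y z = 0\<close> show False
      unfolding line_prod_def comm mult_eq_0_iff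
      using x0 y0 z0 eq[OF Z x0] eq[OF perm(3) y0] eq[OF perm(2) x0] eq[OF perm(5) z0]
        line[OF Z z0] line[OF perm(3) x0] line[OF perm(2) y0]
      by simp
  qed
qed (simp add: sextic_map_def vec_eq_iff forall_3)

section \<open>The group and its mirrors\<close>

lemma is_lift_klein_h: "is_lift 15 (sextic_map klein_c) klein_h"
  unfolding is_lift_def
proof (intro conjI allI impI)
  show "homog_poly 15 (\<lambda>v. sextic_map klein_c v $ i)" for i by (rule homog_poly_sextic_map)
  show "v \<noteq> 0 \<Longrightarrow> sextic_map klein_c v \<noteq> 0" for v by (simp add: sextic_map_klein_0_iff)
  fix v :: "complex^3"
  assume v: "v \<noteq> 0"
  define w where "w = rep_cp2 (cp2_pt v)"
  have "w \<noteq> 0" "cp2_pt w = cp2_pt v"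
    using Quotient_abs_rep[OF Quotient_cp2] Quotient_rep_reflp[OF Quotient_cp2] by (auto simp: w_def cp2_pt_def)
  then obtain c where "c \<noteq> 0" "v = c *s w" using v by (auto simp: cp2_pt_eq_iff)
  then show "klein_h (cp2_pt v) = cp2_pt (sextic_map klein_c v)"
    using \<open>w \<noteq> 0\<close> unfolding klein_h_def w_def[symmetric] klein_h_lift_eq
    by (subst cp2_pt_eq_iff) (auto simp: sextic_map_klein_0_iff sextic_map_homog intro: exI[of _ "c^15"])
qed

lemma to_PGL3_mult:
  assumes "invertible A" "invertible B"
  shows "to_PGL3 A \<otimes>\<^bsub>PGL3\<^esub> to_PGL3 B = to_PGL3 (A ** B)"
  using normal.rcos_sum[OF normal_scalar_mats, of A B] assms
  by (simp add: PGL3_def to_PGL3_def GL3_def)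

lemma to_PGL3_one: "\<one>\<^bsub>PGL3\<^esub> = to_PGL3 (mat 1)"
  by (auto simp: PGL3_def to_PGL3_def r_coset_def GL3_def)

lemma group_PGL3: "group PGL3"
  unfolding PGL3_def by (rule normal.factorgroup_is_group[OF normal_scalar_mats])

lemma to_PGL3_carrier: "invertible A \<Longrightarrow> to_PGL3 A \<in> carrier PGL3"
  by (auto simp: PGL3_def carrier_FactGroup to_PGL3_def GL3_def)

lemma to_PGL3_inv:
  assumes "A ** B = mat 1"
  shows "inv\<^bsub>PGL3\<^esub> (to_PGL3 A) = to_PGL3 B"
proof -
  have "B ** A = mat 1" using assms by (metis matrix_left_right_inverse)
  then have "invertible A" "invertible B" using assms by (auto simp: invertible_def)
  then show ?thesis
    using \<open>B ** A = mat 1\<close>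
    by (intro group.inv_equality[OF group_PGL3]) (simp_all add: to_PGL3_mult to_PGL3_one to_PGL3_carrier)
qed

lemma to_PGL3_eq_iff:
  "to_PGL3 A = to_PGL3 B \<longleftrightarrow> (\<exists>c. c \<noteq> 0 \<and> A = mat c ** B)"
proof -
  have mem: "C \<in> to_PGL3 B \<longleftrightarrow> (\<exists>c. c \<noteq> 0 \<and> C = mat c ** B)" for B C
    by (auto simp: to_PGL3_def r_coset_def scalar_mats_def GL3_def)
  have "A \<in> to_PGL3 A" unfolding mem by (rule exI[of _ 1]) simp
  moreover have "to_PGL3 A = to_PGL3 B" if "c \<noteq> 0" "A = mat c ** B" for c
  proof -
    have "(\<exists>d. d \<noteq> 0 \<and> C = mat d ** A) \<longleftrightarrow> (\<exists>d. d \<noteq> 0 \<and> C = mat d ** B)" for C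
    proof
      assume "\<exists>d. d \<noteq> 0 \<and> C = mat d ** A"
      then obtain d where "d \<noteq> 0" "C = mat d ** A" by blast
      then have "d * c \<noteq> 0 \<and> C = mat (d * c) ** B" using that by (simp add: matrix_mul_assoc mat_mult_mat)
      then show "\<exists>d. d \<noteq> 0 \<and> C = mat d ** B" by blast
    next
      assume "\<exists>d. d \<noteq> 0 \<and> C = mat d ** B"
      then obtain d where "d \<noteq> 0" "C = mat d ** B" by blast
      then have "d / c \<noteq> 0 \<and> C = mat (d / c) ** A" using that by (simp add: matrix_mul_assoc mat_mult_mat)
      then show "\<exists>d. d \<noteq> 0 \<and> C = mat d ** A" by blast
    qed
    then show ?thesis using mem by blast
  qed
  ultimately show ?thesis using mem by blast
qed

lemma invertible_klein_Q: "invertible klein_Q"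
  by (simp add: invertible_det_nz det_klein_Q)

lemma invertible_cube_group: "A \<in> cube_group \<Longrightarrow> invertible A"
  by (simp add: invertible_det_nz cube_group_def)

lemma to_PGL3_in_K168: "A \<in> cube_group \<or> A = klein_Q \<Longrightarrow> to_PGL3 A \<in> K168"
  unfolding K168_def by (rule generate.incl) auto

lemma K168_subgroup: "subgroup K168 PGL3"
  unfolding K168_def
  by (rule group.generate_is_subgroup[OF group_PGL3])
    (auto intro: to_PGL3_carrier invertible_klein_Q invertible_cube_group)

lemma line_prod_sign:
  assumes "e1 \<in> {1, -1}" "e2 \<in> {1, -1}" "e3 \<in> {1, -1}"
  shows "line_prod t (e1 * x) (e2 * y) (e3 * z) = e1 * e2 * e3 * line_prod t x y z"
proof -
  have "(e1 * x)^2 = x^2" "(e2 * y)^2 = y^2" "(e3 * z)^2 = z^2" using assms by auto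
  then show ?thesis unfolding line_prod_squares by (simp only: mult_ac)
qed

lemma line_quad_commute: "line_quad t x z y = line_quad t x y z"
  unfolding line_quad_def by (subst eq_iff_diff_eq_0) Groebner_Basis.algebra

lemma line_prod_swap:
  shows "line_prod t y x z = - line_prod t x y z" and "line_prod t x z y = - line_prod t x y z"
proof -
  have V: "(y^2 - x^2) * (x^2 - z^2) * (z^2 - y^2) = - ((x^2 - y^2) * (y^2 - z^2) * (z^2 - x^2))"
    "(x^2 - z^2) * (z^2 - y^2) * (y^2 - x^2) = - ((x^2 - y^2) * (y^2 - z^2) * (z^2 - x^2))"
    by (simp_all add: algebra_simps)
  have q: "line_quad t (z^2) (y^2) (x^2) = line_quad t (z^2) (x^2) (y^2)"
    "line_quad t (x^2) (z^2) (y^2) = line_quad t (x^2) (y^2) (z^2)"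
    by (rule line_quad_commute)+
  show "line_prod t y x z = - line_prod t x y z" "line_prod t x z y = - line_prod t x y z"
    unfolding line_prod_squares q V by (simp_all only: mult_minus_left mult_minus_right mult_ac)
qed

text \<open>By \<open>line_prod_sign\<close> and \<open>line_prod_swap\<close>, a signed permutation
  multiplies \<Phi> by the sign of the permutation times the product of the signs. That is its
  determinant, hence 1.\<close>

lemma line_prod_cube_group:
  assumes "A \<in> cube_group"
  shows "line_prod t ((A *v v)$1) ((A *v v)$2) ((A *v v)$3) = line_prod t (v$1) (v$2) (v$3)"
proof -
  obtain s e where s: "s permutes (UNIV :: 3 set)" and e: "\<And>i. e i \<in> {1, -1}"
    and A: "A = (\<chi> i j. if j = s i then e i else 0)" and det: "det A = 1"
    using assms unfolding cube_group_def by blast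
  define p q r where "p = s 1" and "q = s 2" and "r = s 3"
  have ne: "p \<noteq> q" "q \<noteq> r" "p \<noteq> r"
    using permutes_inj[OF s] by (auto simp: p_def q_def r_def inj_eq)
  have d: "det3 (if 1 = p then e 1 else 0) (if 2 = p then e 1 else 0) (if 3 = p then e 1 else 0)
     (if 1 = q then e 2 else 0) (if 2 = q then e 2 else 0) (if 3 = q then e 2 else 0)
     (if 1 = r then e 3 else 0) (if 2 = r then e 3 else 0) (if 3 = r then e 3 else 0) = 1"
    using det unfolding A det_3 det3_def p_def q_def r_def by (simp add: algebra_simps)
  define L where "L = (\<lambda>i j k. line_prod t (v$i) (v$j) (v$k))"
  have L: "L 2 1 3 = - L 1 2 3" "L 1 3 2 = - L 1 2 3" "L 2 3 1 = L 1 2 3" "L 3 1 2 = L 1 2 3" "L 3 2 1 = - L 1 2 3"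
  proof -
    have sw1: "L j i k = - L i j k" and sw2: "L i k j = - L i j k" for i j k
      unfolding L_def by (rule line_prod_swap)+
    show "L 2 1 3 = - L 1 2 3" "L 1 3 2 = - L 1 2 3" "L 2 3 1 = L 1 2 3" "L 3 1 2 = L 1 2 3" "L 3 2 1 = - L 1 2 3"
      using sw1[of 2 1 3] sw2[of 1 3 2] sw2[of 2 3 1] sw1[of 3 1 2] sw1[of 3 2 1] by simp_all
  qed
  consider "p = 1" "q = 2" "r = 3" | "p = 1" "q = 3" "r = 2" | "p = 2" "q = 1" "r = 3" | "p = 2" "q = 3" "r = 1" | "p = 3" "q = 1" "r = 2" | "p = 3" "q = 2" "r = 1"
    using ne exhaust_3[of p] exhaust_3[of q] exhaust_3[of r] by auto
  then have "L p q r * (e 1 * e 2 * e 3) = L 1 2 3"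
  proof cases
    case 1
    show ?thesis using d unfolding 1 det3_def by (simp add: L mult.assoc)
  next
    case 2
    have "- (e 1 * e 2 * e 3) = 1" using d unfolding 2 det3_def by (simp add: mult.assoc)
    then have "e 1 * e 2 * e 3 = - 1" by (metis minus_minus)
    then show ?thesis unfolding 2 by (simp add: L)
  next
    case 3
    have "- (e 1 * e 2 * e 3) = 1" using d unfolding 3 det3_def by (simp add: mult.assoc)
    then have "e 1 * e 2 * e 3 = - 1" by (metis minus_minus)
    then show ?thesis unfolding 3 by (simp add: L)
  next
    case 4
    show ?thesis using d unfolding 4 det3_def by (simp add: L mult.assoc)
  next
    case 5
    show ?thesis using d unfolding 5 det3_def by (simp add: L mult.assoc)
  next
    case 6
    have "- (e 1 * e 2 * e 3) = 1" using d unfolding 6 det3_def by (simp add: mult.assoc)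
    then have "e 1 * e 2 * e 3 = - 1" by (metis minus_minus)
    then show ?thesis unfolding 6 by (simp add: L)
  qed
  then have "line_prod t (v$p) (v$q) (v$r) * (e 1 * e 2 * e 3) = line_prod t (v$1) (v$2) (v$3)"
    by (simp only: L_def)
  then show ?thesis
    unfolding A signed_permutation_mult_vec p_def q_def r_def
    by (simp add: line_prod_sign[OF e e e] mult.commute)
qed

lemma line_prod_klein_Q:
  "line_prod klein_theta ((klein_Q *v v)$1) ((klein_Q *v v)$2) ((klein_Q *v v)$3) = line_prod klein_theta (v$1) (v$2) (v$3)"
proof -
  define t where "t = klein_theta"
  have tt: "t * t = t - 2" by (simp add: t_def klein_theta_sq)
  have tau: "(1 - t) * t = 2" by (rule theta_eqI[OF tt, where k = "- 1"]) Groebner_Basis.algebra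
  define X Y W where "X = (v$1 + v$2) / 2" and "Y = (v$1 - v$2) / 2" and "W = t * v$3 / 2"
  have "(1 - t) * W = (1 - t) * t * v$3 / 2" by (simp add: W_def)
  then have v: "v$1 = X + Y" "v$2 = X - Y" "v$3 = (1 - t) * W"
    unfolding tau by (simp_all add: X_def Y_def field_simps)
  have "(klein_Q *v v)$1 = X - W" "(klein_Q *v v)$2 = X + W" "(klein_Q *v v)$3 = (1 - t) * Y"
    unfolding klein_Q_def t_def[symmetric] matrix_vector_mult_def sum_3 vec_lambda_beta vector_scaleR_component vector_3
    by (simp_all add: X_def Y_def W_def scaleR_conv_of_real algebra_simps add_divide_distrib diff_divide_distrib)
  then show ?thesis
    using line_prod_Q[OF tt, of X W Y] unfolding v t_def[symmetric] by simp
qed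

text \<open>The generating matrices have determinant 1 and satisfy both equations exactly; products
  and inverses inherit this. The determinant is used again to find the eigenvalue on a
  mirror.\<close>

lemma K168_lift:
  assumes "T \<in> K168"
  obtains M where "T = to_PGL3 M" "det M = 1" "\<And>v. sextic_map klein_c (M *v v) = M *v sextic_map klein_c v"
    "\<And>v. line_prod klein_theta ((M *v v)$1) ((M *v v)$2) ((M *v v)$3) = line_prod klein_theta (v$1) (v$2) (v$3)"
proof -
  define good where "good = (\<lambda>M. det M = 1 \<and> (\<forall>v. sextic_map klein_c (M *v v) = M *v sextic_map klein_c v) \<and>
    (\<forall>v. line_prod klein_theta ((M *v v)$1) ((M *v v)$2) ((M *v v)$3) = line_prod klein_theta (v$1) (v$2) (v$3)))"
  have nonsingular: "invertible M" if "good M" for M using that by (simp add: good_def invertible_det_nz)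
  have "det A = 1" if "A \<in> cube_group" for A using that by (simp add: cube_group_def)
  then have gen: "good A" if "A \<in> cube_group \<union> {klein_Q}" for A
    using that by (auto simp: good_def det_klein_Q sextic_map_cube_group sextic_map_klein_Q line_prod_cube_group
        line_prod_klein_Q)
  from assms have "\<exists>M. T = to_PGL3 M \<and> good M"
    unfolding K168_def
  proof induction
    case one
    then show ?case unfolding to_PGL3_one by (auto simp: good_def intro!: exI[of _ "mat 1"])
  next
    case (incl h)
    then show ?case using gen by blast
  next
    case (inv h)
    then obtain A where A: "h = to_PGL3 A" "good A" using gen by blast
    obtain B where AB: "A ** B = mat 1" using nonsingular[OF A(2)] by (auto simp: invertible_def)
    have ABv: "A *v (B *v v) = v" for v by (simp add: matrix_vector_mul_assoc AB)
    have BA: "B ** A = mat 1" using AB by (metis matrix_left_right_inverse)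
    have BAv: "B *v (A *v v) = v" for v by (simp add: matrix_vector_mul_assoc BA)
    have "det A * det B = 1" by (metis AB det_I det_mul)
    moreover have "sextic_map klein_c (B *v v) = B *v sextic_map klein_c v" for v
    proof -
      have "A *v sextic_map klein_c (B *v v) = sextic_map klein_c v"
        using A(2) ABv unfolding good_def by metis
      then show ?thesis using BAv by metis
    qed
    moreover have "line_prod klein_theta ((B *v v)$1) ((B *v v)$2) ((B *v v)$3) = line_prod klein_theta (v$1) (v$2) (v$3)" for v
      using A(2) ABv[of v] unfolding good_def by metis
    ultimately have "good B" using A(2) by (simp add: good_def)
    then show ?case using A(1) to_PGL3_inv[OF AB] by blast
  next
    case (eng h1 h2)
    then obtain A B where AB: "h1 = to_PGL3 A" "h2 = to_PGL3 B" "good A" "good B" by blast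
    have "good (A ** B)"
      using AB(3,4) by (simp add: good_def det_mul flip: matrix_vector_mul_assoc)
    then show ?case using AB to_PGL3_mult nonsingular by blast
  qed
  then show ?thesis using that unfolding good_def by blast
qed

lemma invertible_mult_vec_0_iff:
  fixes A :: "complex^3^3"
  assumes "invertible A"
  shows "A *v v = 0 \<longleftrightarrow> v = 0"
  using assms by (metis invertible_def matrix_vector_mul_assoc matrix_vector_mul_lid matrix_vector_mult_0_right)

lemma K168_equivariant_klein_h: "K168_equivariant klein_h"
  unfolding K168_equivariant_def
proof (intro ballI ext)
  fix T p
  assume "T \<in> K168"
  then obtain M where M: "T = to_PGL3 M" "det M = 1" "\<And>v. sextic_map klein_c (M *v v) = M *v sextic_map klein_c v"
    using K168_lift by metis
  then have inv: "invertible M" by (simp add: invertible_det_nz)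
  obtain v where v: "v \<noteq> 0" "p = cp2_pt v" by (rule cp2_pt_cases)
  have h: "klein_h (cp2_pt w) = cp2_pt (sextic_map klein_c w)" if "w \<noteq> 0" for w
    using is_lift_klein_h that by (simp add: is_lift_def)
  show "(klein_h \<circ> pgl_act T) p = (pgl_act T \<circ> klein_h) p"
    using v by (simp add: M(1) pgl_act_to_PGL3[OF inv] h M(3) invertible_mult_vec_0_iff[OF inv] sextic_map_klein_0_iff)
qed

section \<open>The 21 linear forms and the 21-lines\<close>

text \<open>The order is that of the factors of \<open>line_prod\<close>, so that the two products
  differ only by association.\<close>

definition klein_lines :: "(complex^3) list" where
  "klein_lines = (let t = klein_theta in
    [vector [1, 0, 0], vector [1, 1, t], vector [0, 1, 0], vector [-1, -1, t], vector [0, 0, 1], vector [1, -1, 0],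
     vector [1, 1, 0], vector [0, 1, 1], vector [t, -1, 1], vector [0, 1, -1], vector [-1, t, 1],
     vector [1, 0, 1], vector [-1, t, -1], vector [-1, 0, 1], vector [t, -1, -1], vector [t, 1, 1],
     vector [t, 1, -1], vector [1, t, 1], vector [1, t, -1], vector [1, -1, t], vector [-1, 1, t]])"

lemma length_klein_lines: "length klein_lines = 21"
  by (simp add: klein_lines_def Let_def)

lemma line_prod_eq_prod: "line_prod klein_theta (v$1) (v$2) (v$3) = (\<Prod>l\<leftarrow>klein_lines. lin_form l v)"
proof -
  define x y z where "x = v$1" and "y = v$2" and "z = v$3"
  have form: "lin_form (vector [a, b, c]) v = a * x + b * y + c * z" for a b c
    by (simp add: lin_form_def sum_3 vector_3 x_def y_def z_def)
  have f: "lin_form (vector [1, 0, 0]) v = x"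
    "lin_form (vector [1, 1, klein_theta]) v = x + y + klein_theta * z"
    "lin_form (vector [0, 1, 0]) v = y"
    "lin_form (vector [-1, -1, klein_theta]) v = klein_theta * z - x - y"
    "lin_form (vector [0, 0, 1]) v = z"
    "lin_form (vector [1, -1, 0]) v = x - y"
    "lin_form (vector [1, 1, 0]) v = x + y"
    "lin_form (vector [0, 1, 1]) v = y + z"
    "lin_form (vector [klein_theta, -1, 1]) v = klein_theta * x - y + z"
    "lin_form (vector [0, 1, -1]) v = y - z"
    "lin_form (vector [-1, klein_theta, 1]) v = klein_theta * y - x + z"
    "lin_form (vector [1, 0, 1]) v = x + z"
    "lin_form (vector [-1, klein_theta, -1]) v = klein_theta * y - x - z"
    "lin_form (vector [-1, 0, 1]) v = z - x"
    "lin_form (vector [klein_theta, -1, -1]) v = klein_theta * x - y - z"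
    "lin_form (vector [klein_theta, 1, 1]) v = klein_theta * x + y + z"
    "lin_form (vector [klein_theta, 1, -1]) v = klein_theta * x + y - z"
    "lin_form (vector [1, klein_theta, 1]) v = x + klein_theta * y + z"
    "lin_form (vector [1, klein_theta, -1]) v = x + klein_theta * y - z"
    "lin_form (vector [1, -1, klein_theta]) v = x - y + klein_theta * z"
    "lin_form (vector [-1, 1, klein_theta]) v = y - x + klein_theta * z"
    unfolding form by simp_all
  show ?thesis
    unfolding klein_lines_def Let_def list.map prod_list.Cons prod_list.Nil f x_def[symmetric] y_def[symmetric] z_def[symmetric]
      line_prod_def mult_1_right by (simp only: mult.assoc)
qed

lemma line_prod_scale: "line_prod t (s * x) (s * y) (s * z) = s^21 * line_prod t x y z"
proof -
  have lq: "line_quad t ((s * x)^2) ((s * y)^2) ((s * z)^2) = s^4 * line_quad t (x^2) (y^2) (z^2)" for x y z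
    unfolding line_quad_def by (subst eq_iff_diff_eq_0) Groebner_Basis.algebra
  have sd: "(s * x)^2 - (s * y)^2 = s^2 * (x^2 - y^2)" for x y
    by (simp add: power_mult_distrib right_diff_distrib)
  have "line_prod t (s * x) (s * y) (s * z) = (s * s * s * (s^2 * s^2 * s^2) * (s^4 * s^4 * s^4)) * line_prod t x y z"
    unfolding line_prod_squares lq sd by (simp only: mult_ac)
  then show ?thesis by (simp add: power_numeral_reduce mult.assoc)
qed

text \<open>On the curve (1, s, s^2) a nonzero form becomes a nonzero polynomial in
  \<open>s\<close>, and finitely many of these have only finitely many roots together.\<close>

lemma linear_forms_avoid:
  fixes S :: "(complex^3) set"
  assumes "finite S" "0 \<notin> S"
  obtains v where "\<And>m. m \<in> S \<Longrightarrow> lin_form m v \<noteq> 0"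
proof -
  have "finite {s. poly [:m$1, m$2, m$3:] s = 0}" if "m \<in> S" for m :: "complex^3"
  proof (rule poly_roots_finite)
    have "m \<noteq> 0" using that assms(2) by blast
    then show "[:m$1, m$2, m$3:] \<noteq> 0" by (simp add: vec_eq_iff forall_3)
  qed
  then have "finite (\<Union>m\<in>S. {s. poly [:m$1, m$2, m$3:] s = 0})" using assms(1) by simp
  then obtain s where s: "s \<notin> (\<Union>m\<in>S. {s. poly [:m$1, m$2, m$3:] s = 0})"
    using ex_new_if_finite[OF infinite_UNIV_char_0] by blast
  have "lin_form m (vector [1, s, s^2]) = poly [:m$1, m$2, m$3:] s" for m :: "complex^3"
    by (simp add: lin_form_def sum_3 vector_3 power2_eq_square algebra_simps)
  then show ?thesis using that[of "vector [1, s, s^2]"] s by auto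
qed

lemma lin_form_add: "lin_form l (v + w) = lin_form l v + lin_form l w"
  and lin_form_diff: "lin_form l (v - w) = lin_form l v - lin_form l w"
  and lin_form_scale: "lin_form l (c *s v) = c * lin_form l v"
  and lin_form_smult: "lin_form (c *s l) v = c * lin_form l v"
  by (simp_all add: lin_form_def sum_3 algebra_simps)

lemma lin_form_nonzero:
  assumes "l \<noteq> 0"
  obtains w where "lin_form l w = 1"
proof -
  obtain k where k: "l $ k \<noteq> 0" using assms by (auto simp: vec_eq_iff)
  have "lin_form l ((1 / l$k) *s axis k 1) = 1"
    using k by (simp add: lin_form_def axis_def if_distrib[where f = "\<lambda>x. _ * x"] cong: if_cong)
  then show ?thesis by (rule that)
qed

text \<open>Projecting along \<open>w\<close> onto the plane of \<open>l\<close> turns each form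
  \<open>m\<close> into \<open>?m m\<close>, its restriction to that plane. If no restriction were
  zero, some point of the plane would avoid all 21 forms.\<close>

lemma mirror_of_klein_lines:
  assumes l: "l \<noteq> 0" and F: "\<And>v. lin_form l v = 0 \<Longrightarrow> line_prod klein_theta (v$1) (v$2) (v$3) = 0"
  obtains c m where "m \<in> set klein_lines" "m = c *s l"
proof -
  obtain w where w: "lin_form l w = 1" using lin_form_nonzero[OF l] by blast
  let ?m = "\<lambda>m. m - lin_form m w *s l"
  have eq: "lin_form (?m m) v = lin_form m (v - lin_form l v *s w)" for m v
    by (simp add: lin_form_def sum_3 algebra_simps)
  have "\<exists>m\<in>set klein_lines. ?m m = 0"
  proof (rule ccontr)
    assume "\<not> (\<exists>m\<in>set klein_lines. ?m m = 0)"
    then have "0 \<notin> ?m ` set klein_lines" by force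
    then obtain v where v: "\<And>m'. m' \<in> ?m ` set klein_lines \<Longrightarrow> lin_form m' v \<noteq> 0"
      using linear_forms_avoid[of "?m ` set klein_lines"] by blast
    have "line_prod klein_theta ((v - lin_form l v *s w)$1) ((v - lin_form l v *s w)$2) ((v - lin_form l v *s w)$3) = 0"
      by (rule F) (simp add: lin_form_diff lin_form_scale w)
    then show False
      unfolding line_prod_eq_prod eq[symmetric] prod_list_zero_iff using v by auto
  qed
  then obtain m where "m \<in> set klein_lines" "m = lin_form m w *s l" by auto
  then show ?thesis by (rule that)
qed

lemma cp2_pt_in_zero_line:
  assumes "v \<noteq> 0"
  shows "cp2_pt v \<in> zero_line l \<longleftrightarrow> lin_form l v = 0"
proof
  assume "cp2_pt v \<in> zero_line l"
  then obtain w where w: "w \<noteq> 0" "lin_form l w = 0" "cp2_pt v = cp2_pt w" by (auto simp: zero_line_def)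
  then obtain c where "w = c *s v" "c \<noteq> 0" using assms by (auto simp: cp2_pt_eq_iff)
  then show "lin_form l v = 0" using w(2) by (simp add: lin_form_scale)
qed (use assms in \<open>auto simp: zero_line_def\<close>)

lemma zero_line_smult: "c \<noteq> 0 \<Longrightarrow> zero_line (c *s l) = zero_line l"
  by (simp add: zero_line_def lin_form_smult)

text \<open>For independent \<open>v\<close> and \<open>w\<close> in the plane, comparison with the
  eigenvalue of \<open>v + w\<close> forces their eigenvalues to agree.\<close>

lemma common_eigenvalue:
  assumes "\<And>v. v \<noteq> 0 \<Longrightarrow> lin_form l v = 0 \<Longrightarrow> \<exists>c. M *v v = c *s v"
  obtains \<mu> where "\<And>v. lin_form l v = 0 \<Longrightarrow> M *v v = \<mu> *s v"
proof (cases "\<exists>v. v \<noteq> 0 \<and> lin_form l v = 0")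
  case True
  then obtain v where v: "v \<noteq> 0" "lin_form l v = 0" by blast
  then obtain a where a: "M *v v = a *s v" using assms by blast
  have "M *v w = a *s w" if w: "lin_form l w = 0" for w
  proof (cases "\<exists>k. w = k *s v")
    case True
    then show ?thesis using a by (auto simp: vector_scalar_commute vector_smult_assoc mult.commute)
  next
    case False
    have "w \<noteq> 0"
    proof
      assume "w = 0"
      then have "w = 0 *s v" by simp
      with False show False by blast
    qed
    then obtain b where b: "M *v w = b *s w" using assms w by blast
    have "v + w \<noteq> 0"
    proof
      assume "v + w = 0"
      then have "w = (- 1) *s v" by (simp add: add_eq_0_iff)
      with False show False by blast
    qed
    then obtain c where "M *v (v + w) = c *s (v + w)"
      using assms[of "v + w"] v(2) w by (auto simp: lin_form_add)
    then have "a *s v + b *s w = c *s v + c *s w"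
      using a b by (simp add: matrix_vector_right_distrib vector_add_ldistrib)
    then have bc: "(b - c) *s w = (c - a) *s v" by (simp add: vec_eq_iff algebra_simps)
    have "b = c"
    proof (rule ccontr)
      assume "b \<noteq> c"
      have "w = (1 / (b - c)) *s ((b - c) *s w)" using \<open>b \<noteq> c\<close> unfolding vector_smult_assoc by simp
      then have "w = ((c - a) / (b - c)) *s v" unfolding bc vector_smult_assoc
        by (simp only: times_divide_eq_left mult_1_left)
      with False show False by blast
    qed
    moreover from this have "(c - a) *s v = 0" using bc by simp
    ultimately have "a = b" using v(1) by simp
    then show ?thesis using b by simp
  qed
  then show ?thesis by (rule that)
next
  case False
  have "M *v v = 0 *s v" if "lin_form l v = 0" for v
  proof -
    have "v = 0" using False that by blast
    then show ?thesis by simp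
  qed
  then show ?thesis by (rule that)
qed

text \<open>An involution fixing a line pointwise acts on the corresponding plane by a scalar \<open>\<mu>\<close>
  with \<open>\<mu>\<^sup>3 = -1\<close>, so a form of odd degree \<open>21\<close> that is invariant vanishes on that plane.\<close>

lemma lines21_subset:
  assumes "L \<in> lines21"
  shows "\<exists>m\<in>set klein_lines. L = zero_line m"
proof -
  obtain l T p where l: "l \<noteq> 0" "L = zero_line l" and T: "T \<in> K168_involutions" and fp: "{q. pgl_act T q = q} = L \<union> {p}"
    using assms by (auto simp: lines21_def cp2_line_def)
  obtain M where M: "T = to_PGL3 M" "det M = 1"
    and F: "\<And>v. line_prod klein_theta ((M *v v)$1) ((M *v v)$2) ((M *v v)$3) = line_prod klein_theta (v$1) (v$2) (v$3)"
    using T K168_lift unfolding K168_involutions_def by (metis (no_types, lifting) mem_Collect_eq)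
  have inv: "invertible M" using M(2) by (simp add: invertible_det_nz)
  have "\<exists>c. M *v v = c *s v" if "v \<noteq> 0" "lin_form l v = 0" for v
  proof -
    have "cp2_pt v \<in> {q. pgl_act T q = q}" unfolding fp using that l(2) cp2_pt_in_zero_line by simp
    then have "cp2_pt v = cp2_pt (M *v v)" using that(1) by (simp add: M(1) pgl_act_to_PGL3[OF inv])
    then show ?thesis using that(1) invertible_mult_vec_0_iff[OF inv] by (auto simp: cp2_pt_eq_iff)
  qed
  then obtain \<mu> where mu: "\<And>v. lin_form l v = 0 \<Longrightarrow> M *v v = \<mu> *s v" using common_eigenvalue by blast
  obtain w where w: "lin_form l w = 1" using lin_form_nonzero[OF l(1)] by blast
  define u where "u = M *v w - \<mu> *s w"
  \<comment> \<open>\<open>M\<close> is the scalar \<mu> plus a map of rank at most one with image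
    in the span of \<open>u\<close>.\<close>
  have Mv: "M *v v = \<mu> *s v + lin_form l v *s u" for v
  proof -
    have "M *v (v - lin_form l v *s w) = \<mu> *s (v - lin_form l v *s w)"
      by (rule mu) (simp add: lin_form_diff lin_form_scale w)
    then have "M *v v - lin_form l v *s (M *v w) = \<mu> *s v - \<mu> *s (lin_form l v *s w)"
      by (simp add: matrix_vector_mult_diff_distrib vector_scalar_commute vector_ssub_ldistrib)
    then show ?thesis by (simp add: u_def vec_eq_iff algebra_simps)
  qed
  have sq: "to_PGL3 (M ** M) = to_PGL3 (mat 1)" and ne: "to_PGL3 M \<noteq> to_PGL3 (mat 1)"
    using T by (auto simp: K168_involutions_def M(1) to_PGL3_one to_PGL3_mult[OF inv inv])
  obtain c where c: "M ** M = mat c" using sq by (auto simp: to_PGL3_eq_iff)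
  have cv: "M *v (M *v v) = c *s v" for v
    using mat_scalar_mult_vec[of c "mat 1" v] by (simp add: matrix_vector_mul_assoc c)
  have "u \<noteq> 0"
  proof
    assume "u = 0"
    then have "M = mat \<mu> ** mat 1"
      unfolding matrix_eq mat_scalar_mult_vec using Mv by simp
    moreover from this have "\<mu> \<noteq> 0"
      using M(2) by (auto simp: det_3 mat_scalar_mult)
    ultimately show False using ne by (auto simp: to_PGL3_eq_iff)
  qed
  \<comment> \<open>The square of \<open>M\<close> is the scalar \<open>c\<close>. A vector
    \<open>z\<close> of the plane gives c = \<mu>^2; the vector \<open>w\<close> then leaves only a
    multiple of \<open>u\<close>, which must vanish.\<close>
  have "(2 * \<mu> + lin_form l u) *s u = 0 \<and> c = \<mu> * \<mu>"
  proof -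
    have e: "c *s v = (\<mu> * \<mu>) *s v + (lin_form l v * (2 * \<mu> + lin_form l u)) *s u" for v
      unfolding cv[symmetric] Mv by (simp add: lin_form_add lin_form_scale vec_eq_iff algebra_simps)
    obtain z where z: "z \<noteq> 0" "lin_form l z = 0"
    proof (cases "l$1 = 0 \<and> l$2 = 0")
      case True
      then have "lin_form l (vector [1, 0, 0]) = 0" by (simp add: lin_form_def sum_3 vector_3)
      moreover have "vector [1, 0, 0] \<noteq> (0 :: complex^3)" by (simp add: vec_eq_iff forall_3 vector_3)
      ultimately show ?thesis by (rule that[rotated])
    next
      case False
      then have "vector [l$2, - l$1, 0] \<noteq> (0 :: complex^3)" by (auto simp: vec_eq_iff forall_3 vector_3)
      moreover have "lin_form l (vector [l$2, - l$1, 0]) = 0" by (simp add: lin_form_def sum_3 vector_3)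
      ultimately show ?thesis by (rule that)
    qed
    have "c *s z = (\<mu> * \<mu>) *s z" using e[of z] z(2) by simp
    then have "c = \<mu> * \<mu>" using z(1) by (simp add: vector_mul_rcancel)
    then show ?thesis using e[of w] w by simp
  qed
  then have "2 * \<mu> + lin_form l u = 0" using \<open>u \<noteq> 0\<close> unfolding vector_mul_eq_0 by blast
  then have lu: "lin_form l u = - 2 * \<mu>" by (simp add: add_eq_0_iff)
  have entry: "M $ i $ j = (if i = j then \<mu> else 0) + l $ j * u $ i" for i j
  proof -
    have "M $ i $ j = (M *v axis j 1) $ i"
      by (simp add: matrix_vector_mult_def axis_def if_distrib[where f = "\<lambda>x. _ * x"] cong: if_cong)
    also have "\<dots> = (if i = j then \<mu> else 0) + l $ j * u $ i"
      unfolding Mv by (simp add: lin_form_def axis_def if_distrib[where f = "\<lambda>x. _ * x"] cong: if_cong)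
    finally show ?thesis .
  qed
  \<comment> \<open>The determinant of a scalar plus a rank one map; with
    \<open>lin_form l u = - 2 * \<mu>\<close> it becomes - \<mu>^3.\<close>
  have "det M = \<mu>^2 * (\<mu> + lin_form l u)"
    unfolding det_3 entry lin_form_def sum_3 by (simp add: power2_eq_square algebra_simps)
  then have mu3: "\<mu>^3 = - 1" using M(2) lu by (simp add: power2_eq_square power3_eq_cube) (metis minus_minus)
  have "line_prod klein_theta (v$1) (v$2) (v$3) = 0" if "lin_form l v = 0" for v :: "complex^3"
  proof -
    have "\<mu>^21 = (\<mu>^3)^7" by (simp flip: power_mult)
    then have "\<mu>^21 = - 1" by (simp add: mu3)
    then show ?thesis using F[of v] mu[OF that] by (simp add: line_prod_scale)
  qed
  then obtain k m where m: "m \<in> set klein_lines" "m = k *s l"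
    using mirror_of_klein_lines[OF l(1)] by blast
  have "0 \<notin> set klein_lines"
    by (simp add: klein_lines_def Let_def vec_eq_iff forall_3 vector_3)
  then have "k \<noteq> 0" using m by auto
  then show ?thesis using m l(2) zero_line_smult by blast
qed

lemma pgl_act_mult:
  assumes "S \<in> K168" "T \<in> K168"
  shows "pgl_act (S \<otimes>\<^bsub>PGL3\<^esub> T) p = pgl_act S (pgl_act T p)"
proof -
  obtain A B where AB: "S = to_PGL3 A" "det A = 1" "T = to_PGL3 B" "det B = 1" using assms K168_lift by metis
  have inv: "invertible A" "invertible B" using AB by (simp_all add: invertible_det_nz)
  obtain v where "v \<noteq> 0" "p = cp2_pt v" by (rule cp2_pt_cases)
  then show ?thesis
    using inv by (simp add: AB to_PGL3_mult pgl_act_to_PGL3 invertible_mult invertible_mult_vec_0_iff matrix_vector_mul_assoc)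
qed

lemma pgl_act_one: "pgl_act \<one>\<^bsub>PGL3\<^esub> p = p"
proof -
  obtain v where "v \<noteq> 0" "p = cp2_pt v" by (rule cp2_pt_cases)
  then show ?thesis by (simp add: to_PGL3_one pgl_act_to_PGL3 invertible_mat)
qed

text \<open>If \<open>L\<close> is the mirror of the involution T, its preimage under S is the
  mirror of S^(-1) T S, the element called \<open>U\<close>.\<close>

lemma lines21_conjugate:
  assumes S: "S \<in> K168" and L: "L \<in> lines21" and line: "cp2_line {q. pgl_act S q \<in> L}"
  shows "{q. pgl_act S q \<in> L} \<in> lines21"
proof -
  interpret P: group PGL3 by (rule group_PGL3)
  note sub = K168_subgroup
  obtain T p where T: "T \<in> K168" "T \<noteq> \<one>\<^bsub>PGL3\<^esub>" "T \<otimes>\<^bsub>PGL3\<^esub> T = \<one>\<^bsub>PGL3\<^esub>"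
    and p: "p \<notin> L" "{q. pgl_act T q = q} = L \<union> {p}"
    using L unfolding lines21_def K168_involutions_def by blast
  define R where "R = inv\<^bsub>PGL3\<^esub> S"
  have R: "R \<in> K168" unfolding R_def using S subgroup.m_inv_closed[OF sub] by blast
  have car: "S \<in> carrier PGL3" "T \<in> carrier PGL3" "R \<in> carrier PGL3"
    using S T(1) R subgroup.mem_carrier[OF sub] by blast+
  have SR: "S \<otimes>\<^bsub>PGL3\<^esub> R = \<one>\<^bsub>PGL3\<^esub>" "R \<otimes>\<^bsub>PGL3\<^esub> S = \<one>\<^bsub>PGL3\<^esub>"
    using car by (simp_all add: R_def)
  have act: "pgl_act S (pgl_act R q) = q" "pgl_act R (pgl_act S q) = q" for q
    using pgl_act_mult S R SR pgl_act_one by metis+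
  define U where "U = R \<otimes>\<^bsub>PGL3\<^esub> (T \<otimes>\<^bsub>PGL3\<^esub> S)"
  have TS: "T \<otimes>\<^bsub>PGL3\<^esub> S \<in> K168" using subgroup.m_closed[OF sub T(1) S] .
  have U: "U \<in> K168" unfolding U_def using subgroup.m_closed[OF sub R TS] .
  have Uact: "pgl_act U q = pgl_act R (pgl_act T (pgl_act S q))" for q
    unfolding U_def by (simp add: pgl_act_mult R TS T(1) S)
  have "U \<noteq> \<one>\<^bsub>PGL3\<^esub>"
  proof
    assume "U = \<one>\<^bsub>PGL3\<^esub>"
    then have "S \<otimes>\<^bsub>PGL3\<^esub> U \<otimes>\<^bsub>PGL3\<^esub> R = \<one>\<^bsub>PGL3\<^esub>" using car SR by simp
    moreover have "S \<otimes>\<^bsub>PGL3\<^esub> U \<otimes>\<^bsub>PGL3\<^esub> R = (S \<otimes>\<^bsub>PGL3\<^esub> R) \<otimes>\<^bsub>PGL3\<^esub> T \<otimes>\<^bsub>PGL3\<^esub> (S \<otimes>\<^bsub>PGL3\<^esub> R)"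
      unfolding U_def using car by (simp add: P.m_assoc)
    ultimately show False using T(2) car by (simp add: SR)
  qed
  moreover have "U \<otimes>\<^bsub>PGL3\<^esub> U = \<one>\<^bsub>PGL3\<^esub>"
  proof -
    have "U \<otimes>\<^bsub>PGL3\<^esub> U = R \<otimes>\<^bsub>PGL3\<^esub> (T \<otimes>\<^bsub>PGL3\<^esub> ((S \<otimes>\<^bsub>PGL3\<^esub> R) \<otimes>\<^bsub>PGL3\<^esub> (T \<otimes>\<^bsub>PGL3\<^esub> S)))"
      unfolding U_def using car by (simp add: P.m_assoc)
    also have "\<dots> = R \<otimes>\<^bsub>PGL3\<^esub> ((T \<otimes>\<^bsub>PGL3\<^esub> T) \<otimes>\<^bsub>PGL3\<^esub> S)"
      unfolding SR using car by (simp add: P.m_assoc)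
    also have "\<dots> = \<one>\<^bsub>PGL3\<^esub>" unfolding T(3) using car SR by simp
    finally show ?thesis .
  qed
  ultimately have "U \<in> K168_involutions" using U by (simp add: K168_involutions_def)
  moreover have "{q. pgl_act U q = q} = {q. pgl_act S q \<in> L} \<union> {pgl_act R p}"
  proof -
    have "pgl_act U q = q \<longleftrightarrow> pgl_act T (pgl_act S q) = pgl_act S q" for q
      unfolding Uact using act by metis
    then have "{q. pgl_act U q = q} = {q. pgl_act S q \<in> {q. pgl_act T q = q}}" by blast
    then show ?thesis unfolding p(2) using act by auto
  qed
  moreover have "pgl_act R p \<notin> {q. pgl_act S q \<in> L}" using p(1) act by simp
  ultimately show ?thesis unfolding lines21_def using line by blast
qed

lemma cube_groupI:
  assumes "s permutes (UNIV :: 3 set)" "\<And>i. e i \<in> {1, -1}" "det (\<chi> i j. if j = s i then e i else 0 :: complex^3^3) = 1"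
  shows "(\<chi> i j. if j = s i then e i else 0) \<in> cube_group"
  using assms unfolding cube_group_def by blast

text \<open>Conjugation by a generator in terms of linear forms: one pullback identity replaces the
  work with fixed-point sets.\<close>

lemma lines21_transport:
  assumes L: "zero_line l \<in> lines21" and A: "A \<in> cube_group \<or> A = klein_Q"
    and lm: "\<And>v. lin_form l (A *v v) = c * lin_form m v" and c: "c \<noteq> 0" and m: "m \<noteq> 0"
  shows "zero_line m \<in> lines21"
proof -
  have inv: "invertible A" using A invertible_cube_group invertible_klein_Q by blast
  have "{q. pgl_act (to_PGL3 A) q \<in> zero_line l} = zero_line m"
  proof -
    have "pgl_act (to_PGL3 A) q \<in> zero_line l \<longleftrightarrow> q \<in> zero_line m" for q
    proof -
      obtain v where v: "v \<noteq> 0" "q = cp2_pt v" by (rule cp2_pt_cases)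
      then show ?thesis
        using inv c by (simp add: pgl_act_to_PGL3 cp2_pt_in_zero_line invertible_mult_vec_0_iff lm)
    qed
    then show ?thesis by blast
  qed
  moreover have "cp2_line (zero_line m)" using m by (auto simp: cp2_line_def)
  ultimately show ?thesis using lines21_conjugate[OF to_PGL3_in_K168[OF A] L] by simp
qed

lemma lin_form_vector: "lin_form (vector [a, b, c]) v = a * v$1 + b * v$2 + c * v$3"
  by (simp add: lin_form_def sum_3 vector_3)

lemma vector3_eq_0_iff: "vector [a, b, c] = (0 :: complex^3) \<longleftrightarrow> a = 0 \<and> b = 0 \<and> c = 0"
  by (simp add: vec_eq_iff forall_3 vector_3)

text \<open>The half turn diag(-1, -1, 1) fixes the line x_3 = 0 pointwise and, apart from it, only
  [0, 0, 1]. All other 21-lines are obtained from this one.\<close>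

lemma lines21_coordinate: "zero_line (vector [0, 0, 1]) \<in> lines21"
proof -
  define e where "e = (\<lambda>i::3. if i = 3 then 1 else - 1 :: complex)"
  define A where "A = (\<chi> i j. if j = id i then e i else 0 :: complex^3^3)"
  have A: "A \<in> cube_group"
    unfolding A_def by (rule cube_groupI[OF permutes_id]) (auto simp: e_def det_3)
  have Av: "A *v v = vector [- v$1, - v$2, v$3]" for v :: "complex^3"
    unfolding A_def signed_permutation_mult_vec by (simp add: vec_eq_iff forall_3 e_def)
  have inv: "invertible A" using A by (rule invertible_cube_group)
  have "A ** A = mat 1"
    unfolding matrix_eq by (simp add: Av vec_eq_iff forall_3 flip: matrix_vector_mul_assoc)
  moreover have "to_PGL3 A \<noteq> to_PGL3 (mat 1)"
  proof
    assume "to_PGL3 A = to_PGL3 (mat 1)"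
    then obtain c where "A = mat c ** mat 1" unfolding to_PGL3_eq_iff by blast
    then have "A *v vector [1, 0, 1] = c *s vector [1, 0, 1]" by (simp only: mat_scalar_mult_vec matrix_vector_mul_lid)
    then have "- 1 = c \<and> c = 1" by (simp add: Av vec_eq_iff forall_3)
    then show False by (metis one_neq_neg_one)
  qed
  ultimately have inv: "to_PGL3 A \<in> K168_involutions"
    using inv A to_PGL3_in_K168 by (simp add: K168_involutions_def to_PGL3_one to_PGL3_mult)
  have fixed: "pgl_act (to_PGL3 A) q = q \<longleftrightarrow> q \<in> zero_line (vector [0, 0, 1]) \<union> {cp2_pt (vector [0, 0, 1])}" for q
  proof -
    obtain v where v: "v \<noteq> 0" "q = cp2_pt v" by (rule cp2_pt_cases)
    have "pgl_act (to_PGL3 A) q = q \<longleftrightarrow> (\<exists>c. c \<noteq> 0 \<and> v = c *s (A *v v))"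
      using v \<open>invertible A\<close> by (simp add: pgl_act_to_PGL3 cp2_pt_eq_iff invertible_mult_vec_0_iff)
    also have "\<dots> \<longleftrightarrow> v$3 = 0 \<or> v$1 = 0 \<and> v$2 = 0"
    proof
      assume "\<exists>c. c \<noteq> 0 \<and> v = c *s (A *v v)"
      then obtain c where c: "v = c *s (A *v v)" by blast
      then have "v$1 = - c * v$1" "v$2 = - c * v$2" "v$3 = c * v$3"
        unfolding Av by (metis vector_smult_component vector_3 mult_minus_left mult_minus_right)+
      then show "v$3 = 0 \<or> v$1 = 0 \<and> v$2 = 0"
        by (metis mult_cancel_right1 mult_cancel_right2 mult_minus1 neg_equal_zero one_neq_neg_one mult_1_left minus_minus)
    next
      assume "v$3 = 0 \<or> v$1 = 0 \<and> v$2 = 0"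
      then have "v = (- 1) *s (A *v v) \<or> v = 1 *s (A *v v)"
        unfolding Av by (auto simp: vec_eq_iff forall_3)
      then show "\<exists>c. c \<noteq> 0 \<and> v = c *s (A *v v)" by (metis neg_equal_0_iff_equal zero_neq_one)
    qed
    also have "\<dots> \<longleftrightarrow> q \<in> zero_line (vector [0, 0, 1]) \<union> {cp2_pt (vector [0, 0, 1])}"
    proof -
      have "cp2_pt v = cp2_pt (vector [0, 0, 1]) \<longleftrightarrow> v$1 = 0 \<and> v$2 = 0"
      proof
        assume "cp2_pt v = cp2_pt (vector [0, 0, 1])"
        then obtain c where "c \<noteq> 0" "vector [0, 0, 1] = c *s v" using v by (auto simp: cp2_pt_eq_iff vector3_eq_0_iff)
        then show "v$1 = 0 \<and> v$2 = 0" by (simp add: vec_eq_iff forall_3)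
      next
        assume a: "v$1 = 0 \<and> v$2 = 0"
        then have "v$3 \<noteq> 0" using v(1) by (simp add: vec_eq_iff forall_3)
        then have "vector [0, 0, 1] = (1 / v$3) *s v" "1 / v$3 \<noteq> 0" using a by (simp_all add: vec_eq_iff forall_3)
        then show "cp2_pt v = cp2_pt (vector [0, 0, 1])" using v(1) by (subst cp2_pt_eq_iff) (auto simp: vector3_eq_0_iff)
      qed
      then show ?thesis using v by (auto simp: cp2_pt_in_zero_line lin_form_vector)
    qed
    finally show ?thesis .
  qed
  have "cp2_pt (vector [0, 0, 1]) \<notin> zero_line (vector [0, 0, 1])"
    by (subst cp2_pt_in_zero_line) (auto simp: vector3_eq_0_iff lin_form_vector)
  moreover have "cp2_line (zero_line (vector [0, 0, 1]))"
    unfolding cp2_line_def by (rule exI[of _ "vector [0, 0, 1]"]) (simp add: vector3_eq_0_iff)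
  ultimately show ?thesis
    unfolding lines21_def using inv fixed by blast
qed

lemma lines21_signed_permutations:
  fixes a b c :: complex
  assumes z: "zero_line (vector [a, b, c]) \<in> lines21" and nz: "\<not> (a = 0 \<and> b = 0 \<and> c = 0)"
  shows "zero_line (vector [c, a, b]) \<in> lines21"
    and "zero_line (vector [b, a, c]) \<in> lines21"
    and "zero_line (vector [- a, b, c]) \<in> lines21"
proof -
  define s :: "3 \<Rightarrow> 3" where "s = Transposition.transpose 1 2 \<circ> Transposition.transpose 2 3"
  have s: "s permutes UNIV" unfolding s_def by (intro permutes_compose permutes_swap_id) auto
  have s123: "s 1 = 2" "s 2 = 3" "s 3 = 1" by (simp_all add: s_def Transposition.transpose_def)
  show "zero_line (vector [c, a, b]) \<in> lines21"
  proof (rule lines21_transport[OF z])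
    show "(\<chi> i j. if j = s i then 1 else 0) \<in> cube_group \<or> (\<chi> i j. if j = s i then 1 else 0) = klein_Q"
      by (rule disjI1, rule cube_groupI[OF s, where e = "\<lambda>_. 1"]) (simp_all add: det_3 s123)
    show "lin_form (vector [a, b, c]) ((\<chi> i j. if j = s i then 1 else 0) *v v) = 1 * lin_form (vector [c, a, b]) v" for v
      unfolding signed_permutation_mult_vec[of s "\<lambda>_. 1"] by (simp add: lin_form_vector s123)
  qed (use nz in \<open>auto simp: vector3_eq_0_iff\<close>)
  define r :: "3 \<Rightarrow> 3" where "r = Transposition.transpose 1 2"
  have r: "r permutes UNIV" unfolding r_def by (intro permutes_swap_id) auto
  have r123: "r 1 = 2" "r 2 = 1" "r 3 = 3" by (simp_all add: r_def Transposition.transpose_def)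
  show "zero_line (vector [b, a, c]) \<in> lines21"
  proof (rule lines21_transport[OF z])
    \<comment> \<open>Three entries -1 compensate the determinant -1 of the transposition; the form
      changes only by an overall sign.\<close>
    show "(\<chi> i j. if j = r i then - 1 else 0) \<in> cube_group \<or> (\<chi> i j. if j = r i then - 1 else 0) = klein_Q"
      by (rule disjI1, rule cube_groupI[OF r, where e = "\<lambda>_. - 1"]) (simp_all add: det_3 r123)
    show "lin_form (vector [a, b, c]) ((\<chi> i j. if j = r i then - 1 else 0) *v v) = - 1 * lin_form (vector [b, a, c]) v" for v
      unfolding signed_permutation_mult_vec[of r "\<lambda>_. - 1"] by (simp add: lin_form_vector r123)
  qed (use nz in \<open>auto simp: vector3_eq_0_iff\<close>)
  \<comment> \<open>A single sign change has determinant -1, so diag(1, -1, -1) is used: it turns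
    (a, b, c) into (a, -b, -c), a multiple of (-a, b, c).\<close>
  define e where "e = (\<lambda>i::3. if i = 1 then 1 else - 1 :: complex)"
  have e123: "e 1 = 1" "e 2 = - 1" "e 3 = - 1" by (simp_all add: e_def)
  show "zero_line (vector [- a, b, c]) \<in> lines21"
  proof (rule lines21_transport[OF z])
    show "(\<chi> i j. if j = id i then e i else 0) \<in> cube_group \<or> (\<chi> i j. if j = id i then e i else 0) = klein_Q"
      by (rule disjI1, rule cube_groupI[OF permutes_id]) (auto simp: det_3 e_def)
    show "lin_form (vector [a, b, c]) ((\<chi> i j. if j = id i then e i else 0) *v v) = - 1 * lin_form (vector [- a, b, c]) v" for v
      unfolding signed_permutation_mult_vec[of id e] by (simp add: lin_form_vector e123)
  qed (use nz in \<open>auto simp: vector3_eq_0_iff\<close>)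
qed

text \<open>Pulling back coordinate forms along \<open>klein_Q\<close> produces the forms x_1 - x_2
  and x_1 + x_2 - \<theta> x_3. Signed permutations of these and of a coordinate form exhaust the
  list.\<close>

lemma klein_lines_in_lines21:
  assumes "m \<in> set klein_lines"
  shows "zero_line m \<in> lines21"
proof -
  define t where "t = klein_theta"
  have t0: "t \<noteq> 0" "1 - t \<noteq> 0" by (simp_all add: t_def klein_theta_def complex_eq_iff)
  define Z where "Z = (\<lambda>a b c. zero_line (vector [a, b, c]) \<in> lines21 \<and> \<not> (a = 0 \<and> b = 0 \<and> c = 0))"
  have cyc: "Z a b c \<Longrightarrow> Z c a b" and swap: "Z a b c \<Longrightarrow> Z b a c" and sign: "Z a b c \<Longrightarrow> Z (- a) b c" for a b c
    using lines21_signed_permutations[of a b c] by (auto simp: Z_def)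
  have sgn: "Z (e1 * a) (e2 * b) (e3 * c)" if "Z a b c" "e1 \<in> {1, -1}" "e2 \<in> {1, -1}" "e3 \<in> {1, -1}" for a b c e1 e2 e3
  proof -
    have 1: "Z (e * a) b c" if "Z a b c" "e \<in> {1, -1}" for a b c e using that sign by auto
    have 2: "Z a (e * b) c" if "Z a b c" "e \<in> {1, -1}" for a b c e
      using swap[OF 1[OF swap[OF that(1)] that(2)]] .
    have 3: "Z a b (e * c)" if "Z a b c" "e \<in> {1, -1}" for a b c e
      using cyc[OF cyc[OF 1[OF cyc[OF that(1)] that(2)]]] .
    show ?thesis by (rule 1[OF 2[OF 3[OF that(1) that(4)] that(3)] that(2)])
  qed
  have Qform: "lin_form (vector [0, 0, 1]) (klein_Q *v v) = (1 - t) / 2 * lin_form (vector [1, - 1, 0]) v"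
    "lin_form (vector [1, 0, 0]) (klein_Q *v v) = 1 / 2 * lin_form (vector [1, 1, - t]) v" for v
    unfolding lin_form_vector klein_Q_def t_def matrix_vector_mult_def sum_3 vec_lambda_beta vector_scaleR_component vector_3
    by (simp_all add: scaleR_conv_of_real algebra_simps add_divide_distrib diff_divide_distrib)
  have z1: "Z 0 0 1" using lines21_coordinate by (simp add: Z_def)
  have z1': "Z 1 0 0" by (rule cyc[OF z1])
  have z2: "Z 1 (- 1) 0"
    using lines21_transport[OF lines21_coordinate _ Qform(1)] t0 by (simp add: Z_def vector3_eq_0_iff)
  have "Z 1 1 (- t)"
    using lines21_transport[OF _ _ Qform(2)] z1' t0 by (simp add: Z_def vector3_eq_0_iff)
  from sgn[OF this _ _, of _ _ "- 1"] have z3: "Z e1 e2 t" if "e1 \<in> {1, -1}" "e2 \<in> {1, -1}" for e1 e2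
    using that by fastforce
  have z3': "Z t e1 e2" "Z e1 t e2" if "e1 \<in> {1, -1}" "e2 \<in> {1, -1}" for e1 e2
    using cyc[OF z3[OF that]] swap[OF cyc[OF z3[OF that]]] by blast+
  have z2': "Z 1 e 0" "Z 0 1 e" "Z e 0 1" if "e \<in> {1, -1}" for e
  proof -
    show "Z 1 e 0" using sgn[OF z2, of 1 "- e" 1] that by auto
    then show "Z 0 1 e" by (rule cyc)
    then show "Z e 0 1" by (rule cyc)
  qed
  have "\<forall>m\<in>set klein_lines. Z (m$1) (m$2) (m$3)"
    unfolding klein_lines_def Let_def t_def[symmetric] list.set ball_simps vector_3
    using z1 z1' cyc[OF z1'] z2 z2'[of 1] z2'[of "- 1"] z3[of 1 1] z3[of 1 "- 1"] z3[of "- 1" 1] z3[of "- 1" "- 1"]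
      z3'[of 1 1] z3'[of 1 "- 1"] z3'[of "- 1" 1] z3'[of "- 1" "- 1"]
    by simp
  then have "Z (m$1) (m$2) (m$3)" using assms by blast
  moreover have "m = vector [m$1, m$2, m$3]" by (simp add: vec_eq_iff forall_3)
  ultimately show ?thesis unfolding Z_def by simp
qed

lemma zero_line_eqD:
  assumes "l \<noteq> 0" "zero_line l = zero_line m"
  obtains k where "m = k *s l"
proof -
  obtain w where w: "lin_form l w = 1" using lin_form_nonzero[OF assms(1)] by blast
  have K: "lin_form m v = 0" if "lin_form l v = 0" for v
  proof (cases "v = 0")
    case True
    then show ?thesis by (simp add: lin_form_def)
  next
    case False
    then show ?thesis using that assms(2) cp2_pt_in_zero_line by metis
  qed
  have form: "lin_form m v = lin_form m w * lin_form l v" for v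
  proof -
    have "lin_form m (v - lin_form l v *s w) = 0"
      by (rule K) (simp add: lin_form_diff lin_form_scale w)
    then show ?thesis by (simp add: lin_form_diff lin_form_scale)
  qed
  have "m $ i = lin_form m w * l $ i" for i
    using form[of "axis i 1"] by (simp add: lin_form_def axis_def if_distrib[where f = "\<lambda>x. _ * x"] cong: if_cong)
  then show ?thesis by (intro that[of "lin_form m w"]) (simp add: vec_eq_iff)
qed

lemma zero_line_neq:
  assumes "a * b' \<noteq> a' * b \<or> b * c' \<noteq> b' * c \<or> a * c' \<noteq> a' * c"
  shows "zero_line (vector [a, b, c]) \<noteq> zero_line (vector [a', b', c'])"
proof
  assume eq: "zero_line (vector [a, b, c]) = zero_line (vector [a', b', c'])"
  have "vector [a, b, c] \<noteq> (0 :: complex^3)" using assms by (auto simp: vector3_eq_0_iff)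
  from zero_line_eqD[OF this eq] obtain k where "vector [a', b', c'] = k *s (vector [a, b, c] :: complex^3)" by blast
  then have "a' = k * a" "b' = k * b" "c' = k * c" by (simp_all add: vec_eq_iff forall_3)
  then show False using assms by auto
qed

lemma distinct_klein_lines: "distinct (map zero_line klein_lines)"
proof -
  define t where "t = klein_theta"
  have t: "t \<noteq> 0" "t \<noteq> 1" "t \<noteq> - 1" "1 \<noteq> t" "- 1 \<noteq> t" "- t \<noteq> 1" "- t \<noteq> t" "t \<noteq> - t" "t * t \<noteq> 1" "t * t \<noteq> - 1" "1 \<noteq> t * t" "- 1 \<noteq> t * t"
    unfolding t_def by (simp_all add: klein_theta_sq) (simp_all add: klein_theta_def complex_eq_iff)
  show ?thesis
    unfolding klein_lines_def Let_def t_def[symmetric] list.map distinct.simps list.set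
    by (simp add: zero_line_neq t)
qed

lemma lines21_eq: "lines21 = zero_line ` set klein_lines"
  using lines21_subset klein_lines_in_lines21 by blast

lemma bij_betw_klein_lines: "bij_betw (\<lambda>i. zero_line (klein_lines ! (i - 1))) {1..21} lines21"
proof -
  have "bij_betw (\<lambda>i. map zero_line klein_lines ! i) {..<21} lines21"
    using bij_betw_nth[OF distinct_klein_lines, of "{..<21}" lines21] by (simp add: length_klein_lines lines21_eq)
  then have 1: "bij_betw (\<lambda>i. zero_line (klein_lines ! i)) {..<21} lines21"
    by (rule bij_betw_cong[THEN iffD1, rotated]) (simp add: length_klein_lines)
  have 2: "bij_betw (\<lambda>i. i - 1) {1..21::nat} {..<21}"
    by (rule bij_betw_byWitness[where f' = Suc]) auto
  show ?thesis using bij_betw_trans[OF 2 1] by (simp add: o_def)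
qed

lemma klein_lines_nonzero: "0 \<notin> set klein_lines"
  by (simp add: klein_lines_def Let_def vec_eq_iff forall_3 vector_3)

lemma line_prod_nth: "line_prod klein_theta (v$1) (v$2) (v$3) = (\<Prod>i = 1..21. lin_form (klein_lines ! (i - 1)) v)"
proof -
  have "line_prod klein_theta (v$1) (v$2) (v$3) = (\<Prod>i = 0..<21. lin_form (klein_lines ! i) v)"
    unfolding line_prod_eq_prod prod.list_conv_set_nth by (simp add: length_klein_lines)
  also have "\<dots> = (\<Prod>i = 1..21. lin_form (klein_lines ! (i - 1)) v)"
    by (rule prod.reindex_bij_witness[where i = "\<lambda>i. i - 1" and j = Suc]) auto
  finally show ?thesis .
qed

text \<open>Any two systems of forms for the 21 lines are compared through a fixed choice
  \<open>form\<close> of one form per line: either product is a nonzero constant times the product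
  of the chosen forms.\<close>

lemma prod_lines21_unique:
  assumes l: "\<And>i. i \<in> {1..21} \<Longrightarrow> l i \<noteq> 0" and bij: "bij_betw (\<lambda>i. zero_line (l i)) {1..21::nat} lines21"
  obtains c where "c \<noteq> 0" "\<And>v. (\<Prod>i = 1..21. lin_form (l i) v) = c * line_prod klein_theta (v$1) (v$2) (v$3)"
proof -
  define form where "form = (\<lambda>L. SOME m. m \<noteq> 0 \<and> zero_line m = L)"
  have *: "\<exists>c. c \<noteq> 0 \<and> (\<forall>v. (\<Prod>i = 1..21. lin_form (l i) v) = c * (\<Prod>L\<in>lines21. lin_form (form L) v))"
    if l: "\<And>i. i \<in> {1..21} \<Longrightarrow> l i \<noteq> 0" and bij: "bij_betw (\<lambda>i. zero_line (l i)) {1..21::nat} lines21" for l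
  proof -
    have "\<exists>k. k \<noteq> 0 \<and> l i = k *s form (zero_line (l i))" if "i \<in> {1..21}" for i
    proof -
      have f: "form (zero_line (l i)) \<noteq> 0 \<and> zero_line (form (zero_line (l i))) = zero_line (l i)"
        unfolding form_def by (rule someI[of _ "l i"]) (simp add: l[OF that])
      then obtain k where "l i = k *s form (zero_line (l i))" using zero_line_eqD by metis
      moreover from this have "k \<noteq> 0" using l[OF that] by auto
      ultimately show ?thesis by blast
    qed
    then obtain k where k: "\<And>i. i \<in> {1..21} \<Longrightarrow> k i \<noteq> 0 \<and> l i = k i *s form (zero_line (l i))" by metis
    have "(\<Prod>i = 1..21. lin_form (l i) v) = (\<Prod>i = 1..21. k i) * (\<Prod>L\<in>lines21. lin_form (form L) v)" for v
    proof -
      have "(\<Prod>i = 1..21. lin_form (l i) v) = (\<Prod>i = 1..21. k i * lin_form (form (zero_line (l i))) v)"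
        by (rule prod.cong[OF refl]) (metis k lin_form_smult)
      also have "\<dots> = (\<Prod>i = 1..21. k i) * (\<Prod>i = 1..21. lin_form (form (zero_line (l i))) v)" by (rule prod.distrib)
      also have "(\<Prod>i = 1..21. lin_form (form (zero_line (l i))) v) = (\<Prod>L\<in>lines21. lin_form (form L) v)"
        by (rule prod.reindex_bij_betw[OF bij])
      finally show ?thesis .
    qed
    moreover have "(\<Prod>i = 1..21. k i) \<noteq> 0" using k by simp
    ultimately show ?thesis by blast
  qed
  obtain c where c: "c \<noteq> 0" "\<And>v. (\<Prod>i = 1..21. lin_form (l i) v) = c * (\<Prod>L\<in>lines21. lin_form (form L) v)"
    using *[OF l bij] by blast
  have "klein_lines ! (i - 1) \<noteq> 0" if "i \<in> {1..21}" for i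
  proof -
    have "klein_lines ! (i - 1) \<in> set klein_lines" using that by (intro nth_mem) (auto simp: length_klein_lines)
    then show ?thesis using klein_lines_nonzero by metis
  qed
  then obtain d where d: "d \<noteq> 0" "\<And>v. line_prod klein_theta (v$1) (v$2) (v$3) = d * (\<Prod>L\<in>lines21. lin_form (form L) v)"
    using *[of "\<lambda>i. klein_lines ! (i - 1)"] bij_betw_klein_lines unfolding line_prod_nth by blast
  show ?thesis
    by (rule that[of "c / d"]) (use c d in \<open>simp_all add: field_simps\<close>)
qed

lemma doubly_critical_klein_h: "doubly_critical_at_lines21 klein_h"
proof -
  obtain c where c: "c \<noteq> 0" "\<And>v. det (jacobian_mat (sextic_map klein_c) v) = c * (line_prod klein_theta (v$1) (v$2) (v$3))^2"
    using det_jacobian_klein by blast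
  have "klein_lines ! (i - 1) \<noteq> 0" if "i \<in> {1..21}" for i
  proof -
    have "klein_lines ! (i - 1) \<in> set klein_lines" using that by (intro nth_mem) (auto simp: length_klein_lines)
    then show ?thesis using klein_lines_nonzero by metis
  qed
  moreover have "det (jacobian_mat (sextic_map klein_c) v) = c * (\<Prod>i = 1..21. (lin_form (klein_lines ! (i - 1)) v)^2)" for v
    unfolding c(2) line_prod_nth by (simp only: prod_power_distrib)
  ultimately show ?thesis
    unfolding doubly_critical_at_lines21_def using is_lift_klein_h bij_betw_klein_lines c(1)
    by (intro exI[of _ 15] exI[of _ "sextic_map klein_c"] conjI exI[of _ "\<lambda>i. klein_lines ! (i - 1)"] exI[of _ c]) auto
qed

lemma line_prod_nontrivial: obtains v :: "complex^3" where "line_prod klein_theta (v$1) (v$2) (v$3) \<noteq> 0"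
proof -
  obtain v where "\<And>m. m \<in> set klein_lines \<Longrightarrow> lin_form m v \<noteq> 0"
    using linear_forms_avoid[of "set klein_lines"] klein_lines_nonzero by blast
  then have "line_prod klein_theta (v$1) (v$2) (v$3) \<noteq> 0"
    unfolding line_prod_eq_prod prod_list_zero_iff by auto
  then show ?thesis by (rule that)
qed

section \<open>Uniqueness\<close>

text \<open>Comparing coefficients of \<open>X\<^sup>i W\<^sup>k\<close> at \<open>Y = 1\<close> gives an almost triangular linear system for the coefficients \<open>c\<close>,
  whose solution space is a line on which \<open>c 5 0\<close> does not vanish.\<close>

lemma sym_sextic_Q_unique:
  fixes q :: complex
  assumes id: "\<And>X Y W. 2 * q * Y^3 * sym_sextic c (q * Y^2) ((X - W)^2) ((X + W)^2)
      = (X + Y)^3 * sym_sextic c ((X + Y)^2) ((X - Y)^2) (q * W^2) - (X - Y)^3 * sym_sextic c ((X - Y)^2) ((X + Y)^2) (q * W^2)"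
    and q: "q \<noteq> 0" "36 * q^5 + 8 \<noteq> 0" and c50: "c 5 0 = 0"
  shows "sym_sextic c x y z = 0"
proof -
  define c00 where "c00 = c 0 0"
  define c10 where "c10 = c 1 0"
  define c11 where "c11 = c 1 1"
  define c20 where "c20 = c 2 0"
  define c21 where "c21 = c 2 1"
  define c22 where "c22 = c 2 2"
  define c30 where "c30 = c 3 0"
  define c31 where "c31 = c 3 1"
  define c32 where "c32 = c 3 2"
  define c33 where "c33 = c 3 3"
  define c40 where "c40 = c 4 0"
  define c41 where "c41 = c 4 1"
  define c42 where "c42 = c 4 2"
  define c50 where "c50 = c 5 0"
  define c51 where "c51 = c 5 1"
  define c60 where "c60 = c 6 0"
  have S: "sym_sextic c x y z =
    c00 * x^6
    + c10 * x^5 * (y + z)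
    + c20 * x^4 * (y^2 + z^2)
    + c11 * x^4 * y * z
    + c30 * x^3 * (y^3 + z^3)
    + c21 * x^3 * (y^2 * z + y * z^2)
    + c40 * x^2 * (y^4 + z^4)
    + c31 * x^2 * (y^3 * z + y * z^3)
    + c22 * x^2 * y^2 * z^2
    + c50 * x * (y^5 + z^5)
    + c41 * x * (y^4 * z + y * z^4)
    + c32 * x * (y^3 * z^2 + y^2 * z^3)
    + c60 * (y^6 + z^6)
    + c51 * (y^5 * z + y * z^5)
    + c42 * (y^4 * z^2 + y^2 * z^4)
    + c33 * y^3 * z^3" for x y z
    by (simp add: sym_sextic_def c00_def c10_def c11_def c20_def c21_def c22_def c30_def c31_def c32_def c33_def c40_def c41_def c42_def c50_def c51_def c60_def)
  define A0 where "A0 = (\<lambda>X. ((-2) * c00 + (2) * q^7 * c00 + (-2) * c10 + (-2) * c20 + (-2) * c30 + (-2) * c40 + (-2) * c50 + (-2) * c60) * X^0 + ((-210) * c00 + (-106) * c10 + (4) * q^6 * c10 + (-34) * c20 + (6) * c30 + (14) * c40 + (-10) * c50 + (-66) * c60) * X^2 + ((-2730) * c00 + (-442) * c10 + (2) * q^5 * c11 + (86) * c20 + (4) * q^5 * c20 + (6) * c30 + (-42) * c40 + (70) * c50 + (-42) * c60) * X^4 + ((-10010) * c00 + (286) * c10 + (22) * c20 + (4) * q^4 * c21 + (-50) * c30 + (4) * q^4 * c30 + (70) * c40 + (-130) * c50 + (374) * c60) * X^6 + ((-12870) * c00 + (858) * c10 + (-198) * c20 + (2) * q^3 * c22 + (90)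 * c30 + (4) * q^3 * c31 + (-70) * c40 + (4) * q^3 * c40 + (90) * c50 + (-198) * c60) * X^8 + ((-6006) * c00 + (-286) * c10 + (154) * c20 + (-78) * c30 + (4) * q^2 * c32 + (42) * c40 + (4) * q^2 * c41 + (2) * c50 + (4) * q^2 * c50 + (-198) * c60) * X^10 + ((-910) * c00 + (-286) * c10 + (-14) * c20 + (34) * c30 + (2) * q * c33 + (-14) * c40 + (4) * q * c42 + (-30) * c50 + (4) * q * c51 + (114) * c60 + (4) * q * c60) * X^12 + ((-30) * c00 + (-22) * c10 + (-14) * c20 + (-6) * c30 + (2) * c40 + (10) * c50 + (18) * c60) * X^14)"
  define A2 where "A2 = (\<lambda>X. ((-2) * q * c10 + (4) * q^6 * c10 + (-2) * q * c11 + (-2) * q * c21 + (-2) * q * c31 + (-2) * q * c41 + (-2) * q * c51) * X^0 + ((-156) * q * c10 + (-68) * q * c11 + (-4) * q^5 * c11 + (24) * q^5 * c20 + (-12) * q * c21 + (12) * q * c31 + (4) * q * c41 + (-36) * q * c51) * X^2 + ((-1430) * q * c10 + (-110) * q * c11 + (58) * q * c21 + (-4) * q^4 * c21 + (60) * q^4 * c30 + (-30) * q * c31 + (10) * q * c41 + (50) * q * c51) * X^4 + ((-3432) * q * c10 + (264) * q * c11 + (-72) * q * c21 + (-8) * q^3 * c22 + (40) * q * c31 + (16) * q^3 * c31 + (112) * q^3 * c40 + (-40) * q * c41 + (72) * q * c51) * X^6 + ((-2574) * q * c10 + (66) * q * c11 + (18) * q * c21 + (-30) * q * c31 + (-12)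 * q^2 * c32 + (50) * q * c41 + (52) * q^2 * c41 + (180) * q^2 * c50 + (-126) * q * c51) * X^8 + ((-572) * q * c10 + (-132) * q * c11 + (20) * q * c21 + (12) * q * c31 + (-12) * q * c33 + (-28) * q * c41 + (8) * q * c42 + (132) * q * c51 + (264) * q * c60) * X^10 + ((-26) * q * c10 + (-18) * q * c11 + (-10) * q * c21 + (-2) * q * c31 + (6) * q * c41 + (14) * q * c51) * X^12)"
  define A4 where "A4 = (\<lambda>X. ((2) * q^5 * c11 + (-2) * q^2 * c20 + (4) * q^5 * c20 + (-2) * q^2 * c21 + (-2) * q^2 * c22 + (-2) * q^2 * c32 + (-2) * q^2 * c42) * X^0 + ((-110) * q^2 * c20 + (-38) * q^2 * c21 + (-4) * q^4 * c21 + (2) * q^2 * c22 + (60) * q^4 * c30 + (10) * q^2 * c32 + (-14) * q^2 * c42) * X^2 + ((-660) * q^2 * c20 + (12) * q^2 * c21 + (12) * q^2 * c22 + (12) * q^3 * c22 + (-40) * q^3 * c31 + (-20) * q^2 * c32 + (280) * q^3 * c40 + (44) * q^2 * c42) * X^4 + ((-924) * q^2 * c20 + (84) * q^2 * c21 + (-28) * q^2 * c22 + (28) * q^2 * c32 + (-56) * q^2 * c41 + (-28) * q^2 * c42 + (840) * q^2 * c50) * X^6 + ((-330) * q^2 * c20 + (-42) * q^2 * c21 + (22) * q^2 * c22 + (-10) * q^2 * c32 + (30) * q * c33 + (-68) * q * c42 + (-10) * q^2 * c42 + (60) * q * c51 + (1980) * q * c60) * X^8 + ((-22) * q^2 * c20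 + (-14) * q^2 * c21 + (-6) * q^2 * c22 + (2) * q^2 * c32 + (10) * q^2 * c42) * X^10)"
  define A6 where "A6 = (\<lambda>X. ((4) * q^4 * c21 + (-2) * q^3 * c30 + (4) * q^4 * c30 + (-2) * q^3 * c31 + (-2) * q^3 * c32 + (-2) * q^3 * c33) * X^0 + ((-8) * q^3 * c22 + (-72) * q^3 * c30 + (8) * q^3 * c32 + (112) * q^3 * c40) * X^2 + ((-252) * q^3 * c30 + (28) * q^3 * c31 + (8) * q^2 * c32 + (-12) * q^3 * c32 + (12) * q^3 * c33 + (-56) * q^2 * c41 + (840) * q^2 * c50) * X^4 + ((-168) * q^3 * c30 + (8) * q^3 * c32 + (-40) * q * c33 + (-16) * q^3 * c33 + (112) * q * c42 + (-336) * q * c51 + (3696) * q * c60) * X^6 + ((-18) * q^3 * c30 + (-10) * q^3 * c31 + (-2) * q^3 * c32 + (6) * q^3 * c33) * X^8)"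
  define A8 where "A8 = (\<lambda>X. ((2) * q^3 * c22 + (4) * q^3 * c31 + (4) * q^3 * c40 + (-2) * q^4 * c40 + (-2) * q^4 * c41 + (-2) * q^4 * c42) * X^0 + ((-12) * q^2 * c32 + (-42) * q^4 * c40 + (52) * q^2 * c41 + (-2) * q^4 * c41 + (6) * q^4 * c42 + (180) * q^2 * c50) * X^2 + ((30) * q * c33 + (-70) * q^4 * c40 + (10) * q^4 * c41 + (-68) * q * c42 + (-6) * q^4 * c42 + (60) * q * c51 + (1980) * q * c60) * X^4 + ((-14) * q^4 * c40 + (-6) * q^4 * c41 + (2) * q^4 * c42) * X^6)"
  define A10 where "A10 = (\<lambda>X. ((4) * q^2 * c32 + (4) * q^2 * c41 + (4) * q^2 * c50 + (-2) * q^5 * c50 + (-2) * q^5 * c51) * X^0 + ((-12) * q * c33 + (8) * q * c42 + (-20) * q^5 * c50 + (104) * q * c51 + (4) * q^5 * c51 + (264) * q * c60) * X^2 + ((-10) * q^5 * c50 + (-2) * q^5 * c51) * X^4)"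
  define A12 where "A12 = (\<lambda>X. ((2) * q * c33 + (4) * q * c42 + (4) * q * c51 + (4) * q * c60 + (-2) * q^6 * c60) * X^0 + ((-6) * q^6 * c60) * X^2)"
  have "A0 X * W^0 + A2 X * W^2 + A4 X * W^4 + A6 X * W^6 + A8 X * W^8 + A10 X * W^10 + A12 X * W^12 = 0" for X W
  proof -
    have "2 * q * 1^3 * sym_sextic c (q * 1^2) ((X - W)^2) ((X + W)^2)
      - ((X + 1)^3 * sym_sextic c ((X + 1)^2) ((X - 1)^2) (q * W^2) - (X - 1)^3 * sym_sextic c ((X - 1)^2) ((X + 1)^2) (q * W^2))
      - (A0 X * W^0 + A2 X * W^2 + A4 X * W^4 + A6 X * W^6 + A8 X * W^8 + A10 X * W^10 + A12 X * W^12) = 0"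
      unfolding S A0_def A2_def A4_def A6_def A8_def A10_def A12_def power_one mult_1_right by Groebner_Basis.algebra
    then show ?thesis unfolding id[of 1 X W] diff_self diff_0 neg_equal_0_iff_equal .
  qed
  then have "poly [:A0 X, 0, A2 X, 0, A4 X, 0, A6 X, 0, A8 X, 0, A10 X, 0, A12 X:] W = 0" for X W
    by (simp add: power_numeral_reduce algebra_simps)
  then have "[:A0 X, 0, A2 X, 0, A4 X, 0, A6 X, 0, A8 X, 0, A10 X, 0, A12 X:] = 0" for X
    using poly_all_0_iff_0 by blast
  then have A: "A0 X = 0" "A2 X = 0" "A4 X = 0" "A6 X = 0" "A8 X = 0" "A10 X = 0" "A12 X = 0" for X by simp_all
  have p0: "[:((-2) * c00 + (2) * q^7 * c00 + (-2) * c10 + (-2) * c20 + (-2) * c30 + (-2) * c40 + (-2) * c50 + (-2) * c60), 0, ((-210) * c00 + (-106) * c10 + (4) * q^6 * c10 + (-34) * c20 + (6) * c30 + (14) * c40 + (-10) * c50 + (-66) * c60), 0, ((-2730) * c00 + (-442) * c10 + (2) * q^5 * c11 + (86) * c20 + (4) * q^5 * c20 + (6) * c30 + (-42) * c40 + (70) * c50 + (-42) * c60), 0, ((-10010) * c00 + (286) * c10 + (22) * c20 + (4) * q^4 * c21 + (-50) * c30 + (4) * q^4 * c30 + (70) * c40 + (-130) * c50 + (374) * c60), 0, ((-12870) * c00 + (858) * c10 + (-198) * c20 + (2) * q^3 * c22 + (90) * c30 + (4) * q^3 * c31 + (-70) * c40 + (4) * q^3 * c40 + (90) * c50 + (-198)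 * c60), 0, ((-6006) * c00 + (-286) * c10 + (154) * c20 + (-78) * c30 + (4) * q^2 * c32 + (42) * c40 + (4) * q^2 * c41 + (2) * c50 + (4) * q^2 * c50 + (-198) * c60), 0, ((-910) * c00 + (-286) * c10 + (-14) * c20 + (34) * c30 + (2) * q * c33 + (-14) * c40 + (4) * q * c42 + (-30) * c50 + (4) * q * c51 + (114) * c60 + (4) * q * c60), 0, ((-30) * c00 + (-22) * c10 + (-14) * c20 + (-6) * c30 + (2) * c40 + (10) * c50 + (18) * c60):] = 0"
    unfolding poly_all_0_iff_0[symmetric] using A(1) unfolding A0_def by (simp add: power_numeral_reduce algebra_simps)
  have p2: "[:((-2) * q * c10 + (4) * q^6 * c10 + (-2) * q * c11 + (-2) * q * c21 + (-2) * q * c31 + (-2) * q * c41 + (-2) * q * c51), 0, ((-156) * q * c10 + (-68) * q * c11 + (-4) * q^5 * c11 + (24) * q^5 * c20 + (-12) * q * c21 + (12) * q * c31 + (4) * q * c41 + (-36) * q * c51), 0, ((-1430) * q * c10 + (-110) * q * c11 + (58) * q * c21 + (-4) * q^4 * c21 + (60) * q^4 * c30 + (-30) * q * c31 + (10) * q * c41 + (50) * q * c51), 0, ((-3432) * q * c10 + (264) * q * c11 + (-72) * q * c21 + (-8) * q^3 * c22 + (40) * q * c31 + (16) * q^3 * c31 + (112) * q^3 * c40 + (-40) * q * c41 + (72) * q * c51), 0, ((-2574) * q * c10 + (66) * q * c11 + (18) * q * c21 + (-30) * q * c31 + (-12) * q^2 * c32 + (50) * q * c41 + (52) * q^2 *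 c41 + (180) * q^2 * c50 + (-126) * q * c51), 0, ((-572) * q * c10 + (-132) * q * c11 + (20) * q * c21 + (12) * q * c31 + (-12) * q * c33 + (-28) * q * c41 + (8) * q * c42 + (132) * q * c51 + (264) * q * c60), 0, ((-26) * q * c10 + (-18) * q * c11 + (-10) * q * c21 + (-2) * q * c31 + (6) * q * c41 + (14) * q * c51):] = 0"
    unfolding poly_all_0_iff_0[symmetric] using A(2) unfolding A2_def by (simp add: power_numeral_reduce algebra_simps)
  have p4: "[:((2) * q^5 * c11 + (-2) * q^2 * c20 + (4) * q^5 * c20 + (-2) * q^2 * c21 + (-2) * q^2 * c22 + (-2) * q^2 * c32 + (-2) * q^2 * c42), 0, ((-110) * q^2 * c20 + (-38) * q^2 * c21 + (-4) * q^4 * c21 + (2) * q^2 * c22 + (60) * q^4 * c30 + (10) * q^2 * c32 + (-14) * q^2 * c42), 0, ((-660) * q^2 * c20 + (12) * q^2 * c21 + (12) * q^2 * c22 + (12) * q^3 * c22 + (-40) * q^3 * c31 + (-20) * q^2 * c32 + (280) * q^3 * c40 + (44) * q^2 * c42), 0, ((-924) * q^2 * c20 + (84) * q^2 * c21 + (-28) * q^2 * c22 + (28) * q^2 * c32 + (-56) * q^2 * c41 + (-28) * q^2 * c42 + (840) * q^2 * c50), 0, ((-330) * q^2 * c20 + (-42) * q^2 * c21 + (22) * q^2 * c22 + (-10) * q^2 * c32 + (30) * q * c33 + (-68) * q * c42 + (-10) * q^2 * c42 + (60) * q * c51 + (1980) * q * c60), 0, ((-22) * q^2 * c20 + (-14)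 * q^2 * c21 + (-6) * q^2 * c22 + (2) * q^2 * c32 + (10) * q^2 * c42):] = 0"
    unfolding poly_all_0_iff_0[symmetric] using A(3) unfolding A4_def by (simp add: power_numeral_reduce algebra_simps)
  have p6: "[:((4) * q^4 * c21 + (-2) * q^3 * c30 + (4) * q^4 * c30 + (-2) * q^3 * c31 + (-2) * q^3 * c32 + (-2) * q^3 * c33), 0, ((-8) * q^3 * c22 + (-72) * q^3 * c30 + (8) * q^3 * c32 + (112) * q^3 * c40), 0, ((-252) * q^3 * c30 + (28) * q^3 * c31 + (8) * q^2 * c32 + (-12) * q^3 * c32 + (12) * q^3 * c33 + (-56) * q^2 * c41 + (840) * q^2 * c50), 0, ((-168) * q^3 * c30 + (8) * q^3 * c32 + (-40) * q * c33 + (-16) * q^3 * c33 + (112) * q * c42 + (-336) * q * c51 + (3696) * q * c60), 0, ((-18) * q^3 * c30 + (-10) * q^3 * c31 + (-2) * q^3 * c32 + (6) * q^3 * c33):] = 0"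
    unfolding poly_all_0_iff_0[symmetric] using A(4) unfolding A6_def by (simp add: power_numeral_reduce algebra_simps)
  have p8: "[:((2) * q^3 * c22 + (4) * q^3 * c31 + (4) * q^3 * c40 + (-2) * q^4 * c40 + (-2) * q^4 * c41 + (-2) * q^4 * c42), 0, ((-12) * q^2 * c32 + (-42) * q^4 * c40 + (52) * q^2 * c41 + (-2) * q^4 * c41 + (6) * q^4 * c42 + (180) * q^2 * c50), 0, ((30) * q * c33 + (-70) * q^4 * c40 + (10) * q^4 * c41 + (-68) * q * c42 + (-6) * q^4 * c42 + (60) * q * c51 + (1980) * q * c60), 0, ((-14) * q^4 * c40 + (-6) * q^4 * c41 + (2) * q^4 * c42):] = 0"
    unfolding poly_all_0_iff_0[symmetric] using A(5) unfolding A8_def by (simp add: power_numeral_reduce algebra_simps)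
  have p10: "[:((4) * q^2 * c32 + (4) * q^2 * c41 + (4) * q^2 * c50 + (-2) * q^5 * c50 + (-2) * q^5 * c51), 0, ((-12) * q * c33 + (8) * q * c42 + (-20) * q^5 * c50 + (104) * q * c51 + (4) * q^5 * c51 + (264) * q * c60), 0, ((-10) * q^5 * c50 + (-2) * q^5 * c51):] = 0"
    unfolding poly_all_0_iff_0[symmetric] using A(6) unfolding A10_def by (simp add: power_numeral_reduce algebra_simps)
  have p12: "[:((2) * q * c33 + (4) * q * c42 + (4) * q * c51 + (4) * q * c60 + (-2) * q^6 * c60), 0, ((-6) * q^6 * c60):] = 0"
    unfolding poly_all_0_iff_0[symmetric] using A(7) unfolding A12_def by (simp add: power_numeral_reduce algebra_simps)
  \<comment> \<open>The name refers to the coefficient of W^12 X^2, and likewise below. These are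
    fifteen equations for the fifteen unknowns other than \<open>c50\<close>, in an order in which
    they can be solved singly or in pairs.\<close>
  have e12_2: "(-6) * q^6 * c60 = 0" using p12 unfolding pCons_eq_0_iff by (elim conjE)
  have e10_4: "(-10) * q^5 * c50 + (-2) * q^5 * c51 = 0" using p10 unfolding pCons_eq_0_iff by (elim conjE)
  have e12_0: "(2) * q * c33 + (4) * q * c42 + (4) * q * c51 + (4) * q * c60 + (-2) * q^6 * c60 = 0" using p12 unfolding pCons_eq_0_iff by (elim conjE)
  have e10_2: "(-12) * q * c33 + (8) * q * c42 + (-20) * q^5 * c50 + (104) * q * c51 + (4) * q^5 * c51 + (264) * q * c60 = 0" using p10 unfolding pCons_eq_0_iff by (elim conjE)
  have e8_4: "(30) * q * c33 + (-70) * q^4 * c40 + (10) * q^4 * c41 + (-68) * q * c42 + (-6) * q^4 * c42 + (60) * q * c51 + (1980) * q * c60 = 0" using p8 unfolding pCons_eq_0_iff by (elim conjE)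
  have e8_6: "(-14) * q^4 * c40 + (-6) * q^4 * c41 + (2) * q^4 * c42 = 0" using p8 unfolding pCons_eq_0_iff by (elim conjE)
  have e10_0: "(4) * q^2 * c32 + (4) * q^2 * c41 + (4) * q^2 * c50 + (-2) * q^5 * c50 + (-2) * q^5 * c51 = 0" using p10 unfolding pCons_eq_0_iff by (elim conjE)
  have e6_8: "(-18) * q^3 * c30 + (-10) * q^3 * c31 + (-2) * q^3 * c32 + (6) * q^3 * c33 = 0" using p6 unfolding pCons_eq_0_iff by (elim conjE)
  have e6_6: "(-168) * q^3 * c30 + (8) * q^3 * c32 + (-40) * q * c33 + (-16) * q^3 * c33 + (112) * q * c42 + (-336) * q * c51 + (3696) * q * c60 = 0" using p6 unfolding pCons_eq_0_iff by (elim conjE)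
  have e8_0: "(2) * q^3 * c22 + (4) * q^3 * c31 + (4) * q^3 * c40 + (-2) * q^4 * c40 + (-2) * q^4 * c41 + (-2) * q^4 * c42 = 0" using p8 unfolding pCons_eq_0_iff by (elim conjE)
  have e6_0: "(4) * q^4 * c21 + (-2) * q^3 * c30 + (4) * q^4 * c30 + (-2) * q^3 * c31 + (-2) * q^3 * c32 + (-2) * q^3 * c33 = 0" using p6 unfolding pCons_eq_0_iff by (elim conjE)
  have e4_10: "(-22) * q^2 * c20 + (-14) * q^2 * c21 + (-6) * q^2 * c22 + (2) * q^2 * c32 + (10) * q^2 * c42 = 0" using p4 unfolding pCons_eq_0_iff by (elim conjE)
  have e2_12: "(-26) * q * c10 + (-18) * q * c11 + (-10) * q * c21 + (-2) * q * c31 + (6) * q * c41 + (14) * q * c51 = 0" using p2 unfolding pCons_eq_0_iff by (elim conjE)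
  have e2_0: "(-2) * q * c10 + (4) * q^6 * c10 + (-2) * q * c11 + (-2) * q * c21 + (-2) * q * c31 + (-2) * q * c41 + (-2) * q * c51 = 0" using p2 unfolding pCons_eq_0_iff by (elim conjE)
  have e0_14: "(-30) * c00 + (-22) * c10 + (-14) * c20 + (-6) * c30 + (2) * c40 + (10) * c50 + (18) * c60 = 0" using p0 unfolding pCons_eq_0_iff by (elim conjE)
  have z50: "c50 = 0" by (simp add: c50_def c50)
  have z60: "c60 = 0" using e12_2 q(1) by simp
  have z51: "c51 = 0" using e10_4 q(1) unfolding z50 by simp
  have solve2: "x = 0 \<and> y = 0" if "a * x + b * y = 0" "a' * x + b' * y = 0" "a * b' - a' * b \<noteq> 0" for a b a' b' x y :: complex
  proof -
    have "(a * b' - a' * b) * x = b' * (a * x + b * y) - b * (a' * x + b' * y)"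
      "(a * b' - a' * b) * y = a * (a' * x + b' * y) - a' * (a * x + b * y)" by (simp_all add: algebra_simps)
    then show ?thesis using that by simp
  qed
  note z1 = z50 z60 z51
  have z33: "c33 = 0 \<and> c42 = 0"
  proof (rule solve2)
    show "2 * q * c33 + 4 * q * c42 = 0" using e12_0 unfolding z1 by (simp only: mult_zero_right add_0_right add_0_left)
    show "- 12 * q * c33 + 8 * q * c42 = 0" using e10_2 unfolding z1 by (simp only: mult_zero_right add_0_right add_0_left)
    have "2 * q * (8 * q) - - 12 * q * (4 * q) = 64 * (q * q)" by simp
    then show "2 * q * (8 * q) - - 12 * q * (4 * q) \<noteq> 0" using q(1) by simp
  qed
  note z2 = z1 z33[THEN conjunct1] z33[THEN conjunct2]
  have z40: "c40 = 0 \<and> c41 = 0"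
  proof (rule solve2)
    show "- 70 * q^4 * c40 + 10 * q^4 * c41 = 0" using e8_4 unfolding z2 by (simp only: mult_zero_right add_0_right add_0_left)
    show "- 14 * q^4 * c40 + - 6 * q^4 * c41 = 0" using e8_6 unfolding z2 by (simp only: mult_zero_right add_0_right add_0_left)
    have "- 70 * q^4 * (- 6 * q^4) - - 14 * q^4 * (10 * q^4) = 560 * (q^4 * q^4)" by simp
    then show "- 70 * q^4 * (- 6 * q^4) - - 14 * q^4 * (10 * q^4) \<noteq> 0" using q(1) by simp
  qed
  note z3 = z2 z40[THEN conjunct1] z40[THEN conjunct2]
  have z32: "c32 = 0" using e10_0 q(1) unfolding z3 by simp
  have z30: "c30 = 0" using e6_6 q(1) unfolding z3 z32 by simp
  have z31: "c31 = 0" using e6_8 q(1) unfolding z3 z32 z30 by simp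
  have z22: "c22 = 0" using e8_0 q(1) unfolding z3 z32 z30 z31 by simp
  have z21: "c21 = 0" using e6_0 q(1) unfolding z3 z32 z30 z31 z22 by simp
  have z20: "c20 = 0" using e4_10 q(1) unfolding z3 z32 z30 z31 z22 z21 by simp
  note z4 = z3 z32 z30 z31 z22 z21 z20
  have z10: "c10 = 0 \<and> c11 = 0"
  proof (rule solve2)
    show "- 26 * q * c10 + - 18 * q * c11 = 0" using e2_12 unfolding z4 by (simp only: mult_zero_right add_0_right add_0_left)
    show "(- 2 * q + 4 * q^6) * c10 + - 2 * q * c11 = 0" using e2_0 unfolding z4 by (simp only: mult_zero_right add_0_right add_0_left distrib_right)
    \<comment> \<open>Among the three pairs this is the one whose determinant is not a monomial in
      \<open>q\<close>; the hypothesis on \<open>36 * q^5 + 8\<close> comes from here.\<close>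
    have "- 26 * q * (- 2 * q) - (- 2 * q + 4 * q^6) * (- 18 * q) = 2 * q^2 * (36 * q^5 + 8)"
      by (subst eq_iff_diff_eq_0) Groebner_Basis.algebra
    then show "- 26 * q * (- 2 * q) - (- 2 * q + 4 * q^6) * (- 18 * q) \<noteq> 0" using q by simp
  qed
  have z00: "c00 = 0" using e0_14 unfolding z4 z10[THEN conjunct1] z10[THEN conjunct2] by simp
  show ?thesis unfolding S using z4 z10 z00 by simp
qed


text \<open>Along a line \<open>u + s w\<close> missing the origin the ratio of two proportional lifts is an entire function of \<open>s\<close>
  with a limit at infinity, hence constant by Liouville's theorem.\<close>

lemma proportional_lifts:
  fixes F G :: "complex^3 \<Rightarrow> complex^3"
  assumes F: "\<And>u w i. (\<lambda>s. F (u + s *s w) $ i) holomorphic_on UNIV" "\<And>c v. F (c *s v) = c^d *s F v"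
    and G: "\<And>u w i. (\<lambda>s. G (u + s *s w) $ i) holomorphic_on UNIV" "\<And>c v. G (c *s v) = c^d *s G v"
    and nz: "\<And>v. v \<noteq> 0 \<Longrightarrow> G v \<noteq> 0" and ratio: "\<And>v. v \<noteq> 0 \<Longrightarrow> \<exists>k. F v = k *s G v"
  obtains k where "\<And>v. F v = k *s G v"
proof -
  define \<kappa> where "\<kappa> = (\<lambda>v. SOME k. F v = k *s G v)"
  have kap: "F v = \<kappa> v *s G v" if "v \<noteq> 0" for v
    unfolding \<kappa>_def using ratio[OF that] by (rule someI_ex)
  have quot: "\<kappa> v = F v $ i / G v $ i" if "v \<noteq> 0" "G v $ i \<noteq> 0" for v i
    using kap[OF that(1)] that(2) by (simp add: vec_eq_iff)
  have scale: "\<kappa> (c *s v) = \<kappa> v" if "c \<noteq> 0" and v: "v \<noteq> 0" for c v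
  proof -
    obtain i where i: "G v $ i \<noteq> 0" using nz[OF v] by (auto simp: vec_eq_iff)
    then show ?thesis using that by (simp add: quot[of v i] quot[of "c *s v" i] F(2) G(2))
  qed
  have line: "\<kappa> u = \<kappa> w" if w: "w \<noteq> 0" and uw: "\<And>s. u + s *s w \<noteq> 0" for u w
  proof -
    define f where "f = (\<lambda>s. \<kappa> (u + s *s w))"
    have "f holomorphic_on UNIV"
      unfolding holomorphic_on_def
    proof
      fix s0 :: complex
      obtain i where i: "G (u + s0 *s w) $ i \<noteq> 0" using nz[OF uw] by (auto simp: vec_eq_iff)
      define S where "S = {s. G (u + s *s w) $ i \<noteq> 0}"
      have S: "open S"
        unfolding S_def using G(1) by (intro open_Collect_neq continuous_on_const holomorphic_on_imp_continuous_on)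
      have "(\<lambda>s. F (u + s *s w) $ i / G (u + s *s w) $ i) holomorphic_on S"
        by (intro holomorphic_on_divide holomorphic_on_subset[OF F(1)] holomorphic_on_subset[OF G(1)]) (auto simp: S_def)
      then have "f holomorphic_on S"
        by (rule holomorphic_transform) (simp add: S_def f_def quot[OF uw])
      then have "f field_differentiable at s0"
        using S i by (auto simp: S_def intro: holomorphic_on_imp_differentiable_at)
      then show "f field_differentiable at s0 within UNIV" by simp
    qed
    moreover have "(f \<longlongrightarrow> \<kappa> w) at_infinity"
    proof -
      obtain i where i: "G w $ i \<noteq> 0" using nz[OF w] by (auto simp: vec_eq_iff)
      \<comment> \<open>With r = 1/s the end of the line at infinity is \<open>w\<close>, reached at
        r = 0, where the components are continuous.\<close>
      have lim: "((\<lambda>s. H (w + inverse s *s u) $ i) \<longlongrightarrow> H w $ i) at_infinity"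
        if "\<And>u w i. (\<lambda>s. H (u + s *s w) $ i) holomorphic_on UNIV" for H :: "complex^3 \<Rightarrow> complex^3"
      proof -
        have "isCont (\<lambda>r. H (w + r *s u) $ i) 0"
          using holomorphic_on_imp_continuous_on[OF that] by (simp add: continuous_on_eq_continuous_at)
        from isCont_tendsto_compose[OF this tendsto_inverse_0] show ?thesis by simp
      qed
      have "((\<lambda>s. F (w + inverse s *s u) $ i / G (w + inverse s *s u) $ i) \<longlongrightarrow> F w $ i / G w $ i) at_infinity"
        by (intro tendsto_divide lim F(1) G(1) i)
      moreover have "\<forall>\<^sub>F s in at_infinity. F (w + inverse s *s u) $ i / G (w + inverse s *s u) $ i = f s"
      proof -
        have "\<forall>\<^sub>F s in at_infinity. G (w + inverse s *s u) $ i \<noteq> 0"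
          using tendsto_imp_eventually_ne[OF lim[OF G(1)] i] .
        moreover have "\<forall>\<^sub>F s :: complex in at_infinity. s \<noteq> 0"
          unfolding eventually_at_infinity by (rule exI[of _ 1]) auto
        ultimately show ?thesis
        proof eventually_elim
          case (elim s)
          have eq: "w + inverse s *s u = inverse s *s (u + s *s w)"
            using elim(2) by (simp add: vec_eq_iff field_simps)
          have "w + inverse s *s u \<noteq> 0" unfolding eq vector_mul_eq_0 using uw[of s] elim(2) by simp
          then have "F (w + inverse s *s u) $ i / G (w + inverse s *s u) $ i = \<kappa> (w + inverse s *s u)"
            using quot elim(1) by simp
          also have "\<dots> = f s" unfolding eq f_def by (rule scale) (use elim(2) uw in auto)
          finally show ?case .
        qed
      qed
      ultimately show ?thesis using quot[OF w i] by (simp add: tendsto_cong)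
    qed
    ultimately have "f 0 = \<kappa> w" by (rule Liouville_weak)
    then show ?thesis by (simp add: f_def)
  qed
  define e :: "complex^3" where "e = axis 1 1"
  have e: "e \<noteq> 0" by (simp add: e_def axis_eq_0_iff)
  \<comment> \<open>Either \<open>v\<close> is a multiple of \<open>e\<close>, or its line in the
    direction \<open>e\<close> misses the origin and \<open>line\<close> applies.\<close>
  have const: "\<kappa> v = \<kappa> e" if v: "v \<noteq> 0" for v
  proof (cases "\<exists>s. v + s *s e = 0")
    case True
    then obtain s where "v = (- s) *s e" by (auto simp: add_eq_0_iff2)
    moreover from this have "- s \<noteq> 0" using v by auto
    ultimately show ?thesis using scale e by metis
  next
    case False
    then show ?thesis using line[OF e] by blast
  qed
  have "F v = \<kappa> e *s G v" for v
  proof (cases "v = 0")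
    case True
    have "F (0 *s e) = \<kappa> e *s G (0 *s e)"
      unfolding F(2) G(2) kap[OF e] by (simp add: vector_smult_assoc mult.commute)
    then show ?thesis using True by simp
  next
    case False
    then show ?thesis using kap const by metis
  qed
  then show ?thesis by (rule that)
qed

lemma homog_poly_holomorphic_on_line:
  assumes "homog_poly d p"
  shows "(\<lambda>s. p (u + s *s w)) holomorphic_on UNIV"
proof -
  obtain G where G: "has_gradient p G" using homog_poly_has_gradient[OF assms] by blast
  have "((\<lambda>s. p (u + s *s w)) has_field_derivative lin_form (G (u + s *s w)) w) (at s)" for s
    by (rule has_gradientD[OF G, where w = "\<lambda>s. u + s *s w"]) (auto intro!: derivative_eq_intros)
  then show ?thesis unfolding holomorphic_on_def field_differentiable_def by auto
qed

text \<open>Projective equivariance gives a scalar for each \<open>v\<close>. Both sides are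
  homogeneous of the same degree, and the right-hand one has no zero off the origin, so
  \<open>proportional_lifts\<close> makes the scalar constant.\<close>

lemma lift_equivariant:
  assumes g: "is_lift d F g" and eq: "K168_equivariant g" and A: "A \<in> cube_group \<or> A = klein_Q"
  obtains k where "\<And>v. F (A *v v) = k *s (A *v F v)"
proof -
  have inv: "invertible A" using A invertible_cube_group invertible_klein_Q by blast
  have hp: "homog_poly d (\<lambda>v. F v $ i)" for i using g by (simp add: is_lift_def)
  have nz: "v \<noteq> 0 \<Longrightarrow> F v \<noteq> 0" and gF: "v \<noteq> 0 \<Longrightarrow> g (cp2_pt v) = cp2_pt (F v)" for v
    using g by (simp_all add: is_lift_def)
  have hol: "(\<lambda>s. F (u + s *s w) $ i) holomorphic_on UNIV" for u w i
    by (rule homog_poly_holomorphic_on_line[OF hp])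
  have hom: "F (c *s v) = c^d *s F v" for c v
    using homog_poly_homog[OF hp] by (simp add: vec_eq_iff)
  have lin: "A *v (u + s *s w) = A *v u + s *s (A *v w)" for u w s
    by (simp add: matrix_vector_right_distrib vector_scalar_commute)
  show ?thesis
  proof (rule proportional_lifts[where F = "\<lambda>v. F (A *v v)" and G = "\<lambda>v. A *v F v" and d = d])
    show "(\<lambda>s. F (A *v (u + s *s w)) $ i) holomorphic_on UNIV" for u w i unfolding lin by (rule hol)
    show "F (A *v (c *s v)) = c^d *s F (A *v v)" for c v by (simp add: vector_scalar_commute hom)
    show "(\<lambda>s. (A *v F (u + s *s w)) $ i) holomorphic_on UNIV" for u w i
      unfolding matrix_vector_mult_def by (simp, intro holomorphic_intros hol)
    show "A *v F (c *s v) = c^d *s (A *v F v)" for c v by (simp add: vector_scalar_commute hom)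
    show "A *v F v \<noteq> 0" if "v \<noteq> 0" for v using nz[OF that] invertible_mult_vec_0_iff[OF inv] by simp
    show "\<exists>k. F (A *v v) = k *s (A *v F v)" if v: "v \<noteq> 0" for v
    proof -
      have Av: "A *v v \<noteq> 0" using v invertible_mult_vec_0_iff[OF inv] by simp
      have "(g \<circ> pgl_act (to_PGL3 A)) (cp2_pt v) = (pgl_act (to_PGL3 A) \<circ> g) (cp2_pt v)"
        using eq to_PGL3_in_K168[OF A] by (simp add: K168_equivariant_def)
      then have "cp2_pt (A *v F v) = cp2_pt (F (A *v v))"
        using v Av nz by (simp add: pgl_act_to_PGL3[OF inv] gF)
      then show ?thesis
        using nz[OF v] nz[OF Av] invertible_mult_vec_0_iff[OF inv] by (auto simp: cp2_pt_eq_iff)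
    qed
  qed (rule that)
qed

text \<open>A lift is not assumed to have degree 15; its degree follows from that of the Jacobian
  determinant.\<close>

lemma lift_jacobian:
  assumes g: "is_lift d F g" and l: "\<And>i. i \<in> {1..21} \<Longrightarrow> l i \<noteq> 0"
    and bij: "bij_betw (\<lambda>i. zero_line (l i)) {1..21::nat} lines21" and c: "c \<noteq> 0"
    and det: "\<And>v. det (jacobian_mat F v) = c * (\<Prod>i=1..21. (lin_form (l i) v)^2)"
  obtains c' where "c' \<noteq> 0" "\<And>v. det (jacobian_mat F v) = c' * (line_prod klein_theta (v$1) (v$2) (v$3))^2" "d = 15"
proof -
  obtain k where k: "k \<noteq> 0" "\<And>v. (\<Prod>i = 1..21. lin_form (l i) v) = k * line_prod klein_theta (v$1) (v$2) (v$3)"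
    using prod_lines21_unique[of l] l bij by blast
  have D: "det (jacobian_mat F v) = c * k^2 * (line_prod klein_theta (v$1) (v$2) (v$3))^2" for v
    unfolding det prod_power_distrib[symmetric] k(2) by (simp add: power_mult_distrib)
  obtain v :: "complex^3" where v: "line_prod klein_theta (v$1) (v$2) (v$3) \<noteq> 0" by (rule line_prod_nontrivial)
  have "2^3 * det (jacobian_mat F (2 *s v)) = 2^(3 * d) * det (jacobian_mat F v)"
    by (rule det_jacobian_homog) (use g in \<open>simp add: is_lift_def\<close>)
  \<comment> \<open>45 is the degree 42 of the square of \<Phi> plus the exponent in the factor
    \<open>2^3\<close>.\<close>
  then have "(2::complex)^45 = 2^(3 * d)"
    unfolding D using c k(1) v by (simp add: line_prod_scale power_mult_distrib)
  then have "cmod (2^45) = cmod (2^(3 * d))" by simp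
  then have "(2::real)^45 = 2^(3 * d)" unfolding norm_power by simp
  then have "45 = 3 * d" by (subst (asm) power_inject_exp) auto
  then show ?thesis using that[of "c * k^2"] D c k(1) by simp
qed

text \<open>The multiplier \<open>k\<close> satisfies \<open>k\<^sup>3 = 1\<close> because the Jacobian determinant is invariant, and \<open>k\<^sup>4 = 1\<close> because \<open>A\<^sup>4 = 1\<close>.\<close>

lemma lift_commutes:
  assumes g: "is_lift d F g" and eq: "K168_equivariant g" and A: "A \<in> cube_group \<or> A = klein_Q"
    and c: "c \<noteq> 0" and D: "\<And>v. det (jacobian_mat F v) = c * (line_prod klein_theta (v$1) (v$2) (v$3))^2"
    and A4: "\<And>v. A *v (A *v (A *v (A *v v))) = v"
  shows "F (A *v v) = A *v F v"
proof -
  obtain k where k: "\<And>v. F (A *v v) = k *s (A *v F v)" using lift_equivariant[OF g eq A] by blast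
  obtain v :: "complex^3" where v: "line_prod klein_theta (v$1) (v$2) (v$3) \<noteq> 0" by (rule line_prod_nontrivial)
  have inv: "invertible A" using A invertible_cube_group invertible_klein_Q by blast
  have "det (jacobian_mat F (A *v v)) = k^3 * det (jacobian_mat F v)"
  proof (rule det_jacobian_equivariant)
    show "homog_poly d (\<lambda>v. F v $ i)" for i using g by (simp add: is_lift_def)
  qed (rule k inv)+
  moreover have "line_prod klein_theta ((A *v v)$1) ((A *v v)$2) ((A *v v)$3) = line_prod klein_theta (v$1) (v$2) (v$3)"
    using A line_prod_cube_group line_prod_klein_Q by metis
  ultimately have k3: "k^3 = 1" using v c by (simp add: D)
  define e :: "complex^3" where "e = axis 1 1"
  have "F e \<noteq> 0" using g by (simp add: is_lift_def e_def axis_eq_0_iff)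
  have "F e = F (A *v (A *v (A *v (A *v e))))" by (simp add: A4)
  also have "\<dots> = k^4 *s (A *v (A *v (A *v (A *v F e))))"
    unfolding k by (simp add: vector_scalar_commute vector_smult_assoc power_numeral_reduce)
  finally have "(k^4 - 1) *s F e = 0" by (simp add: A4 vector_sub_rdistrib)
  then have "k^4 = 1" using \<open>F e \<noteq> 0\<close> unfolding vector_mul_eq_0 by simp
  then have "k * k^3 = 1" by (simp add: power_numeral_reduce)
  then show ?thesis using k k3 by simp
qed

section \<open>The coefficients of a lift with the symmetries of the cube\<close>

lemma double_power_sum_eq_0:
  fixes b :: "nat \<Rightarrow> nat \<Rightarrow> complex"
  assumes "\<And>x y. (\<Sum>i\<le>n. \<Sum>j\<le>n. b i j * x^i * y^j) = 0" and "i \<le> n" "j \<le> n"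
  shows "b i j = 0"
proof -
  have "(\<Sum>j\<le>n. b i j * y^j) = 0" for y
  proof -
    have "(\<Sum>i\<le>n. (\<Sum>j\<le>n. b i j * y^j) * x^i) = 0" for x
    proof -
      have "(\<Sum>i\<le>n. (\<Sum>j\<le>n. b i j * y^j) * x^i) = (\<Sum>i\<le>n. \<Sum>j\<le>n. b i j * x^i * y^j)"
        unfolding sum_distrib_right by (intro sum.cong refl) (simp only: mult_ac)
      then show ?thesis by (simp only: assms(1))
    qed
    then have "\<forall>x. (\<Sum>i\<le>n. (\<Sum>j\<le>n. b i j * y^j) * x^i) = 0" by blast
    then show ?thesis using assms(2) unfolding polyfun_eq_0 by blast
  qed
  then have "\<forall>y. (\<Sum>j\<le>n. b i j * y^j) = 0" by blast
  then show ?thesis using assms(3) unfolding polyfun_eq_0 by blast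
qed

lemma sum_even_le_15:
  fixes f :: "nat \<Rightarrow> complex"
  assumes "\<And>i. odd i \<Longrightarrow> f i = 0"
  shows "(\<Sum>i\<le>15. f i) = f 0 + f 2 + f 4 + f 6 + f 8 + f 10 + f 12 + f 14"
proof -
  have "(\<Sum>i\<le>15. f i) = (\<Sum>i\<in>{0, 2, 4, 6, 8, 10, 12, 14}. f i)"
  proof (rule sum.mono_neutral_right)
    show "\<forall>i\<in>{..15} - {0, 2, 4, 6, 8, 10, 12, 14}. f i = 0"
    proof
      fix i :: nat
      assume i: "i \<in> {..15} - {0, 2, 4, 6, 8, 10, 12, 14}"
      then have "odd i" by (auto elim!: evenE)
      then show "f i = 0" by (rule assms)
    qed
  qed auto
  then show ?thesis by (simp add: add_ac)
qed

text \<open>A square index range padded with zeros lets the two exponents be exchanged and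
  coefficients be compared. The truncated exponent \<open>d - i - j\<close> does no harm, since the
  padded coefficients vanish.\<close>

lemma homog_poly_square_sum:
  fixes p :: "complex^3 \<Rightarrow> complex"
  assumes "homog_poly d p"
  obtains b where "\<And>v. p v = (\<Sum>i\<le>d. \<Sum>j\<le>d. b i j * (v$1)^i * (v$2)^j * (v$3)^(d - i - j))"
    "\<And>i j. i + j > d \<Longrightarrow> b i j = 0"
proof -
  obtain a where a: "\<And>v. p v = (\<Sum>i\<le>d. \<Sum>j\<le>d - i. a i j * (v$1)^i * (v$2)^j * (v$3)^(d - i - j))"
    using assms unfolding homog_poly_def by blast
  define b where "b = (\<lambda>i j. if i + j \<le> d then a i j else 0)"
  have "p v = (\<Sum>i\<le>d. \<Sum>j\<le>d. b i j * (v$1)^i * (v$2)^j * (v$3)^(d - i - j))" for v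
    unfolding a
  proof (rule sum.cong[OF refl])
    fix i assume "i \<in> {..d}"
    then have "(\<Sum>j\<le>d - i. b i j * (v$1)^i * (v$2)^j * (v$3)^(d - i - j))
        = (\<Sum>j\<le>d. b i j * (v$1)^i * (v$2)^j * (v$3)^(d - i - j))"
      by (intro sum.mono_neutral_left) (auto simp: b_def)
    moreover have "(\<Sum>j\<le>d - i. a i j * (v$1)^i * (v$2)^j * (v$3)^(d - i - j))
        = (\<Sum>j\<le>d - i. b i j * (v$1)^i * (v$2)^j * (v$3)^(d - i - j))"
      using \<open>i \<in> {..d}\<close> by (intro sum.cong) (auto simp: b_def)
    ultimately show "(\<Sum>j\<le>d - i. a i j * (v$1)^i * (v$2)^j * (v$3)^(d - i - j))
        = (\<Sum>j\<le>d. b i j * (v$1)^i * (v$2)^j * (v$3)^(d - i - j))" by simp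
  qed
  then show ?thesis by (rule that) (simp add: b_def)
qed

text \<open>The even symmetric form of degree 14 that may occur as the coefficient of
  \<open>z\<close> in the third component. It is the part that the Jacobian condition will
  remove.\<close>

definition edge_form :: "complex \<Rightarrow> complex \<Rightarrow> complex \<Rightarrow> complex \<Rightarrow> complex \<Rightarrow> complex \<Rightarrow> complex" where
  "edge_form r0 r1 r2 r3 x y = r0 * (x^14 + y^14) + r1 * (x^12 * y^2 + x^2 * y^12)
    + r2 * (x^10 * y^4 + x^4 * y^10) + r3 * (x^8 * y^6 + x^6 * y^8)"

text \<open>Compare coefficients of x^i y^j: \<open>E1\<close> makes i + j even, \<open>E2\<close>
  makes i even, hence both exponents are even and that of \<open>z\<close> is odd, and then
  \<open>E3\<close> makes the coefficients symmetric. The value \<open>c 7 0\<close> belongs to x^14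
  z and is not read by \<open>sym_sextic\<close>.\<close>

lemma third_component_form:
  fixes p :: "complex^3 \<Rightarrow> complex"
  assumes hp: "homog_poly 15 p"
    and E1: "\<And>x y z. p (vector [- x, - y, z]) = p (vector [x, y, z])"
    and E2: "\<And>x y z. p (vector [x, - y, - z]) = - p (vector [x, y, z])"
    and E3: "\<And>x y z. p (vector [y, x, - z]) = - p (vector [x, y, z])"
  obtains c r1 r2 r3 where "\<And>x y z. p (vector [x, y, z])
    = z * edge_form (c 7 0) r1 r2 r3 x y + z^3 * sym_sextic c (z^2) (x^2) (y^2)"
proof -
  obtain b where b: "\<And>v. p v = (\<Sum>i\<le>15. \<Sum>j\<le>15. b i j * (v$1)^i * (v$2)^j * (v$3)^(15 - i - j))"
    and b0: "\<And>i j. i + j > 15 \<Longrightarrow> b i j = 0"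
    using homog_poly_square_sum[OF hp] by blast
  have pv: "p (vector [x, y, z]) = (\<Sum>i\<le>15. \<Sum>j\<le>15. b i j * x^i * y^j * z^(15 - i - j))" for x y z
    unfolding b by simp
  have par: "b i j = 0" if "odd (i + j)" for i j
  proof (cases "i \<le> 15 \<and> j \<le> 15")
    case True
    have "(\<Sum>i\<le>15. \<Sum>j\<le>15. (((- 1)^(i + j) - 1) * b i j) * x^i * y^j) = 0" for x y
    proof -
      have "(\<Sum>i\<le>15. \<Sum>j\<le>15. (((- 1)^(i + j) - 1) * b i j) * x^i * y^j)
          = p (vector [- x, - y, 1]) - p (vector [x, y, 1])"
        unfolding pv sum_subtractf[symmetric]
        by (intro sum.cong refl) (simp add: power_add power_minus[of x] power_minus[of y] algebra_simps)
      then show ?thesis by (simp add: E1)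
    qed
    from double_power_sum_eq_0[OF this] have "((- 1)^(i + j) - 1) * b i j = 0" using True by blast
    then show ?thesis using that by simp
  qed (use b0[of i j] in auto)
  have par1: "b i j = 0" if "odd i" for i j
  proof (cases "i + j \<le> 15")
    case True
    have "(\<Sum>i\<le>15. \<Sum>j\<le>15. ((1 - (- 1)^i) * b i j) * x^i * y^j) = 0" for x y
    proof -
      have s: "b i j * x^i * (- y)^j * (- 1)^(15 - i - j) + b i j * x^i * y^j * 1^(15 - i - j) = (1 - (- 1)^i) * b i j * x^i * y^j" for i j
      proof (cases "i + j \<le> 15")
        case True
        have "(- 1)^j * (- 1)^(15 - i - j) = ((- 1)^(15 - i) :: complex)"
          using True by (simp flip: power_add)
        also have "\<dots> = - ((- 1)^i)" using True by (cases "even i") (simp_all add: minus_one_power_iff)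
        finally have sgn: "(- 1)^j * (- 1)^(15 - i - j) = - ((- 1)^i :: complex)" .
        have "b i j * x^i * (- y)^j * (- 1)^(15 - i - j) = ((- 1)^j * (- 1)^(15 - i - j)) * (b i j * x^i * y^j)"
          unfolding power_minus[of y] by (simp only: mult_ac)
        then have "b i j * x^i * (- y)^j * (- 1)^(15 - i - j) = - ((- 1)^i) * (b i j * x^i * y^j)"
          by (simp only: sgn)
        then show ?thesis by (simp add: algebra_simps)
      qed (simp add: b0)
      have "(\<Sum>i\<le>15. \<Sum>j\<le>15. ((1 - (- 1)^i) * b i j) * x^i * y^j)
          = p (vector [x, - y, - 1]) + p (vector [x, y, 1])"
        unfolding pv sum.distrib[symmetric] s ..
      then show ?thesis by (simp add: E2)
    qed
    from double_power_sum_eq_0[OF this] have "(1 - (- 1)^i) * b i j = 0" using True by simp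
    then show ?thesis using that by simp
  qed (use b0[of i j] in auto)
  have par2: "b i j = 0" if "odd j" for i j
    using par[of i j] par1[of i j] that by auto
  have sym: "b i j = b j i" for i j
  proof (cases "i \<le> 15 \<and> j \<le> 15")
    case True
    have "(\<Sum>i\<le>15. \<Sum>j\<le>15. (b i j - b j i) * x^i * y^j) = 0" for x y
    proof -
      have s: "b j i * y^j * x^i * (- 1)^(15 - j - i) = - (b j i * x^i * y^j)" for i j
      proof (cases "i + j \<le> 15 \<and> even (i + j)")
        case True
        then have "odd (15 - j - i)" by auto
        then show ?thesis by (simp add: mult_ac)
      qed (use b0[of j i] par[of j i] in \<open>auto simp: add.commute\<close>)
      have "(\<Sum>i\<le>15. \<Sum>j\<le>15. b i j * y^i * x^j * (- 1)^(15 - i - j)) = (\<Sum>i\<le>15. \<Sum>j\<le>15. - (b j i * x^i * y^j))"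
        by (subst sum.swap) (simp only: s)
      then have "p (vector [x, y, 1]) + p (vector [y, x, - 1]) = (\<Sum>i\<le>15. \<Sum>j\<le>15. (b i j - b j i) * x^i * y^j)"
        unfolding pv by (simp add: sum.distrib[symmetric] sum_negf left_diff_distrib sum_subtractf)
      then show ?thesis by (simp add: E3)
    qed
    from double_power_sum_eq_0[OF this] show ?thesis using True by simp
  next
    case False
    then show ?thesis using b0[of i j] b0[of j i] by auto
  qed
  define c where "c = (\<lambda>j k. b (2 * j) (2 * k))"
  \<comment> \<open>One name for each coefficient up to symmetry, so that the final identity is one
    between polynomials in free variables.\<close>
  obtain b00 b10 b11 b20 b21 b22 b30 b31 b32 b33 b40 b41 b42 b43 b50 b51 b52 b60 b61 b70 where B: "b 0 0 = b00"
    "b 0 2 = b10"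
    "b 0 4 = b20"
    "b 0 6 = b30"
    "b 0 8 = b40"
    "b 0 10 = b50"
    "b 0 12 = b60"
    "b 0 14 = b70"
    "b 2 0 = b10"
    "b 2 2 = b11"
    "b 2 4 = b21"
    "b 2 6 = b31"
    "b 2 8 = b41"
    "b 2 10 = b51"
    "b 2 12 = b61"
    "b 4 0 = b20"
    "b 4 2 = b21"
    "b 4 4 = b22"
    "b 4 6 = b32"
    "b 4 8 = b42"
    "b 4 10 = b52"
    "b 6 0 = b30"
    "b 6 2 = b31"
    "b 6 4 = b32"
    "b 6 6 = b33"
    "b 6 8 = b43"
    "b 8 0 = b40"
    "b 8 2 = b41"
    "b 8 4 = b42"
    "b 8 6 = b43"
    "b 10 0 = b50"
    "b 10 2 = b51"
    "b 10 4 = b52"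
    "b 12 0 = b60"
    "b 12 2 = b61"
    "b 14 0 = b70"
    using sym[of 0 2] sym[of 0 4] sym[of 0 6] sym[of 0 8] sym[of 0 10] sym[of 0 12] sym[of 0 14] sym[of 2 4] sym[of 2 6] sym[of 2 8] sym[of 2 10] sym[of 2 12] sym[of 4 6] sym[of 4 8] sym[of 4 10] sym[of 6 8] by blast
  have Z: "b 2 14 = 0" "b 4 12 = 0" "b 4 14 = 0" "b 6 10 = 0" "b 6 12 = 0" "b 6 14 = 0" "b 8 8 = 0" "b 8 10 = 0" "b 8 12 = 0" "b 8 14 = 0" "b 10 6 = 0" "b 10 8 = 0" "b 10 10 = 0" "b 10 12 = 0" "b 10 14 = 0" "b 12 4 = 0" "b 12 6 = 0" "b 12 8 = 0" "b 12 10 = 0" "b 12 12 = 0" "b 12 14 = 0" "b 14 2 = 0" "b 14 4 = 0" "b 14 6 = 0" "b 14 8 = 0" "b 14 10 = 0" "b 14 12 = 0" "b 14 14 = 0"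
    by (rule b0; simp)+
  have C: "c 0 0 = b00" "c 1 0 = b10" "c 1 1 = b11" "c 2 0 = b20" "c 2 1 = b21" "c 2 2 = b22" "c 3 0 = b30" "c 3 1 = b31" "c 3 2 = b32" "c 3 3 = b33" "c 4 0 = b40" "c 4 1 = b41" "c 4 2 = b42" "c 4 3 = b43" "c 5 0 = b50" "c 5 1 = b51" "c 5 2 = b52" "c 6 0 = b60" "c 6 1 = b61" "c 7 0 = b70"
    by (simp_all add: c_def B)
  have "p (vector [x, y, z]) = z * edge_form (c 7 0) (c 6 1) (c 5 2) (c 4 3) x y + z^3 * sym_sextic c (z^2) (x^2) (y^2)" for x y z
  proof -
    have row: "(\<Sum>j\<le>15. b i j * x^i * y^j * z^(15 - i - j)) = b i 0 * x^i * y^0 * z^(15 - i - 0) + b i 2 * x^i * y^2 * z^(15 - i - 2)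
        + b i 4 * x^i * y^4 * z^(15 - i - 4) + b i 6 * x^i * y^6 * z^(15 - i - 6)
        + b i 8 * x^i * y^8 * z^(15 - i - 8) + b i 10 * x^i * y^10 * z^(15 - i - 10)
        + b i 12 * x^i * y^12 * z^(15 - i - 12) + b i 14 * x^i * y^14 * z^(15 - i - 14)" for i
      by (rule sum_even_le_15) (simp add: par2)
    have "p (vector [x, y, z]) = (\<Sum>i\<le>15. (\<Sum>j\<le>15. b i j * x^i * y^j * z^(15 - i - j)))" by (rule pv)
    also have "\<dots> = (\<Sum>j\<le>15. b 0 j * x^0 * y^j * z^(15 - 0 - j))
        + (\<Sum>j\<le>15. b 2 j * x^2 * y^j * z^(15 - 2 - j))
        + (\<Sum>j\<le>15. b 4 j * x^4 * y^j * z^(15 - 4 - j))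
        + (\<Sum>j\<le>15. b 6 j * x^6 * y^j * z^(15 - 6 - j))
        + (\<Sum>j\<le>15. b 8 j * x^8 * y^j * z^(15 - 8 - j))
        + (\<Sum>j\<le>15. b 10 j * x^10 * y^j * z^(15 - 10 - j))
        + (\<Sum>j\<le>15. b 12 j * x^12 * y^j * z^(15 - 12 - j))
        + (\<Sum>j\<le>15. b 14 j * x^14 * y^j * z^(15 - 14 - j))"
      by (rule sum_even_le_15) (simp add: par1)
    also have "\<dots> = (b00 * z^15 + b10 * y^2 * z^13 + b20 * y^4 * z^11 + b30 * y^6 * z^9 + b40 * y^8 * z^7 + b50 * y^10 * z^5 + b60 * y^12 * z^3 + b70 * y^14 * z)
        + (b10 * x^2 * z^13 + b11 * x^2 * y^2 * z^11 + b21 * x^2 * y^4 * z^9 + b31 * x^2 * y^6 * z^7 + b41 * x^2 * y^8 * z^5 + b51 * x^2 * y^10 * z^3 + b61 * x^2 * y^12 * z)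
        + (b20 * x^4 * z^11 + b21 * x^4 * y^2 * z^9 + b22 * x^4 * y^4 * z^7 + b32 * x^4 * y^6 * z^5 + b42 * x^4 * y^8 * z^3 + b52 * x^4 * y^10 * z)
        + (b30 * x^6 * z^9 + b31 * x^6 * y^2 * z^7 + b32 * x^6 * y^4 * z^5 + b33 * x^6 * y^6 * z^3 + b43 * x^6 * y^8 * z)
        + (b40 * x^8 * z^7 + b41 * x^8 * y^2 * z^5 + b42 * x^8 * y^4 * z^3 + b43 * x^8 * y^6 * z)
        + (b50 * x^10 * z^5 + b51 * x^10 * y^2 * z^3 + b52 * x^10 * y^4 * z)
        + (b60 * x^12 * z^3 + b61 * x^12 * y^2 * z)
        + (b70 * x^14 * z)"
      by (simp only: row B Z) simp
    also have "\<dots> = z * edge_form (c 7 0) (c 6 1) (c 5 2) (c 4 3) x y + z^3 * sym_sextic c (z^2) (x^2) (y^2)"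
      unfolding edge_form_def sym_sextic_def C by (subst eq_iff_diff_eq_0) Groebner_Basis.algebra
    finally show ?thesis .
  qed
  then show ?thesis by (rule that)
qed

text \<open>Orders of vanishing at 0: the first product has the order of \<open>pderiv q\<close>,
  which is one less than that of \<open>q\<close>, while the second has at least the order of
  \<open>q\<close>.\<close>

lemma wronskian_nonzero:
  fixes p q :: "complex poly"
  assumes p: "poly p 0 \<noteq> 0" and q: "q \<noteq> 0" "poly q 0 = 0"
  shows "p * pderiv q - q * pderiv p \<noteq> 0"
proof
  assume "p * pderiv q - q * pderiv p = 0"
  then have eq: "p * pderiv q = q * pderiv p" by simp
  have "pderiv q \<noteq> 0"
  proof
    assume "pderiv q = 0"
    then obtain k where "q = [:k:]" by (auto simp: pderiv_eq_0_iff elim: degree_eq_zeroE)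
    then show False using q by simp
  qed
  then have oq: "Polynomial.order 0 q = Suc (Polynomial.order 0 (pderiv q))"
    using order_pderiv[of q 0] q by (simp add: order_root)
  have "p \<noteq> 0" using p by auto
  then have nz: "p * pderiv q \<noteq> 0" using \<open>pderiv q \<noteq> 0\<close> by simp
  have "Polynomial.order 0 p = 0" using p order_root[of p 0] by simp
  then have "Polynomial.order 0 (p * pderiv q) = Polynomial.order 0 (pderiv q)" using nz by (simp add: order_mult)
  moreover have "Polynomial.order 0 (q * pderiv p) = Polynomial.order 0 q + Polynomial.order 0 (pderiv p)"
    by (rule order_mult) (use nz eq in simp)
  ultimately show False using eq oq by simp
qed

text \<open>For an involutive \<open>s\<close> the square of the matrix is diagonal with entries 1
  or -1, so its fourth power is the identity, as \<open>lift_commutes\<close> requires.\<close>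

lemma lift_commutes_signed_permutation:
  assumes g: "is_lift d F g" and eq: "K168_equivariant g" and c: "c \<noteq> 0"
    and D: "\<And>v. det (jacobian_mat F v) = c * (line_prod klein_theta (v$1) (v$2) (v$3))^2"
    and s: "s permutes (UNIV :: 3 set)" and e: "\<And>i. e i \<in> {1, -1}"
    and det: "det (\<chi> i j. if j = s i then e i else 0 :: complex^3^3) = 1" and s2: "\<And>i. s (s i) = i"
  shows "F (\<chi> i. e i * v $ s i) = (\<chi> i. e i * F v $ s i)"
proof -
  let ?A = "\<chi> i j. if j = s i then e i else 0 :: complex^3^3"
  have "?A \<in> cube_group" by (rule cube_groupI[OF s e det])
  moreover have "?A *v (?A *v (?A *v (?A *v v))) = v" for v
  proof -
    have "e i * e i = 1" for i using e[of i] by auto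
    then have "e i * (e (s i) * (e i * (e (s i) * x))) = x" for i x by (metis mult.left_commute mult.assoc mult_1_left)
    then show ?thesis unfolding signed_permutation_mult_vec by (simp add: vec_eq_iff s2)
  qed
  ultimately have "F (?A *v v) = ?A *v F v" using lift_commutes[OF g eq _ c D] by blast
  then show ?thesis unfolding signed_permutation_mult_vec .
qed

text \<open>The square of \<open>klein_Q\<close> is the signed permutation (x, y, z) -> (y, x, -z),
  an involution.\<close>

lemma klein_Q_order_4: "klein_Q *v (klein_Q *v (klein_Q *v (klein_Q *v v))) = v"
proof -
  define t where "t = klein_theta"
  have tau: "(1 - t) * t = 2" by (rule theta_eqI[where t = t and k = "- 1"]) (simp add: t_def klein_theta_sq, Groebner_Basis.algebra)
  have Qm: "klein_Q *v u = vector [(u$1 + u$2 - t * u$3) / 2, (u$1 + u$2 + t * u$3) / 2, (1 - t) * (u$1 - u$2) / 2]" for u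
    unfolding t_def by (rule klein_Q_mult_vec)
  have "klein_Q *v (klein_Q *v u) = vector [u$2, u$1, - u$3]" for u
  proof -
    have "t * ((1 - t) * (u$1 - u$2) / 2) = (1 - t) * t * (u$1 - u$2) / 2" by simp
    then have a: "t * ((1 - t) * (u$1 - u$2) / 2) = u$1 - u$2" unfolding tau by simp
    have "(1 - t) * ((u$1 + u$2 - t * u$3) / 2 - (u$1 + u$2 + t * u$3) / 2) / 2 = - ((1 - t) * t * u$3 / 2)"
      by (simp add: field_simps)
    then have b: "(1 - t) * ((u$1 + u$2 - t * u$3) / 2 - (u$1 + u$2 + t * u$3) / 2) / 2 = - u$3" unfolding tau by simp
    show ?thesis
      unfolding Qm[of "klein_Q *v u"] unfolding Qm vector_3 a b by (simp add: vec_eq_iff forall_3 field_simps)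
  qed
  then show ?thesis by (simp add: vec_eq_iff forall_3)
qed

text \<open>On the line \<open>x\<^sub>3 = 0\<close> the Jacobian determinant is, up to a constant, the product of \<open>\<partial>F\<^sub>3/\<partial>x\<^sub>3\<close> and the Wronskian of
  the restrictions of \<open>F\<^sub>1\<close> and \<open>F\<^sub>2\<close>. It vanishes there, so \<open>x\<^sub>3\<^sup>3\<close> divides \<open>F\<^sub>3\<close>.\<close>

lemma lift_is_sextic_map:
  assumes g: "is_lift 15 F g" and eq: "K168_equivariant g" and c0: "c0 \<noteq> 0"
    and D: "\<And>v. det (jacobian_mat F v) = c0 * (line_prod klein_theta (v$1) (v$2) (v$3))^2"
  obtains c where "\<And>v. F v = sextic_map c v"
proof -
  note comm = lift_commutes_signed_permutation[OF g eq c0 D]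
  have hp: "homog_poly 15 (\<lambda>v. F v $ i)" for i using g by (simp add: is_lift_def)
  have eta: "v = vector [v$1, v$2, v$3]" for v :: "complex^3" by (simp add: vec_eq_iff forall_3)
  define r where "r = (\<lambda>i j :: 3. Transposition.transpose i j)"
  have r: "r i j permutes UNIV" "r i j (r i j k) = k" for i j k
    unfolding r_def by (auto intro: permutes_swap_id)
  have r12: "r 1 2 1 = 2" "r 1 2 2 = 1" "r 1 2 3 = 3" and r23: "r 2 3 1 = 1" "r 2 3 2 = 3" "r 2 3 3 = 2"
    by (simp_all add: r_def Transposition.transpose_def)
  \<comment> \<open>\<open>e i\<close> is the half turn about the i-th axis. The single sign in
    \<open>e' i\<close> compensates the determinant of a transposition.\<close>
  define e where "e = (\<lambda>i j :: 3. if j = i then 1 else - 1 :: complex)"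
  define e' where "e' = (\<lambda>i j :: 3. if j = i then - 1 else 1 :: complex)"
  have ev: "e i j \<in> {1, - 1}" "e' i j \<in> {1, - 1}" for i j by (simp_all add: e_def e'_def)
  have E1: "F (vector [- x, - y, z]) = vector [- a, - b, c]" if "F (vector [x, y, z]) = vector [a, b, c]" for x y z a b c
  proof -
    have "F (\<chi> i. e 3 i * vector [x, y, z] $ id i) = (\<chi> i. e 3 i * F (vector [x, y, z]) $ id i)"
      by (rule comm[OF permutes_id ev(1)]) (simp_all add: det_3 e_def)
    moreover have "(\<chi> i. e 3 i * vector [x, y, z] $ id i) = vector [- x, - y, z]" for x y z
      by (simp add: vec_eq_iff forall_3 e_def)
    ultimately show ?thesis using that by simp
  qed
  have E2: "F (vector [x, - y, - z]) = vector [a, - b, - c]" if "F (vector [x, y, z]) = vector [a, b, c]" for x y z a b c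
  proof -
    have "F (\<chi> i. e 1 i * vector [x, y, z] $ id i) = (\<chi> i. e 1 i * F (vector [x, y, z]) $ id i)"
      by (rule comm[OF permutes_id ev(1)]) (simp_all add: det_3 e_def)
    moreover have "(\<chi> i. e 1 i * vector [x, y, z] $ id i) = vector [x, - y, - z]" for x y z
      by (simp add: vec_eq_iff forall_3 e_def)
    ultimately show ?thesis using that by simp
  qed
  have E3: "F (vector [y, x, - z]) = vector [b, a, - c]" if "F (vector [x, y, z]) = vector [a, b, c]" for x y z a b c
  proof -
    have "F (\<chi> i. e' 3 i * vector [x, y, z] $ r 1 2 i) = (\<chi> i. e' 3 i * F (vector [x, y, z]) $ r 1 2 i)"
      by (rule comm[OF r(1) ev(2) _ r(2)]) (simp add: det_3 e'_def r12)
    moreover have "(\<chi> i. e' 3 i * vector [x, y, z] $ r 1 2 i) = vector [y, x, - z]" for x y z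
      by (simp add: vec_eq_iff forall_3 e'_def r12)
    ultimately show ?thesis using that by simp
  qed
  have E4: "F (vector [- x, z, y]) = vector [- a, c, b]" if "F (vector [x, y, z]) = vector [a, b, c]" for x y z a b c
  proof -
    have "F (\<chi> i. e' 1 i * vector [x, y, z] $ r 2 3 i) = (\<chi> i. e' 1 i * F (vector [x, y, z]) $ r 2 3 i)"
      by (rule comm[OF r(1) ev(2) _ r(2)]) (simp add: det_3 e'_def r23)
    moreover have "(\<chi> i. e' 1 i * vector [x, y, z] $ r 2 3 i) = vector [- x, z, y]" for x y z
      by (simp add: vec_eq_iff forall_3 e'_def r23)
    ultimately show ?thesis using that by simp
  qed
  obtain c r1 r2 r3 where F3: "\<And>x y z. F (vector [x, y, z]) $ 3
      = z * edge_form (c 7 0) r1 r2 r3 x y + z^3 * sym_sextic c (z^2) (x^2) (y^2)"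
  proof (rule third_component_form[of "\<lambda>v. F v $ 3", OF hp])
    fix x y z
    show "F (vector [- x, - y, z]) $ 3 = F (vector [x, y, z]) $ 3" using E1[OF eta] by simp
    show "F (vector [x, - y, - z]) $ 3 = - F (vector [x, y, z]) $ 3" using E2[OF eta] by simp
    show "F (vector [y, x, - z]) $ 3 = - F (vector [x, y, z]) $ 3" using E3[OF eta] by simp
  qed (rule that)
  have F2: "F (vector [x, y, z]) $ 2 = F (vector [x, z, y]) $ 3" for x y z
  proof -
    have "F (vector [x, y, z]) $ 2 = F (vector [- x, z, y]) $ 3" using E4[OF eta, where x = x and y = y and z = z] by simp
    also have "\<dots> = F (vector [x, z, y]) $ 3" unfolding F3 by (simp add: edge_form_def)
    finally show ?thesis .
  qed
  have F1: "F (vector [x, y, z]) $ 1 = F (vector [y, z, x]) $ 3" for x y z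
  proof -
    have "F (vector [x, y, z]) $ 1 = F (vector [y, x, - z]) $ 2" using E3[OF eta, where x = x and y = y and z = z] by simp
    also have "\<dots> = F (vector [y, - z, x]) $ 3" by (rule F2)
    also have "\<dots> = F (vector [y, z, x]) $ 3" unfolding F3 by (simp add: edge_form_def)
    finally show ?thesis .
  qed
  \<comment> \<open>\<open>P\<close> and \<open>Q\<close> are the first two components at the points
    (1, s, 0), and \<open>R\<close> is the derivative of the third one in x_3 there.\<close>
  define P where "P = [:c 0 0, 0, c 1 0, 0, c 2 0, 0, c 3 0, 0, c 4 0, 0, c 5 0, 0, c 6 0, 0, c 7 0:]"
  define Q where "Q = [:0, c 7 0, 0, c 6 0, 0, c 5 0, 0, c 4 0, 0, c 3 0, 0, c 2 0, 0, c 1 0, 0, c 0 0:]"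
  define R where "R = [:c 7 0, 0, r1, 0, r2, 0, r3, 0, r3, 0, r2, 0, r1, 0, c 7 0:]"
  have P: "F (vector [1, s, 0]) $ 1 = poly P s" for s
    unfolding F1 F3 P_def by (simp add: edge_form_def sym_sextic_def power_numeral_reduce algebra_simps)
  have Q: "F (vector [1, s, 0]) $ 2 = poly Q s" for s
    unfolding F2 F3 Q_def by (simp add: edge_form_def sym_sextic_def power_numeral_reduce algebra_simps)
  have R: "edge_form (c 7 0) r1 r2 r3 1 s = poly R s" for s
    unfolding R_def by (simp add: edge_form_def power_numeral_reduce algebra_simps)
  have "poly (R * (P * pderiv Q - Q * pderiv P)) s = 0" for s
  proof -
    define v :: "complex^3" where "v = vector [1, s, 0]"
    define J where "J = jacobian_mat F v"
    have dir: "J $ i $ j = D" if "((\<lambda>t. F (v + t *s axis j 1) $ i) has_field_derivative D) (at 0)" for i j D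
      using DERIV_imp_deriv[OF that] by (simp add: J_def jacobian_mat_def)
    have dv: "v + t *s axis 1 1 = vector [1 + t, s, 0]" "v + t *s axis 2 1 = vector [1, s + t, 0]"
      "v + t *s axis 3 1 = vector [1, s, t]" for t
      by (simp_all add: v_def vec_eq_iff forall_3 axis_def)
    have J31: "J $ 3 $ 1 = 0" by (rule dir) (simp add: dv F3)
    have J32: "J $ 3 $ 2 = 0" by (rule dir) (simp add: dv F3)
    have J33: "J $ 3 $ 3 = poly R s"
    proof (rule dir)
      have "((\<lambda>t. t * poly R s + t^3 * sym_sextic c (t^2) (1^2) (s^2)) has_field_derivative poly R s) (at 0)"
      proof -
        have "((\<lambda>t. sym_sextic c (t^2) (1^2) (s^2)) has_field_derivative
            sym_sextic_dx c (0^2) (1^2) (s^2) * 0 + sym_sextic_dy c (0^2) (1^2) (s^2) * 0 + sym_sextic_dy c (0^2) (s^2) (1^2) * 0) (at 0)"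
          by (rule has_field_derivative_sym_sextic[where x = "\<lambda>t. t^2" and y = "\<lambda>t. 1^2" and z = "\<lambda>t. s^2"])
            (auto intro!: derivative_eq_intros)
        then show ?thesis by (auto intro!: derivative_eq_intros)
      qed
      then show "((\<lambda>t. F (v + t *s axis 3 1) $ 3) has_field_derivative poly R s) (at 0)"
        unfolding dv F3 R .
    qed
    have shift: "((\<lambda>t. poly p (s + t)) has_field_derivative poly (pderiv p) s) (at 0)" for p :: "complex poly"
      using DERIV_chain'[of "\<lambda>t. s + t" 1 0 UNIV "poly p" "poly (pderiv p) s"] poly_DERIV[of p s]
      by (auto intro!: derivative_eq_intros)
    have J12: "J $ 1 $ 2 = poly (pderiv P) s" by (rule dir) (simp only: dv P shift)
    have J22: "J $ 2 $ 2 = poly (pderiv Q) s" by (rule dir) (simp only: dv Q shift)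
    \<comment> \<open>Euler's formula yields the first column of \<open>J\<close> from the second
      one, because the third coordinate of \<open>v\<close> is 0.\<close>
    have euler: "J *v v = 15 *s F v" using jacobian_euler[OF hp] by (simp add: J_def)
    have "(J *v v) $ i = J $ i $ 1 + J $ i $ 2 * s" for i
      by (simp add: matrix_vector_mult_def sum_3 v_def)
    then have row: "15 * F (vector [1, s, 0]) $ i = J $ i $ 1 + J $ i $ 2 * s" for i
      unfolding euler by (simp add: v_def)
    have J11: "J $ 1 $ 1 = 15 * poly P s - poly (pderiv P) s * s" and J21: "J $ 2 $ 1 = 15 * poly Q s - poly (pderiv Q) s * s"
      using row[of 1] row[of 2] unfolding P Q J12 J22 by (simp_all only: eq_diff_eq)
    have "det J = 15 * (poly R s * (poly P s * poly (pderiv Q) s - poly Q s * poly (pderiv P) s))"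
      unfolding det_3 J11 J12 J21 J22 J31 J32 J33 by (simp add: algebra_simps)
    moreover have "det J = 0" unfolding J_def D by (simp add: v_def line_prod_squares)
    ultimately show ?thesis by simp
  qed
  then have "R * (P * pderiv Q - Q * pderiv P) = 0" using poly_all_0_iff_0 by blast
  \<comment> \<open>Otherwise the lift would vanish at (1, 0, 0). Hence \<open>P\<close> is nonzero
    at 0, whereas \<open>Q\<close> vanishes there and has leading coefficient \<open>c 0 0\<close>,
    so the Wronskian is not zero.\<close>
  moreover have c00: "c 0 0 \<noteq> 0"
  proof
    assume "c 0 0 = 0"
    then have "F (vector [1, 0, 0]) = 0"
      using P[of 0] Q[of 0] F3[of 1 0 0] by (simp add: vec_eq_iff forall_3 P_def Q_def)
    moreover have "vector [1, 0, 0] \<noteq> (0 :: complex^3)" by (simp add: vector3_eq_0_iff)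
    ultimately show False using g by (simp add: is_lift_def)
  qed
  then have "P * pderiv Q - Q * pderiv P \<noteq> 0"
    by (intro wronskian_nonzero) (simp_all add: P_def Q_def)
  ultimately have "R = 0" by simp
  then have "c 7 0 = 0" "r1 = 0" "r2 = 0" "r3 = 0" by (simp_all add: R_def)
  then have F3': "F (vector [x, y, z]) $ 3 = z^3 * sym_sextic c (z^2) (x^2) (y^2)" for x y z
    unfolding F3 by (simp add: edge_form_def)
  have "F v = sextic_map c v" for v
    using F1[of "v$1" "v$2" "v$3"] F2[of "v$1" "v$2" "v$3"] F3'[of "v$1" "v$2" "v$3"]
    unfolding eta[symmetric] F3' by (simp add: sextic_map_def vec_eq_iff forall_3)
  then show ?thesis by (rule that)
qed

text \<open>Subtracting the multiple of \<open>klein_c\<close> with the same entry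
  \<open>5 0\<close> leaves an equivariant map to which \<open>sym_sextic_Q_unique\<close> applies,
  with q = (1 - t)^2. Its functional equation is the third component of equivariance in the
  coordinates X, Y, W.\<close>

lemma sextic_map_klein_unique:
  assumes Q: "\<And>v. sextic_map c (klein_Q *v v) = klein_Q *v sextic_map c v"
  obtains k where "\<And>v. sextic_map c v = k *s sextic_map klein_c v"
proof -
  define t where "t = klein_theta"
  have tt: "t * t = t - 2" by (simp add: t_def klein_theta_sq)
  define q where "q = - (1 + t)"
  define k where "k = c 5 0 / klein_c 5 0"
  \<comment> \<open>The form with denominator 1 is an instance of
    \<open>sym_sextic_lincomb\<close>.\<close>
  define d where "d = (\<lambda>i j. (c i j + (- k) * klein_c i j) / 1)"
  have dS: "sym_sextic d x y z = sym_sextic c x y z - k * sym_sextic klein_c x y z" for x y z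
    unfolding d_def sym_sextic_lincomb by simp
  have dM: "sextic_map d v = sextic_map c v - k *s sextic_map klein_c v" for v
    by (simp add: sextic_map_def vec_eq_iff forall_3 dS algebra_simps)
  have dQ: "sextic_map d (klein_Q *v v) = klein_Q *v sextic_map d v" for v
    unfolding dM Q sextic_map_klein_Q
    by (simp add: matrix_vector_mult_diff_distrib vector_scalar_commute)
  have tau: "(1 - t) * t = 2" by (rule theta_eqI[OF tt, where k = "- 1"]) Groebner_Basis.algebra
  have tq: "(1 - t) * (1 - t) = q" unfolding q_def by (rule theta_eqI[OF tt, where k = "1"]) Groebner_Basis.algebra
  have t1: "1 - t \<noteq> 0" using tau by auto
  have sq: "((1 - t) * x)^2 = q * x^2" "((1 - t) * x)^3 = (1 - t) * (q * x^3)" for x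
    unfolding tq[symmetric] by (simp_all add: power2_eq_square power3_eq_cube mult_ac)
  have Qm: "klein_Q *v u = vector [(u$1 + u$2 - t * u$3) / 2, (u$1 + u$2 + t * u$3) / 2, (1 - t) * (u$1 - u$2) / 2]" for u
    unfolding t_def by (rule klein_Q_mult_vec)
  have Qv: "klein_Q *v vector [X + Y, X - Y, (1 - t) * W] = vector [X - W, X + W, (1 - t) * Y]" for X Y W
  proof -
    have tW: "t * ((1 - t) * W) = 2 * W" using tau by (metis mult.assoc mult.commute)
    show ?thesis
      unfolding Qm vector_3 tW by (simp add: vec_eq_iff forall_3 diff_divide_distrib add_divide_distrib)
  qed
  have Q3: "(klein_Q *v v) $ 3 = (1 - t) * (v$1 - v$2) / 2" for v by (simp add: Qm)
  have "sym_sextic d x y z = 0" for x y z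
  proof (rule sym_sextic_Q_unique[where q = q])
    fix X Y W
    have "sextic_map d (vector [X - W, X + W, (1 - t) * Y]) $ 3
        = (1 - t) * (sextic_map d (vector [X + Y, X - Y, (1 - t) * W]) $ 1 - sextic_map d (vector [X + Y, X - Y, (1 - t) * W]) $ 2) / 2"
      unfolding Qv[symmetric] dQ Q3 ..
    then have "(1 - t) * (q * (Y^3 * (sym_sextic d (q * Y^2) ((X - W)^2) ((X + W)^2) * 2)))
        = (1 - t) * ((X + Y)^3 * sym_sextic d ((X + Y)^2) ((X - Y)^2) (q * W^2) - (X - Y)^3 * sym_sextic d ((X - Y)^2) ((X + Y)^2) (q * W^2))"
      by (simp add: sextic_map_def sq)
    then show "2 * q * Y^3 * sym_sextic d (q * Y^2) ((X - W)^2) ((X + W)^2)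
      = (X + Y)^3 * sym_sextic d ((X + Y)^2) ((X - Y)^2) (q * W^2) - (X - Y)^3 * sym_sextic d ((X - Y)^2) ((X + Y)^2) (q * W^2)"
      unfolding mult_cancel_left using t1 by (simp add: mult_ac)
  next
    show "q \<noteq> 0" using t1 unfolding tq[symmetric] by simp
    have q2: "q^2 = 3 * t - 1" unfolding q_def power2_eq_square by (rule theta_eqI[OF tt, where k = 1]) Groebner_Basis.algebra
    have "q^5 = q^2 * q^2 * q" by (simp add: power_numeral_reduce)
    also have "\<dots> = 23 + 11 * t" unfolding q2 unfolding q_def by (rule theta_eqI[OF tt, where k = "- 9 * t - 12"]) Groebner_Basis.algebra
    finally have "36 * q^5 + 8 = 836 + 396 * t" by simp
    moreover have "836 + 396 * t \<noteq> 0" by (simp add: t_def klein_theta_def complex_eq_iff)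
    ultimately show "36 * q^5 + 8 \<noteq> 0" by simp
    have "klein_c 5 0 \<noteq> 0"
      by (simp add: klein_c_def klein_c0_def klein_c1_def klein_theta_def complex_eq_iff)
    then show "d 5 0 = 0" by (simp add: d_def k_def)
  qed
  then have "sextic_map d v = 0" for v by (simp add: sextic_map_def vec_eq_iff forall_3)
  then show ?thesis using that[of k] dM by simp
qed

text \<open>Proportional lifts define the same map; the factor \<open>k\<close> is nonzero because
  \<open>F\<close> has no zero off the origin.\<close>

lemma klein_h_unique:
  assumes eq: "K168_equivariant g" and crit: "doubly_critical_at_lines21 g"
  shows "g = klein_h"
proof -
  obtain d F l c where F: "is_lift d F g" and l: "\<And>i. i \<in> {1..21} \<Longrightarrow> l i \<noteq> (0 :: complex^3)"
    and bij: "bij_betw (\<lambda>i. zero_line (l i)) {1..21::nat} lines21" and c: "c \<noteq> 0"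
    and det: "\<And>v. det (jacobian_mat F v) = c * (\<Prod>i=1..21. (lin_form (l i) v)^2)"
    using crit unfolding doubly_critical_at_lines21_def by blast
  obtain c' where c': "c' \<noteq> 0" "\<And>v. det (jacobian_mat F v) = c' * (line_prod klein_theta (v$1) (v$2) (v$3))^2" and "d = 15"
    using lift_jacobian[OF F l bij c det] by blast
  then have F: "is_lift 15 F g" using F by simp
  obtain a where a: "\<And>v. F v = sextic_map a v" using lift_is_sextic_map[OF F eq c'] by blast
  have "F (klein_Q *v v) = klein_Q *v F v" for v
    by (rule lift_commutes[OF F eq _ c' klein_Q_order_4]) simp
  then have "sextic_map a (klein_Q *v v) = klein_Q *v sextic_map a v" for v by (simp add: a)
  then obtain k where k: "\<And>v. sextic_map a v = k *s sextic_map klein_c v"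
    using sextic_map_klein_unique[of a] by blast
  show ?thesis
  proof
    fix p
    obtain v where v: "v \<noteq> 0" "p = cp2_pt v" by (rule cp2_pt_cases)
    have Fv: "F v = k *s sextic_map klein_c v" by (simp add: a k)
    have "F v \<noteq> 0" "g p = cp2_pt (F v)" using F v by (simp_all add: is_lift_def)
    moreover from this have "k \<noteq> 0" unfolding Fv by auto
    moreover have "klein_h p = cp2_pt (sextic_map klein_c v)" "sextic_map klein_c v \<noteq> 0"
      using is_lift_klein_h v by (simp_all add: is_lift_def)
    moreover have "cp2_pt (sextic_map klein_c v) = cp2_pt (F v)"
      using calculation Fv by (subst cp2_pt_eq_iff) auto
    ultimately show "g p = klein_h p" by simp
  qed
qed


theorem theorem5p1:
  shows "is_lift 15 klein_h_lift klein_h \<and>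
    holomorphic_cp2 klein_h \<and> K168_equivariant klein_h \<and> doubly_critical_at_lines21 klein_h \<and>
    (\<forall>g :: cp2 \<Rightarrow> cp2. holomorphic_cp2 g \<and> K168_equivariant g \<and> doubly_critical_at_lines21 g
      \<longrightarrow> g = klein_h)"
proof -
  have lift: "klein_h_lift = sextic_map klein_c" by (simp add: fun_eq_iff klein_h_lift_eq)
  have "is_lift 15 klein_h_lift klein_h" unfolding lift by (rule is_lift_klein_h)
  moreover from this have "holomorphic_cp2 klein_h" by (auto simp: holomorphic_cp2_def)
  ultimately show ?thesis
    using K168_equivariant_klein_h doubly_critical_klein_h klein_h_unique by blast
qed

end
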